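(* Let $d\ge 3$ be a fixed integer. (i) If $p=(d-1)!\,\dfrac{\ln n+c_n}{n^{d-1}}$, where $c_n\to c\in\mathbb{R}$, then as $n\to\infty$ $$P(H_d(n,p)\text{ is weak Hamiltonian})=P(\min\deg(H_d(n,p))\ge 1)+o(1)\to e^{-e^{-c}}.$$ (ii) If $m=\dfrac{n}{d}(\ln n+c_n)$, where $c_n\to c\in\mathbb{R}$, then as $n\to\infty$ $$P(H_d(n,m)\text{ is weak Hamiltonian})=P(\min\deg(H_d(n,m))\ge 1)+o(1)\to e^{-e^{-c}}.$$ Consequently, with $p$ and $m$ given by the same formulas in terms of $c_n$: for any $c_n\to-\infty$, w.h.p. $H_d(n,p)$ and $H_d(n,m)$ are not weak Hamiltonian, and for any $c_n\to\infty$, w.h.p. $H_d(n,p)$ and $H_d(n,m)$ are weak Hamiltonian.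
   Context: A $d$-uniform hypergraph is a pair $(V,E)$ with $E\subseteq\binom{V}{d}$ (the $d$-element subsets of $V$); elements of $E$ are called edges. $H_d(n,p)$ is the random $d$-uniform hypergraph on $[n]=\{1,\dots,n\}$ in which each of the $\binom nd$ potential edges is present with probability $p$, independently. $H_d(n,m)$ is the random $d$-uniform hypergraph on $[n]$ whose edge set is chosen uniformly at random among all sets of $m$ potential edges. (It is understood that $p\in[0,1]$ and that $m$ is an integer with $0\le m\le\binom nd$.) The degree of a vertex is the number of edges containing it; $\min\deg(H)$ is the minimum degree. A weak (Berge) cycle of length $\ell\ge 3$ is an alternating sequence $(v_0,e_1,v_1,\dots,e_\ell,v_\ell=v_0)$ of vertices and edges such that $v_0,\dots,v_{\ell-1}$ are distinct and $v_{i-1},v_i\in e_i$ for each $i$; the edges $e_1,\dots,e_\ell$ need not be distinct. It spans the vertices $v_0,\dots,v_{\ell-1}$. A weak Hamilton cycle is a weak cycle spanning the entire vertex set, and a hypergraph is weak Hamiltonian if it contains a weak Hamilton cycle. "W.h.p." means with probability tending to $1$ as $n\to\infty$. *)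

theory Defs
  imports "HOL-Probability.Probability" "HOL-Library.Ramsey" "HOL-Library.Landau_Symbols"
begin

type_synonym 'a hypergraph = "'a set \<times> 'a set set"

abbreviation verts :: "'a hypergraph \<Rightarrow> 'a set" where
  "verts H \<equiv> fst H"

abbreviation edges :: "'a hypergraph \<Rightarrow> 'a set set" where
  "edges H \<equiv> snd H"

definition uniform_hypergraph :: "nat \<Rightarrow> 'a hypergraph \<Rightarrow> bool" where
  "uniform_hypergraph d H \<longleftrightarrow> edges H \<subseteq> nsets (verts H) d"

definition degree :: "'a hypergraph \<Rightarrow> 'a \<Rightarrow> nat" where
  "degree H v = card {e \<in> edges H. v \<in> e}"

text \<open>Only meaningful for a finite nonempty vertex set.\<close>
definition min_degree :: "'a hypergraph \<Rightarrow> nat" where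
  "min_degree H = Min (degree H ` verts H)"

text \<open>The sequence \<open>v 0, e 1, v 1, \<dots>, e l, v l = v 0\<close>; values of \<open>v\<close> and \<open>e\<close> at
  other indices are irrelevant. The edges \<open>e i\<close> may repeat.\<close>
definition weak_cycle :: "'a hypergraph \<Rightarrow> nat \<Rightarrow> (nat \<Rightarrow> 'a) \<Rightarrow> (nat \<Rightarrow> 'a set) \<Rightarrow> bool" where
  "weak_cycle H l v e \<longleftrightarrow>
     3 \<le> l \<and> v l = v 0 \<and> inj_on v {..<l} \<and> v ` {..<l} \<subseteq> verts H \<and>
     (\<forall>i\<in>{1..l}. e i \<in> edges H \<and> v (i - 1) \<in> e i \<and> v i \<in> e i)"

definition weak_hamiltonian :: "'a hypergraph \<Rightarrow> bool" where
  "weak_hamiltonian H \<longleftrightarrow> (\<exists>l v e. weak_cycle H l v e \<and> v ` {..<l} = verts H)"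

text \<open>The model $H_d(n,p)$, for \<open>p\<close> in the unit interval.\<close>
definition hyp_np :: "nat \<Rightarrow> nat \<Rightarrow> real \<Rightarrow> nat hypergraph pmf" where
  "hyp_np d n p =
     map_pmf (\<lambda>b. ({1..n}, {e \<in> nsets {1..n} d. b e}))
       (Pi_pmf (nsets {1..n} d) False (\<lambda>_. bernoulli_pmf p))"

text \<open>The model $H_d(n,m)$, for \<open>m \<le> n choose d\<close> (otherwise the underlying set is empty
  and \<open>pmf_of_set\<close> is unspecified).\<close>
definition hyp_nm :: "nat \<Rightarrow> nat \<Rightarrow> nat \<Rightarrow> nat hypergraph pmf" where
  "hyp_nm d n m =
     pmf_of_set {H. uniform_hypergraph d H \<and> verts H = {1..n} \<and> card (edges H) = m}"

end

theory Submission
  imports Defs "HOL-Real_Asymp.Real_Asymp"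
begin

text \<open>
  Call two vertices linked if some edge contains both. Because edges of a weak cycle may repeat, a
  hypergraph is weak Hamiltonian exactly when its graph of linked pairs has a Hamilton cycle. A vertex
  in no edge rules this out, and the theorem says that near the threshold nothing else does. So there
  are two things to show at $p = (d-1)!\,(\ln n + x)/n^{d-1}$ for a constant $x$, followed by a
  transfer to the hypotheses of the theorem.

  \<^bold>\<open>Isolated vertices.\<close> The expected number of $j$-sets of isolated vertices tends to $e^{-jx}/j!$, so
  Bonferroni's inequalities give $P(\min\deg \ge 1) \to e^{-e^{-x}}$ (\<open>prob_covering_tendsto\<close>).

  \<^bold>\<open>No other obstruction.\<close> Posa's rotations (\<open>posa_lemma\<close>) show that if every vertex set $U$ with
  $4|U| \le n$ has at least $2|U|$ outside neighbours, then there are at least $n^2/16$ ordered pairs joined by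
  a longest path; a constant fraction of all $d$-sets contains such a pair. Call these $d$-sets
  boosters. Adding a booster to a non-Hamiltonian hypergraph with this expansion lengthens its
  longest path or closes it to a Hamilton cycle.

  Now suppose that $H$ covers all vertices but is not weak Hamiltonian. If $H$ has a sub-hypergraph
  $\Gamma$ that expands and contains a longest path of $H$, then no booster of $\Gamma$ is an edge of
  $H$ (\<open>boosters_avoided\<close>). A fixed $\Gamma$ has this property with probability
  $p^{|\Gamma|}(1-p)^{\Omega(n^d)}$, where the second factor is $e^{-\Omega(n \ln n)}$. If
  $\Gamma$ has only $\epsilon n \ln n$ edges, the sum over all $\Gamma$ is still small
  (\<open>prob_sparse_certificate\<close>). The point is therefore that a sparse $\Gamma$ exists with high
  probability (\<open>sparse_booster_free_expander\<close>). It is the union of three pieces: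
  \<^item> the edges of a longest path, at most $n$;
  \<^item> $6d$ edges at each vertex, or all of them if there are fewer, which makes sets of size up to
    $n/(\ln n)^2$ expand: sets of that size span few edges, and vertices of small degree are far apart
    (\<open>small_sets_expand\<close>);
  \<^item> a sparser random hypergraph inside $H$, which makes larger sets expand
    (\<open>prob_no_sparse_mid_expander\<close>).

  The probability estimates all start from the identity
  $P(F \subseteq E,\ E \cap B = \emptyset) = p^{|F|}(1-p)^{|B|}$ for disjoint $F$ and $B$.

  \<^bold>\<open>Transfer.\<close> Both properties are increasing. By monotone coupling, the limits for constant $x$ settle
  every sequence $c_n$ at once. For $H_d(n,m)$ one compares with $H_d(n,p)$ at a slightly shifted $x$:
  the shift moves the mean number of edges by $\epsilon n/d$, which by Chebyshev exceeds the
  fluctuation of order $\sqrt{n \ln n}$.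
\<close>

section \<open>Longest paths and Posa's rotations\<close>

definition path_in :: "('a \<Rightarrow> 'a \<Rightarrow> bool) \<Rightarrow> 'a set \<Rightarrow> 'a list \<Rightarrow> bool" where
  "path_in r V P \<longleftrightarrow> P \<noteq> [] \<and> distinct P \<and> set P \<subseteq> V \<and> successively r P"

definition longest_path :: "('a \<Rightarrow> 'a \<Rightarrow> bool) \<Rightarrow> 'a set \<Rightarrow> 'a list \<Rightarrow> bool" where
  "longest_path r V P \<longleftrightarrow> path_in r V P \<and> (\<forall>Q. path_in r V Q \<longrightarrow> length Q \<le> length P)"

definition nbhd :: "('a \<Rightarrow> 'a \<Rightarrow> bool) \<Rightarrow> 'a set \<Rightarrow> 'a set \<Rightarrow> 'a set" where
  "nbhd r V U = {y \<in> V - U. \<exists>x\<in>U. r x y}"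

text \<open>
  If a longest path ends in $y$ and $y$ is adjacent to the inner vertex $x$, reversing the part of the
  path behind $x$ gives another longest path with the same first vertex.
\<close>

inductive rotation_of :: "('a \<Rightarrow> 'a \<Rightarrow> bool) \<Rightarrow> 'a list \<Rightarrow> 'a list \<Rightarrow> bool" for r P where
  start: "rotation_of r P P"
| rotate: "rotation_of r P (as @ x # bs) \<Longrightarrow> bs \<noteq> [] \<Longrightarrow> r (last bs) x \<Longrightarrow>
    rotation_of r P (as @ x # rev bs)"

text \<open>
  Stated through \<^const>\<open>successively\<close>, so that its rules for appending and reversing carry over.
\<close>

definition consecutive :: "'a list \<Rightarrow> 'a \<Rightarrow> 'a \<Rightarrow> bool" where
  "consecutive Q a b \<longleftrightarrow> \<not> successively (\<lambda>x y. \<not> (x = a \<and> y = b)) Q"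

definition path_nbs :: "'a list \<Rightarrow> 'a \<Rightarrow> 'a set" where
  "path_nbs Q w = {z. consecutive Q w z \<or> consecutive Q z w}"

lemma consecutive_Cons: "consecutive (x # bs) a b \<longleftrightarrow> bs \<noteq> [] \<and> x = a \<and> hd bs = b \<or> consecutive bs a b"
  by (auto simp: consecutive_def successively_Cons)

lemma consecutive_append: "consecutive (xs @ ys) a b \<longleftrightarrow> consecutive xs a b \<or> consecutive ys a b \<or>
    (xs \<noteq> [] \<and> ys \<noteq> [] \<and> last xs = a \<and> hd ys = b)"
  by (auto simp: consecutive_def successively_append_iff)

lemma consecutive_rev: "consecutive (rev xs) a b \<longleftrightarrow> consecutive xs b a"
  by (simp only: consecutive_def successively_rev conj_commute)

lemma consecutive_nth:
  "consecutive xs a b \<longleftrightarrow> (\<exists>i. Suc i < length xs \<and> xs ! i = a \<and> xs ! Suc i = b)"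
proof (induction xs)
  case Nil
  then show ?case by (simp add: consecutive_def)
next
  case (Cons x xs)
  have "(\<exists>i. Suc i < length (x # xs) \<and> (x # xs) ! i = a \<and> (x # xs) ! Suc i = b) \<longleftrightarrow>
     xs \<noteq> [] \<and> x = a \<and> hd xs = b \<or> (\<exists>i. Suc i < length xs \<and> xs ! i = a \<and> xs ! Suc i = b)"
    (is "(\<exists>i. ?P i) \<longleftrightarrow> _")
  proof -
    have "(\<exists>i. ?P i) \<longleftrightarrow> ?P 0 \<or> (\<exists>i. ?P (Suc i))"
      by (metis not0_implies_Suc)
    then show ?thesis by (auto simp: hd_conv_nth)
  qed
  then show ?case by (simp add: consecutive_Cons Cons.IH)
qed

lemma rotation_of_set: "rotation_of r P Q \<Longrightarrow> set Q = set P"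
  by (induction rule: rotation_of.induct) auto

lemma rotation_of_hd: "rotation_of r P Q \<Longrightarrow> hd Q = hd P"
  by (induction rule: rotation_of.induct) (auto simp: hd_append)

lemma rotation_of_length: "rotation_of r P Q \<Longrightarrow> length Q = length P"
  by (induction rule: rotation_of.induct) auto

lemma rotation_of_path_in:
  assumes "rotation_of r P Q" "path_in r V P" "symp r"
  shows "path_in r V Q"
  using assms
proof (induction rule: rotation_of.induct)
  case (rotate as x bs)
  have "r x (last bs)" using rotate by (blast dest: sympD)
  moreover have "successively (\<lambda>x y. r y x) bs = successively r bs"
    using rotate.prems(2) by (intro successively_cong) (auto dest: sympD)
  ultimately show ?case using rotate
    by (auto simp: path_in_def successively_append_iff successively_Cons hd_rev)
qed simp

lemma rotation_of_longest:
  assumes "rotation_of r P Q" "longest_path r V P" "symp r"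
  shows "longest_path r V Q"
  using assms rotation_of_path_in[OF assms(1)] rotation_of_length[OF assms(1)]
  by (auto simp: longest_path_def)

lemma longest_path_rev: "symp r \<Longrightarrow> longest_path r V P \<Longrightarrow> longest_path r V (rev P)"
proof -
  assume "symp r" and P: "longest_path r V P"
  then have "successively (\<lambda>x y. r y x) P = successively r P"
    by (intro successively_cong) (auto dest: sympD)
  with P show ?thesis by (auto simp: longest_path_def path_in_def)
qed

lemma longest_path_last_nbs:
  assumes "longest_path r V P" "symp r" "r (last P) y" "y \<in> V"
  shows "y \<in> set P"
proof (rule ccontr)
  assume "y \<notin> set P"
  then have "path_in r V (P @ [y])"
    using assms by (auto simp: longest_path_def path_in_def successively_append_iff)
  then show False using assms(1) by (force simp: longest_path_def)
qed

definition rotation_ends :: "('a \<Rightarrow> 'a \<Rightarrow> bool) \<Rightarrow> 'a list \<Rightarrow> 'a set" where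
  "rotation_ends r P = last ` {Q. rotation_of r P Q}"

text \<open>
  A rotation at $x$ removes the pair $\{x, z\}$, where $z$ becomes the new end, and adds the pair
  $\{x, y\}$, where $y$ is the old end. Both pairs contain an end of some rotated path. So the
  neighbourhood of $w$ along the path can change only if $w$ is such an end or lies next to one.
\<close>

lemma rotation_of_path_nbs:
  assumes "rotation_of r P Q" "w \<notin> rotation_ends r P" "path_nbs P w \<inter> rotation_ends r P = {}"
  shows "path_nbs Q w = path_nbs P w"
  using assms
proof (induction rule: rotation_of.induct)
  case (rotate as x bs)
  let ?Q = "as @ x # bs" and ?Q' = "as @ x # rev bs"
  have nb: "path_nbs ?Q w = path_nbs P w" using rotate by blast
  have l: "last bs \<in> rotation_ends r P"
    unfolding rotation_ends_def using rotate.hyps(1,2)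
    by (metis imageI last.simps last_appendR list.distinct(1) mem_Collect_eq)
  have "rotation_of r P ?Q'" using rotate.hyps by (rule rotation_of.rotate)
  moreover have "last ?Q' = hd bs" using rotate.hyps(2) by (simp add: last_rev)
  ultimately have h: "hd bs \<in> rotation_ends r P"
    unfolding rotation_ends_def by (metis imageI mem_Collect_eq)
  have "hd bs \<in> path_nbs ?Q x" using rotate.hyps(2)
    by (auto simp: path_nbs_def consecutive_append consecutive_Cons)
  then have "w \<noteq> x" using nb h rotate.prems by auto
  moreover have "w \<noteq> hd bs" "w \<noteq> last bs" using l h rotate.prems by auto
  ultimately have "path_nbs ?Q' w = path_nbs ?Q w"
    using rotate.hyps(2) by (auto simp: path_nbs_def consecutive_append consecutive_Cons
      consecutive_rev hd_rev)
  then show ?case using nb by simp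
qed simp

lemma rotation_ends_subset:
  assumes "longest_path r V P" "symp r"
  shows "rotation_ends r P \<subseteq> set P"
proof
  fix x assume "x \<in> rotation_ends r P"
  then obtain Q where Q: "rotation_of r P Q" "x = last Q" by (auto simp: rotation_ends_def)
  have "Q \<noteq> []" using rotation_of_length[OF Q(1)] assms(1)
    by (auto simp: longest_path_def path_in_def)
  then show "x \<in> set P" using rotation_of_set[OF Q(1)] Q(2) last_in_set by blast
qed

text \<open>
  Let $R$ be the set of ends of the rotated paths. A neighbour $w \notin R$ of an end lies on the path,
  by maximality, and rotating at $w$ makes its successor an end. If no neighbour of $w$ along the
  original path were in $R$, that successor would still be a neighbour of $w$ along the original path,
  by the previous lemma, and it is in $R$: a contradiction. So all of $N(R)$ lies next to $R$ on the
  original path.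
\<close>

theorem posa_lemma:
  assumes P: "longest_path r V P" and "symp r"
  shows "card (nbhd r V (rotation_ends r P)) < 2 * card (rotation_ends r P)"
proof -
  let ?R = "rotation_ends r P"
  have dist: "distinct P" "P \<noteq> []" using P by (auto simp: longest_path_def path_in_def)
  have fin: "finite ?R" using rotation_ends_subset[OF assms] finite_subset by blast
  have lastR: "last P \<in> ?R" using rotation_of.start by (auto simp: rotation_ends_def)
  have nb: "path_nbs P w \<inter> ?R \<noteq> {}" if w: "w \<in> nbhd r V ?R" for w
  proof
    assume *: "path_nbs P w \<inter> ?R = {}"
    obtain Q where Q: "rotation_of r P Q" "r (last Q) w" and wV: "w \<in> V" "w \<notin> ?R"
      using w by (auto simp: nbhd_def rotation_ends_def)
    have lQ: "longest_path r V Q" using rotation_of_longest Q(1) assms by blast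
    then have wQ: "w \<in> set Q" using longest_path_last_nbs assms(2) Q(2) wV(1) by fast
    have "w \<noteq> last Q" using wV Q(1) by (auto simp: rotation_ends_def)
    then obtain as bs where Qs: "Q = as @ w # bs" "bs \<noteq> []"
      using wQ by (metis append.right_neutral last_snoc split_list)
    have "rotation_of r P (as @ w # rev bs)"
      using Q Qs by (intro rotation_of.rotate) auto
    moreover have "last (as @ w # rev bs) = hd bs" using Qs(2) by (simp add: last_rev)
    ultimately have "hd bs \<in> ?R" unfolding rotation_ends_def by (metis imageI mem_Collect_eq)
    moreover have "hd bs \<in> path_nbs Q w"
      using Qs by (auto simp: path_nbs_def consecutive_append consecutive_Cons)
    ultimately show False using rotation_of_path_nbs[OF Q(1) wV(2) *] * by auto
  qed
  \<comment> \<open>The last vertex of \<open>P\<close> is one of the ends and has no successor; this makes the bound strict.\<close>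
  let ?A = "{i. Suc i < length P \<and> P ! i \<in> ?R}" and ?B = "{i. Suc i < length P \<and> P ! Suc i \<in> ?R}"
  have finAB: "finite ?A" "finite ?B"
    by (rule finite_subset[of _ "{..<length P}"]; auto)+
  have "nbhd r V ?R \<subseteq> (\<lambda>i. P ! Suc i) ` ?A \<union> (\<lambda>i. P ! i) ` ?B"
  proof
    fix w assume "w \<in> nbhd r V ?R"
    from nb[OF this] obtain z where z: "z \<in> ?R" "consecutive P w z \<or> consecutive P z w"
      by (auto simp: path_nbs_def)
    then show "w \<in> (\<lambda>i. P ! Suc i) ` ?A \<union> (\<lambda>i. P ! i) ` ?B"
      by (auto simp: consecutive_nth)
  qed
  then have "card (nbhd r V ?R) \<le> card ((\<lambda>i. P ! Suc i) ` ?A \<union> (\<lambda>i. P ! i) ` ?B)"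
    by (intro card_mono) (use finAB in auto)
  also have "\<dots> \<le> card ?A + card ?B"
    by (intro order.trans[OF card_Un_le] add_mono card_image_le finAB)
  also have "card ?A \<le> card (?R - {last P})"
  proof (rule card_inj_on_le)
    show "inj_on (\<lambda>i. P ! i) ?A" using dist by (auto simp: inj_on_def nth_eq_iff_index_eq)
    show "(\<lambda>i. P ! i) ` ?A \<subseteq> ?R - {last P}"
      using dist by (auto simp: last_conv_nth nth_eq_iff_index_eq)
  qed (use fin in auto)
  also have "card (?R - {last P}) < card ?R" using fin lastR by (rule card_Diff1_less)
  also have "card ?B \<le> card ?R"
  proof (rule card_inj_on_le)
    show "inj_on (\<lambda>i. P ! Suc i) ?B" using dist by (auto simp: inj_on_def nth_eq_iff_index_eq)
  qed (use fin in auto)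
  finally show ?thesis by simp
qed

section \<open>Expanding graphs\<close>

text \<open>
  The bound of a quarter leaves room for the $3|U| \le 3n/4$ vertices of $U$ and its neighbours, and
  it forces connectivity (from $n = 8$ on), as every component then has more than half of the vertices.
\<close>

definition expanding :: "('a \<Rightarrow> 'a \<Rightarrow> bool) \<Rightarrow> 'a set \<Rightarrow> bool" where
  "expanding r V \<longleftrightarrow> (\<forall>U\<subseteq>V. 4 * card U \<le> card V \<longrightarrow> 2 * card U \<le> card (nbhd r V U))"

lemma expanding_rotation_ends:
  assumes "expanding r V" "finite V" "longest_path r V P" "symp r"
  shows "card V < 4 * card (rotation_ends r P)"
proof (rule ccontr)
  assume "\<not> ?thesis"
  moreover have "rotation_ends r P \<subseteq> V"
    using rotation_ends_subset[OF assms(3,4)] assms(3) by (auto simp: longest_path_def path_in_def)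
  ultimately show False using posa_lemma[OF assms(3,4)] assms(1) unfolding expanding_def
    by (meson leD leI)
qed

text \<open>
  The pairs whose joining would close a longest path to a cycle.
\<close>

definition end_pairs :: "('a \<Rightarrow> 'a \<Rightarrow> bool) \<Rightarrow> 'a set \<Rightarrow> ('a \<times> 'a) set" where
  "end_pairs r V = {(hd Q, last Q) | Q. longest_path r V Q}"

lemma end_pairs_subset: "end_pairs r V \<subseteq> V \<times> V"
  by (auto simp: end_pairs_def longest_path_def path_in_def intro!: hd_in_set last_in_set
      elim!: subsetD)

lemma ex_longest_path:
  assumes "finite V" "path_in r V P0"
  shows "\<exists>P. longest_path r V P"
proof -
  have "\<forall>P. path_in r V P \<longrightarrow> length P < Suc (card V)"
    using assms(1) by (auto simp: path_in_def less_Suc_eq_le distinct_card[symmetric] intro!: card_mono)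
  from Lattices_Big.ex_has_greatest_nat[OF assms(2) this] show ?thesis
    by (auto simp: longest_path_def)
qed

text \<open>
  Rotating with one end fixed gives more than $n/4$ ends. Each of them can in turn be kept fixed while
  the other side is rotated, which gives more than $n/4$ partners.
\<close>

lemma card_end_pairs:
  assumes "expanding r V" "finite V" "V \<noteq> {}" "symp r"
  shows "(card V)^2 \<le> 16 * card (end_pairs r V)"
proof -
  obtain x where "x \<in> V" using assms(3) by blast
  then have "path_in r V [x]" by (simp add: path_in_def)
  then obtain P where P: "longest_path r V P" using ex_longest_path assms(2) by blast
  let ?R = "rotation_ends r P"
  have "\<exists>S. S \<subseteq> {c. (b, c) \<in> end_pairs r V} \<and> card V \<le> 4 * card S" if b: "b \<in> ?R" for b
  proof -
    obtain Q where Q: "rotation_of r P Q" "b = last Q" using b by (auto simp: rotation_ends_def)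
    have Ql: "longest_path r V (rev Q)"
      using rotation_of_longest[OF Q(1) P assms(4)] longest_path_rev assms(4) by blast
    have "rotation_ends r (rev Q) \<subseteq> {c. (b, c) \<in> end_pairs r V}"
    proof
      fix c assume "c \<in> rotation_ends r (rev Q)"
      then obtain Q' where Q': "rotation_of r (rev Q) Q'" "c = last Q'"
        by (auto simp: rotation_ends_def)
      have "longest_path r V Q'" using rotation_of_longest[OF Q'(1) Ql assms(4)] .
      moreover have "hd Q' = b" using rotation_of_hd[OF Q'(1)] Q(2) by (simp add: hd_rev)
      ultimately show "c \<in> {c. (b, c) \<in> end_pairs r V}" using Q'(2)
        by (auto simp: end_pairs_def)
    qed
    moreover have "card V \<le> 4 * card (rotation_ends r (rev Q))"
      using expanding_rotation_ends[OF assms(1,2) Ql assms(4)] by simp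
    ultimately show ?thesis by blast
  qed
  then obtain S where S: "\<And>b. b \<in> ?R \<Longrightarrow> S b \<subseteq> {c. (b, c) \<in> end_pairs r V}"
    "\<And>b. b \<in> ?R \<Longrightarrow> card V \<le> 4 * card (S b)" by metis
  have finE: "finite (end_pairs r V)" using end_pairs_subset assms(2)
    by (metis finite_SigmaI finite_subset)
  have finR: "finite ?R" using rotation_ends_subset[OF P assms(4)] finite_subset by blast
  have finS: "finite (S b)" if "b \<in> ?R" for b
  proof (rule finite_subset)
    show "S b \<subseteq> snd ` end_pairs r V" using S(1)[OF that] by force
  qed (use finE in auto)
  have "(card V)^2 \<le> card V * (4 * card ?R)"
    using expanding_rotation_ends[OF assms(1,2) P assms(4)] by (simp add: power2_eq_square)
  also have "\<dots> = 4 * (\<Sum>b\<in>?R. card V)" by simp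
  also have "\<dots> \<le> 4 * (\<Sum>b\<in>?R. 4 * card (S b))" using S(2) by (intro mult_left_mono sum_mono) auto
  also have "\<dots> = 16 * card (Sigma ?R S)" using finR finS
    by (subst card_SigmaI) (auto simp: sum_distrib_left)
  also have "\<dots> \<le> 16 * card (end_pairs r V)"
    using S(1) by (intro mult_left_mono card_mono finE) auto
  finally show ?thesis .
qed

lemma expanding_connected:
  assumes "expanding r V" "symp r" "finite V" "card V \<ge> 8" "U \<subseteq> V" "U \<noteq> {}" "U \<noteq> V"
  shows "nbhd r V U \<noteq> {}"
proof
  assume U: "nbhd r V U = {}"
  have aux: False if W: "W \<subseteq> V" "W \<noteq> {}" "nbhd r V W = {}" "2 * card W \<le> card V" for W
  proof (cases "4 * card W \<le> card V")
    case True
    then have "2 * card W \<le> card (nbhd r V W)" using assms(1) W(1) by (simp add: expanding_def)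
    then show False using W(2,3) assms(3) W(1) finite_subset by fastforce
  next
    case False
    let ?q = "card V div 4"
    \<comment> \<open>The neighbours of a quarter-size subset stay inside \<open>W\<close>, so \<open>W\<close> has more than half of the vertices.\<close>
    obtain W0 where W0: "W0 \<subseteq> W" "card W0 = ?q"
      using False by (metis (no_types, opaque_lifting) div_le_mono linorder_not_le nat_less_le
        nonzero_mult_div_cancel_left obtain_subset_with_card_n zero_neq_numeral)
    have "nbhd r V W0 \<subseteq> W - W0" using W(3) W0(1) by (auto simp: nbhd_def)
    then have "card (nbhd r V W0) \<le> card W - ?q"
      using W0 W(1) assms(3) by (metis card_Diff_subset card_mono finite_Diff finite_subset)
    moreover have "2 * card W0 \<le> card (nbhd r V W0)"
      using assms(1) W0 W(1) unfolding expanding_def by (metis div_times_less_eq_dividend mult.commute order_trans)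
    ultimately have "2 * ?q \<le> card W - ?q" using W0(2) by linarith
    moreover have "card V < 4 * ?q + 4" "?q \<ge> 2" using assms(4) by presburger+
    ultimately show False using W(4) by linarith
  qed
  have "nbhd r V (V - U) = {}" using U assms(2) by (auto simp: nbhd_def dest: sympD)
  moreover have "card (V - U) = card V - card U" "card U \<le> card V"
    using assms(3,5) by (auto simp: card_Diff_subset finite_subset card_mono)
  ultimately show False
    using aux[of U] aux[of "V - U"] assms(5-7) U by fastforce
qed

text \<open>
  Otherwise connectivity provides a vertex outside the closed path that is adjacent to a vertex on it;
  cutting the cycle open at that vertex yields a longer path.
\<close>

lemma closed_longest_path_spans:
  assumes Q: "longest_path r V Q" and sym: "symp r" and cl: "r (last Q) (hd Q)"
    and conn: "\<And>U. U \<subseteq> V \<Longrightarrow> U \<noteq> {} \<Longrightarrow> U \<noteq> V \<Longrightarrow> nbhd r V U \<noteq> {}"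
  shows "set Q = V"
proof (rule ccontr)
  assume ne: "set Q \<noteq> V"
  have p: "path_in r V Q" using Q by (simp add: longest_path_def)
  then obtain x y where xy: "x \<in> set Q" "y \<in> V - set Q" "r x y"
    using conn[of "set Q"] ne by (auto simp: nbhd_def path_in_def)
  obtain as bs where Qs: "Q = as @ x # bs" using xy(1) by (meson split_list)
  have "successively r (x # bs @ as)"
    using p cl by (cases "bs = []"; cases "as = []")
      (auto simp: Qs path_in_def successively_append_iff successively_Cons)
  then have "path_in r V (y # x # bs @ as)"
    using p xy sym by (auto simp: Qs path_in_def successively_append_iff successively_Cons dest: sympD)
  then show False using Q by (force simp: longest_path_def Qs)
qed

section \<open>Weak Hamilton cycles as Hamilton cycles of linked vertices\<close>

text \<open>
  Adjacency in the graph that a hypergraph induces on its vertices.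
\<close>

definition linked :: "'a set set \<Rightarrow> 'a \<Rightarrow> 'a \<Rightarrow> bool" where
  "linked E x y \<longleftrightarrow> x \<noteq> y \<and> (\<exists>e\<in>E. x \<in> e \<and> y \<in> e)"

lemma symp_linked: "symp (linked E)"
  by (auto simp: symp_def linked_def)

lemma linked_mono: "E \<subseteq> E' \<Longrightarrow> linked E x y \<Longrightarrow> linked E' x y"
  by (auto simp: linked_def)

lemma path_in_linked_mono: "E \<subseteq> E' \<Longrightarrow> path_in (linked E) V P \<Longrightarrow> path_in (linked E') V P"
  by (auto simp: path_in_def intro: successively_mono linked_mono)

lemma nbhd_linked_mono: "E \<subseteq> E' \<Longrightarrow> nbhd (linked E) V U \<subseteq> nbhd (linked E') V U"
  by (auto simp: nbhd_def intro: linked_mono)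

lemma weak_hamiltonian_mono:
  "weak_hamiltonian (V, E) \<Longrightarrow> E \<subseteq> E' \<Longrightarrow> weak_hamiltonian (V, E')"
  unfolding weak_hamiltonian_def weak_cycle_def by fastforce

lemma weak_hamiltonian_covers:
  assumes "weak_hamiltonian (V, E)" "x \<in> V"
  shows "\<exists>e\<in>E. x \<in> e"
proof -
  obtain l v e where w: "weak_cycle (V, E) l v e" "v ` {..<l} = V"
    using assms(1) by (auto simp: weak_hamiltonian_def)
  then obtain i where "i < l" "x = v i" using assms(2) by auto
  then show ?thesis using w(1) unfolding weak_cycle_def
    by (intro bexI[of _ "e (Suc i)"]) (auto dest!: bspec[of _ _ "Suc i"])
qed

lemma min_degree_ge_1_iff:
  assumes "finite V" "V \<noteq> {}" "finite E"
  shows "min_degree (V, E) \<ge> 1 \<longleftrightarrow> (\<forall>x\<in>V. \<exists>e\<in>E. x \<in> e)"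
proof -
  have "min_degree (V, E) \<ge> 1 \<longleftrightarrow> (\<forall>x\<in>V. 1 \<le> degree (V, E) x)"
    unfolding min_degree_def using assms by (subst Min_ge_iff) auto
  also have "\<dots> \<longleftrightarrow> (\<forall>x\<in>V. \<exists>e\<in>E. x \<in> e)"
    unfolding degree_def using assms(3) by (auto simp: Suc_le_eq card_gt_0_iff)
  finally show ?thesis .
qed

lemma successively_consecutive: "successively r Q \<Longrightarrow> consecutive Q a b \<Longrightarrow> r a b"
proof (induction Q)
  case Nil
  then show ?case by (simp add: consecutive_def)
qed (auto simp: consecutive_Cons successively_Cons)

lemma weak_hamiltonianI:
  assumes "distinct Q" "set Q = V" "length Q \<ge> 3" "successively (linked E) Q"
    and "linked E (last Q) (hd Q)"
  shows "weak_hamiltonian (V, E)"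
proof -
  let ?l = "length Q"
  define v where "v = (\<lambda>i. Q ! (i mod ?l))"
  have l: "linked E (v i) (v (Suc i))" if "i < ?l" for i
  proof (cases "Suc i < ?l")
    case True
    have "consecutive Q (Q ! i) (Q ! Suc i)" using True by (auto simp: consecutive_nth)
    then have "linked E (Q ! i) (Q ! Suc i)"
      by (rule successively_consecutive[OF assms(4)])
    then show ?thesis using True by (simp add: v_def)
  next
    case False
    then have "Suc i = ?l" using that by simp
    moreover from this have "i = ?l - 1" by simp
    moreover have "Q \<noteq> []" using assms(3) by auto
    ultimately show ?thesis using assms(5)
      by (simp add: v_def last_conv_nth hd_conv_nth)
  qed
  then have "\<exists>f. f \<in> E \<and> v (i - 1) \<in> f \<and> v i \<in> f" if "i \<in> {1..?l}" for i
  proof -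
    have "i - 1 < ?l" "Suc (i - 1) = i" using that by auto
    then show ?thesis using l[of "i - 1"] by (auto simp: linked_def)
  qed
  then obtain e where e: "\<And>i. i \<in> {1..?l} \<Longrightarrow> e i \<in> E \<and> v (i - 1) \<in> e i \<and> v i \<in> e i"
    by metis
  have im: "v ` {..<?l} = V"
    using assms(2) by (force simp: v_def in_set_conv_nth image_iff)
  have "inj_on v {..<?l}" using assms(1) by (auto simp: inj_on_def v_def nth_eq_iff_index_eq)
  then have "weak_cycle (V, E) ?l v e"
    using e assms(3) im by (auto simp: weak_cycle_def v_def)
  then show ?thesis using im by (auto simp: weak_hamiltonian_def)
qed

section \<open>Counting edges that contain one of many pairs\<close>

lemma card_nsets: "finite V \<Longrightarrow> card (nsets V d) = card V choose d"
proof -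
  assume V: "finite V"
  then have "nsets V d = {B. B \<subseteq> V \<and> card B = d}" by (auto simp: nsets_def finite_subset)
  then show ?thesis using n_subsets[OF V] by simp
qed

lemma card_nsets_containing_pair:
  assumes "finite V" "x \<in> V" "y \<in> V" "x \<noteq> y" "d \<ge> 2"
  shows "card {e \<in> nsets V d. x \<in> e \<and> y \<in> e} = (card V - 2) choose (d - 2)"
proof -
  have "bij_betw (\<lambda>e. e - {x, y}) {e \<in> nsets V d. x \<in> e \<and> y \<in> e} (nsets (V - {x, y}) (d - 2))"
  proof (rule bij_betw_byWitness[where f' = "\<lambda>e. e \<union> {x, y}"])
    show "(\<lambda>e. e - {x, y}) ` {e \<in> nsets V d. x \<in> e \<and> y \<in> e} \<subseteq> nsets (V - {x, y}) (d - 2)"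
      using assms(4) by (auto simp: nsets_def card_Diff_subset)
    show "(\<lambda>e. e \<union> {x, y}) ` nsets (V - {x, y}) (d - 2) \<subseteq> {e \<in> nsets V d. x \<in> e \<and> y \<in> e}"
    proof clarify
      fix e assume e: "e \<in> nsets (V - {x, y}) (d - 2)"
      then have "card (e \<union> {x, y}) = (d - 2) + 2"
        using assms(4) by (subst card_Un_disjoint) (auto simp: nsets_def)
      then show "e \<union> {x, y} \<in> nsets V d \<and> x \<in> e \<union> {x, y} \<and> y \<in> e \<union> {x, y}"
        using e assms by (auto simp: nsets_def)
    qed
  qed (auto simp: nsets_def)
  then have "card {e \<in> nsets V d. x \<in> e \<and> y \<in> e} = card (nsets (V - {x, y}) (d - 2))"
    by (rule bij_betw_same_card)
  moreover have "card (V - {x, y}) = card V - 2"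
    using assms by (subst card_Diff_subset) auto
  ultimately show ?thesis using assms by (simp add: card_nsets)
qed

lemma binomial_absorb_twice:
  assumes "d \<ge> 2"
  shows "(n choose d) * (d * (d - 1)) = n * (n - 1) * ((n - 2) choose (d - 2))"
proof -
  obtain k where k: "d = Suc (Suc k)" using assms by (metis add_2_eq_Suc le_Suc_ex)
  show ?thesis
  proof (cases "n \<ge> 2")
    case True
    then obtain m where m: "n = Suc (Suc m)" by (metis add_2_eq_Suc le_Suc_ex)
    have "Suc (Suc k) * (Suc (Suc m) choose Suc (Suc k)) = Suc (Suc m) * (Suc m choose Suc k)"
      "Suc k * (Suc m choose Suc k) = Suc m * (m choose k)"
      by (rule Suc_times_binomial)+
    then have "(Suc (Suc m) choose Suc (Suc k)) * (Suc (Suc k) * Suc k) =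
        Suc (Suc m) * Suc m * (m choose k)"
      by (metis (no_types, lifting) mult.assoc mult.commute)
    then show ?thesis by (simp add: k m)
  next
    case False
    then have "n = 0 \<or> n = 1" by auto
    then show ?thesis using assms k by auto
  qed
qed

text \<open>
  Double counting: each pair lies in $\binom{n-2}{d-2}$ of the $d$-sets, and each $d$-set contains at
  most $d(d-1)$ ordered pairs. The quotient of these numbers is $\binom nd / (n(n-1))$.
\<close>

lemma card_nsets_meeting_pairs:
  assumes "finite V" "Pr \<subseteq> V \<times> V" "\<And>x y. (x, y) \<in> Pr \<Longrightarrow> x \<noteq> y" "d \<ge> 2"
  shows "card Pr * (card V choose d) \<le> (card V)^2 * card {e \<in> nsets V d. \<exists>(x, y)\<in>Pr. x \<in> e \<and> y \<in> e}"
proof -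
  let ?n = "card V"
  let ?B = "{e \<in> nsets V d. \<exists>(x, y)\<in>Pr. x \<in> e \<and> y \<in> e}"
  have finPr: "finite Pr" using assms(1,2) by (meson finite_SigmaI finite_subset)
  have finB: "finite ?B" using assms(1) by (simp add: finite_imp_finite_nsets)
  have "card Pr * ((?n - 2) choose (d - 2)) = (\<Sum>p\<in>Pr. card {e \<in> ?B. fst p \<in> e \<and> snd p \<in> e})"
  proof -
    have "card {e \<in> ?B. fst p \<in> e \<and> snd p \<in> e} = (?n - 2) choose (d - 2)" if "p \<in> Pr" for p
    proof -
      have "{e \<in> ?B. fst p \<in> e \<and> snd p \<in> e} = {e \<in> nsets V d. fst p \<in> e \<and> snd p \<in> e}"
        using that by force
      moreover have "fst p \<in> V" "snd p \<in> V"
        using assms(2) that by (auto simp: mem_Times_iff)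
      moreover have "fst p \<noteq> snd p" using assms(3)[of "fst p" "snd p"] that by simp
      ultimately show ?thesis using card_nsets_containing_pair[OF assms(1) _ _ _ assms(4)] by simp
    qed
    then show ?thesis by simp
  qed
  also have "\<dots> = (\<Sum>e\<in>?B. card {p \<in> Pr. fst p \<in> e \<and> snd p \<in> e})"
    by (rule sum_multicount_gen[where R = "\<lambda>p e. fst p \<in> e \<and> snd p \<in> e", OF finPr finB]) simp
  also have "\<dots> \<le> (\<Sum>e\<in>?B. d * (d - 1))"
  proof (rule sum_mono)
    fix e assume "e \<in> ?B"
    then have e: "finite e" "card e = d" by (auto simp: nsets_def)
    have "{p \<in> Pr. fst p \<in> e \<and> snd p \<in> e} \<subseteq> e \<times> e - (\<lambda>x. (x, x)) ` e"
      using assms(3) by auto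
    then have "card {p \<in> Pr. fst p \<in> e \<and> snd p \<in> e} \<le> card (e \<times> e - (\<lambda>x. (x, x)) ` e)"
      using e by (intro card_mono) auto
    also have "\<dots> = card (e \<times> e) - card ((\<lambda>x. (x, x)) ` e)"
      using e by (intro card_Diff_subset) auto
    also have "\<dots> = d * (d - 1)"
      using e by (simp add: card_cartesian_product card_image inj_on_def diff_mult_distrib2)
    finally show "card {p \<in> Pr. fst p \<in> e \<and> snd p \<in> e} \<le> d * (d - 1)" .
  qed
  finally have 1: "card Pr * ((?n - 2) choose (d - 2)) \<le> card ?B * (d * (d - 1))" by simp
  have "card Pr * (?n choose d) * (d * (d - 1)) = ?n * (?n - 1) * (card Pr * ((?n - 2) choose (d - 2)))"
    using binomial_absorb_twice[OF assms(4), of ?n] by (metis mult.assoc mult.left_commute)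
  also have "\<dots> \<le> ?n * ?n * (card ?B * (d * (d - 1)))"
    by (rule mult_le_mono[OF _ 1]) simp
  finally have "card Pr * (?n choose d) * (d * (d - 1)) \<le> ?n^2 * card ?B * (d * (d - 1))"
    by (simp add: power2_eq_square mult.assoc)
  then show ?thesis using assms(4) by simp
qed

section \<open>Boosters\<close>

definition boosters :: "nat \<Rightarrow> 'a set \<Rightarrow> 'a set set \<Rightarrow> 'a set set" where
  "boosters d V \<Gamma> = {e \<in> nsets V d. \<exists>(x, y)\<in>end_pairs (linked \<Gamma>) V. x \<in> e \<and> y \<in> e}"

lemma end_pairs_irrefl:
  assumes "expanding (linked \<Gamma>) V" "finite V" "card V \<ge> 8" "(x, y) \<in> end_pairs (linked \<Gamma>) V"
  shows "x \<noteq> y"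
proof
  assume "x = y"
  then obtain Q where Q: "longest_path (linked \<Gamma>) V Q" "hd Q = last Q" "x = hd Q"
    using assms(4) by (auto simp: end_pairs_def)
  then have Q': "Q \<noteq> []" "distinct Q" "set Q \<subseteq> V" by (auto simp: longest_path_def path_in_def)
  then have "length Q = 1"
    using Q(2) by (cases Q) (auto split: if_splits)
  then obtain z where z: "Q = [z]" by (auto simp: length_Suc_conv)
  have "nbhd (linked \<Gamma>) V {z} \<noteq> {}"
    using Q' z assms(3) by (intro expanding_connected assms(1,2) symp_linked) auto
  then obtain w where w: "w \<in> V" "linked \<Gamma> z w" by (auto simp: nbhd_def)
  have "path_in (linked \<Gamma>) V [z, w]"
    using w Q' z by (auto simp: path_in_def linked_def)
  then show False using Q(1) z by (force simp: longest_path_def)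
qed

lemma card_boosters:
  assumes "expanding (linked \<Gamma>) V" "finite V" "card V \<ge> 8" "d \<ge> 2"
  shows "card V choose d \<le> 16 * card (boosters d V \<Gamma>)"
proof -
  let ?Pr = "end_pairs (linked \<Gamma>) V"
  have V: "V \<noteq> {}" using assms(3) by auto
  have "(card V)^2 * (card V choose d) \<le> 16 * (card ?Pr * (card V choose d))"
    using card_end_pairs[OF assms(1,2) V symp_linked] by simp
  also have "\<dots> \<le> 16 * ((card V)^2 * card (boosters d V \<Gamma>))"
    unfolding boosters_def using end_pairs_irrefl[OF assms(1-3)]
    by (intro mult_left_mono card_nsets_meeting_pairs assms end_pairs_subset) auto
  finally show ?thesis using assms(3) by simp
qed

text \<open>
  As $\Gamma$ contains a longest path of $E$, longest paths of $\Gamma$ are also longest in $E$. An edge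
  of $E$ joining the two ends of such a path would close it to a cycle, which spans all vertices.
\<close>

lemma boosters_avoided:
  assumes exp: "expanding (linked \<Gamma>) V" and V: "finite V" "card V \<ge> 8" and sub: "\<Gamma> \<subseteq> E"
    and P: "longest_path (linked E) V P" "path_in (linked \<Gamma>) V P"
    and nh: "\<not> weak_hamiltonian (V, E)"
  shows "E \<inter> boosters d V \<Gamma> = {}"
proof (rule ccontr)
  assume "\<not> ?thesis"
  then obtain e Q where e: "e \<in> E" "longest_path (linked \<Gamma>) V Q" "hd Q \<in> e" "last Q \<in> e"
    by (auto simp: boosters_def end_pairs_def)
  have "hd Q \<noteq> last Q"
    by (rule end_pairs_irrefl[OF exp V]) (use e(2) in \<open>unfold end_pairs_def, blast\<close>)
  then have cl: "linked E (last Q) (hd Q)" using e by (auto simp: linked_def)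
  have "length P \<le> length Q" using e(2) P(2) by (auto simp: longest_path_def)
  moreover have pQ: "path_in (linked E) V Q"
    using e(2) path_in_linked_mono[OF sub] by (auto simp: longest_path_def)
  ultimately have lQ: "longest_path (linked E) V Q"
    using P(1) unfolding longest_path_def by (meson le_trans)
  have span: "set Q = V"
  proof (rule closed_longest_path_spans[OF lQ symp_linked cl])
    fix U assume "U \<subseteq> V" "U \<noteq> {}" "U \<noteq> V"
    then have "nbhd (linked \<Gamma>) V U \<noteq> {}"
      by (intro expanding_connected[OF exp symp_linked V])
    then show "nbhd (linked E) V U \<noteq> {}" using nbhd_linked_mono[OF sub] by blast
  qed
  have "length Q = card V" using span pQ distinct_card by (fastforce simp: path_in_def)
  then have "weak_hamiltonian (V, E)"
    using pQ span cl V(2) by (intro weak_hamiltonianI[of Q]) (auto simp: path_in_def)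
  then show False using nh by blast
qed

section \<open>A sparse expander inside a hypergraph\<close>

text \<open>
  One edge per step of the path suffices to keep it.
\<close>

lemma path_certificate:
  assumes "successively (linked E) P"
  shows "\<exists>F\<subseteq>E. finite F \<and> card F \<le> length P \<and> successively (linked F) P"
  using assms
proof (induction P)
  case (Cons x P)
  then obtain F where F: "F \<subseteq> E" "finite F" "card F \<le> length P" "successively (linked F) P"
    by (auto simp: successively_Cons)
  show ?case
  proof (cases "P = []")
    case False
    then obtain e where e: "e \<in> E" "x \<in> e" "hd P \<in> e" "x \<noteq> hd P"
      using Cons.prems by (auto simp: successively_Cons linked_def)
    have "successively (linked (insert e F)) P"
      using F(4) by (rule successively_mono) (auto intro: linked_mono)
    then show ?thesis using F e
      by (intro exI[of _ "insert e F"]) (auto simp: successively_Cons linked_def card_insert_if)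
  qed (auto intro!: exI[of _ "{}"])
qed auto

text \<open>
  Keeping all edges at vertices of low degree preserves their few neighbours; at the others \<open>K\<close>
  edges are enough to contradict local sparsity.
\<close>

lemma degree_certificate:
  assumes "finite V" "finite E"
  shows "\<exists>D\<subseteq>E. card D \<le> K * card V \<and>
    (\<forall>x\<in>V. (card {e\<in>E. x \<in> e} < K \<longrightarrow> {e\<in>E. x \<in> e} \<subseteq> D) \<and>
           (card {e\<in>E. x \<in> e} \<ge> K \<longrightarrow> card {e\<in>D. x \<in> e} \<ge> K))"
proof -
  have "\<exists>A. A \<subseteq> {e\<in>E. x \<in> e} \<and> card A \<le> K \<and> (card {e\<in>E. x \<in> e} < K \<longrightarrow> A = {e\<in>E. x \<in> e}) \<and>
     (card {e\<in>E. x \<in> e} \<ge> K \<longrightarrow> card A = K)" (is "\<exists>A. ?P x A") for x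
  proof (cases "card {e\<in>E. x \<in> e} < K")
    case False
    then obtain A where "A \<subseteq> {e\<in>E. x \<in> e}" "card A = K"
      by (meson obtain_subset_with_card_n linorder_not_less)
    then show ?thesis using False by auto
  qed auto
  then have "\<forall>x. \<exists>A. ?P x A" by blast
  then obtain A where A0: "\<forall>x. ?P x (A x)" by (rule exE[OF choice])
  have A: "A x \<subseteq> {e\<in>E. x \<in> e}" "card (A x) \<le> K"
    "card {e\<in>E. x \<in> e} < K \<Longrightarrow> A x = {e\<in>E. x \<in> e}"
    "card {e\<in>E. x \<in> e} \<ge> K \<Longrightarrow> card (A x) = K" for x
    using spec[OF A0, of x] by simp_all
  define D where "D = (\<Union>x\<in>V. A x)"
  have DE: "D \<subseteq> E" using A(1) by (auto simp: D_def)
  have "card D \<le> (\<Sum>x\<in>V. card (A x))" unfolding D_def by (rule card_UN_le[OF assms(1)])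
  also have "\<dots> \<le> (\<Sum>x\<in>V. K)" by (intro sum_mono A(2))
  finally have "card D \<le> K * card V" by (simp add: mult.commute)
  moreover have "card {e\<in>D. x \<in> e} \<ge> K" if "x \<in> V" "card {e\<in>E. x \<in> e} \<ge> K" for x
  proof -
    have "A x \<subseteq> {e\<in>D. x \<in> e}" using that(1) A(1)[of x] by (auto simp: D_def)
    then have "card (A x) \<le> card {e\<in>D. x \<in> e}"
      using finite_subset[OF DE assms(2)] by (intro card_mono) auto
    then show ?thesis using A(4)[OF that(2)] by simp
  qed
  moreover have "{e\<in>E. x \<in> e} \<subseteq> D" if "x \<in> V" "card {e\<in>E. x \<in> e} < K" for x
    using A(3)[OF that(2)] that(1) by (auto simp: D_def)
  ultimately show ?thesis using DE by (intro exI[of _ D]) auto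
qed

text \<open>
  Each new edge of a chain shares a vertex with the earlier ones and adds at most $d - 1$ vertices. The
  first moment over chains then contains the factor $n^{f(d-1)+1} p^f$, that is $n$ up to logarithms.
\<close>

lemma card_Union_chain:
  assumes "successively (\<lambda>e f. e \<inter> f \<noteq> {}) es" "\<And>e. e \<in> set es \<Longrightarrow> finite e \<and> card e = d" "d \<ge> 1"
  shows "card (\<Union>(set es)) \<le> card (set es) * (d - 1) + 1"
  using assms(1,2)
proof (induction es)
  case (Cons e es)
  consider "es = []" | "e \<in> set es" | "es \<noteq> []" "e \<notin> set es" by blast
  then show ?case
  proof cases
    case 1
    then show ?thesis using Cons assms(3) by simp
  next
    case 2
    then have "\<Union>(set (e # es)) = \<Union>(set es)" "set (e # es) = set es" by auto
    then show ?thesis using Cons by (simp only: successively_Cons list.set_intros) auto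
  next
    case False: 3
    then have ne: "e \<inter> \<Union>(set es) \<noteq> {}"
      using Cons.prems by (cases es) (auto simp: successively_Cons)
    have IH: "card (\<Union>(set es)) \<le> card (set es) * (d - 1) + 1"
      using Cons by (auto simp: successively_Cons)
    have fin: "finite (\<Union>(set es))" using Cons.prems by auto
    have e: "finite e" "card e = d" using Cons.prems by auto
    have "card (e \<union> \<Union>(set es)) + card (e \<inter> \<Union>(set es)) = d + card (\<Union>(set es))"
      using card_Un_Int[OF e(1) fin] e(2) by simp
    moreover have "card (e \<inter> \<Union>(set es)) \<ge> 1"
      using ne e(1) by (simp add: Suc_le_eq card_gt_0_iff)
    ultimately have "card (e \<union> \<Union>(set es)) \<le> (d - 1) + card (\<Union>(set es))" using assms(3) by linarith
    then show ?thesis using IH False by simp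
  qed
qed simp

text \<open>
  Vertices of degree below $K$ are not joined by chains of at most four edges. Chains are relaxed here to
  families of edges covering few vertices, which are easier to count.
\<close>

definition low_degree_far :: "nat \<Rightarrow> nat \<Rightarrow> 'a set set \<Rightarrow> bool" where
  "low_degree_far d K E \<longleftrightarrow> \<not> (\<exists>F\<subseteq>E. card F \<in> {1..4} \<and> card (\<Union>F) \<le> card F * (d - 1) + 1 \<and>
     (\<exists>s\<in>\<Union>F. \<exists>t\<in>\<Union>F. s \<noteq> t \<and> card {e\<in>E. s \<in> e} < K \<and> card {e\<in>E. t \<in> e} < K))"

definition locally_sparse :: "nat \<Rightarrow> 'a set \<Rightarrow> 'a set set \<Rightarrow> bool" where
  "locally_sparse t V E \<longleftrightarrow> (\<forall>T\<subseteq>V. T \<noteq> {} \<longrightarrow> card T \<le> t \<longrightarrow> card {e\<in>E. e \<subseteq> T} < card T)"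

lemma low_degree_far_chain:
  assumes far: "low_degree_far d K E" and "d \<ge> 1" "\<And>e. e \<in> E \<Longrightarrow> finite e \<and> card e = d"
    and es: "successively (\<lambda>e f. e \<inter> f \<noteq> {}) es" "set es \<subseteq> E" "es \<noteq> []" "length es \<le> 4"
    and "s \<in> \<Union>(set es)" "t \<in> \<Union>(set es)" "card {e\<in>E. s \<in> e} < K" "card {e\<in>E. t \<in> e} < K"
  shows "s = t"
proof (rule ccontr)
  assume "s \<noteq> t"
  moreover have "card (\<Union>(set es)) \<le> card (set es) * (d - 1) + 1"
    using assms(2,3) es(2) by (intro card_Union_chain es) auto
  moreover have "card (set es) \<in> {1..4}"
    using es(3,4) card_length[of es] by (auto simp: Suc_le_eq card_gt_0_iff)
  ultimately show False using far es(2) assms(8-) unfolding low_degree_far_def by blast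
qed

text \<open>
  Split $U$ into the set $S$ of vertices of degree below $6d$ and the rest $L$, and suppose that
  $T = U \cup N(U)$ has fewer than $3|U|$ vertices. Each $s \in S$ has an edge $\epsilon_s$, and these
  edges are disjoint since low-degree vertices are far apart. For the same reason the edges
  at a vertex of $L$ meet at most one of them, so at most $|L|$ of them meet an edge at $L$. Remove the
  others from $T$: each takes $d \ge 3$ vertices away, at least its share of $3|U|$. What
  remains has fewer than $6|L|$ vertices but contains all chosen edges at $L$, at least $6|L|$ in
  number, against local sparsity.
\<close>

lemma small_sets_expand:
  assumes V: "finite V" and E: "E \<subseteq> nsets V d" and d: "d \<ge> 3"
    and cover: "\<forall>x\<in>V. \<exists>e\<in>E. x \<in> e"
    and sparse: "locally_sparse t V E" and far: "low_degree_far d (6 * d) E"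
    and D: "D \<subseteq> E"
      "\<And>x. x \<in> V \<Longrightarrow> card {e\<in>E. x \<in> e} < 6 * d \<Longrightarrow> {e\<in>E. x \<in> e} \<subseteq> D"
      "\<And>x. x \<in> V \<Longrightarrow> card {e\<in>E. x \<in> e} \<ge> 6 * d \<Longrightarrow> card {e\<in>D. x \<in> e} \<ge> 6 * d"
    and U: "U \<subseteq> V" "6 * card U \<le> t"
  shows "2 * card U \<le> card (nbhd (linked D) V U)"
proof (rule ccontr)
  assume small: "\<not> ?thesis"
  let ?K = "6 * d" and ?N = "nbhd (linked D) V U"
  have finE: "finite E" using E V finite_imp_finite_nsets finite_subset by blast
  have finD: "finite D" using finE D(1) finite_subset by blast
  have E': "finite e" "card e = d" "e \<subseteq> V" if "e \<in> E" for e
    using E that by (auto simp: nsets_def)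
  have finU: "finite U" using U(1) V finite_subset by blast
  define S where "S = {x\<in>U. card {e\<in>E. x \<in> e} < ?K}"
  define L where "L = U - S"
  have S: "S \<subseteq> U" "finite S" and L: "finite L" "card U = card L + card S"
    using finU by (auto simp: S_def L_def card_Diff_subset card_mono)
  have low: "card {e\<in>E. s \<in> e} < ?K" if "s \<in> S" for s using that by (simp add: S_def)
  have "\<forall>s\<in>S. \<exists>e\<in>E. s \<in> e" using cover S(1) U(1) by blast
  then obtain \<epsilon> where \<epsilon>: "\<And>s. s \<in> S \<Longrightarrow> \<epsilon> s \<in> E \<and> s \<in> \<epsilon> s" by metis
  have \<epsilon>D: "\<epsilon> s \<in> D" if "s \<in> S" for s
    using D(2)[of s] low[OF that] \<epsilon>[OF that] S(1) U(1) that by blast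
  have chain: "s = s'" if "s \<in> S" "s' \<in> S" "successively (\<lambda>e f. e \<inter> f \<noteq> {}) es" "set es \<subseteq> E"
    "es \<noteq> []" "length es \<le> 4" "s \<in> \<Union>(set es)" "s' \<in> \<Union>(set es)" for s s' es
    using low_degree_far_chain[OF far _ _ that(3-8)] d E' low that(1,2) by auto
  have disj: "\<epsilon> s \<inter> \<epsilon> s' = {}" if "s \<in> S" "s' \<in> S" "s \<noteq> s'" for s s'
    using chain[OF that(1,2), of "[\<epsilon> s, \<epsilon> s']"] \<epsilon> that by auto
  let ?T = "U \<union> ?N"
  have TV: "?T \<subseteq> V" using U(1) by (auto simp: nbhd_def)
  have cT: "card ?T < 3 * card U"
    using small card_Un_le[of U ?N] by linarith
  have inT: "e \<subseteq> ?T" if "e \<in> D" "e \<inter> U \<noteq> {}" for e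
    using that D(1) E'(3)[of e] by (fastforce simp: nbhd_def linked_def)
  define S1 where "S1 = {s\<in>S. \<exists>f\<in>D. f \<inter> L \<noteq> {} \<and> f \<inter> \<epsilon> s \<noteq> {}}"
  define S0 where "S0 = S - S1"
  have S01: "S1 \<subseteq> S" "S0 \<subseteq> S" "finite S0" "card S = card S0 + card S1"
    using S(2) by (auto simp: S1_def S0_def card_Diff_subset card_mono)
  have "card S1 \<le> card L"
  proof -
    have "\<forall>s\<in>S1. \<exists>x f. f \<in> D \<and> x \<in> f \<and> x \<in> L \<and> f \<inter> \<epsilon> s \<noteq> {}" by (auto simp: S1_def)
    then obtain x f where xf: "\<And>s. s \<in> S1 \<Longrightarrow> f s \<in> D \<and> x s \<in> f s \<and> x s \<in> L \<and> f s \<inter> \<epsilon> s \<noteq> {}"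
      by metis
    have "inj_on x S1"
    proof (rule inj_onI)
      fix s s' assume s: "s \<in> S1" "s' \<in> S1" "x s = x s'"
      then have ss: "s \<in> S" "s' \<in> S" using S01 by auto
      have "f s \<inter> f s' \<noteq> {}" using xf s by (metis disjoint_iff)
      \<comment> \<open>Two vertices of \<open>S1\<close> with the same witness in \<open>L\<close> are joined by a chain of four edges.\<close>
      then have "successively (\<lambda>e f. e \<inter> f \<noteq> {}) [\<epsilon> s, f s, f s', \<epsilon> s']"
        using xf[OF s(1)] xf[OF s(2)] by auto
      then show "s = s'" using \<epsilon> ss xf s D(1)
        by (intro chain[OF ss, of "[\<epsilon> s, f s, f s', \<epsilon> s']"]) auto
    qed
    then show ?thesis using xf L(1) by (intro card_inj_on_le[of x]) auto
  qed
  define T' where "T' = ?T - (\<Union>s\<in>S0. \<epsilon> s)"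
  have "card (\<Union>s\<in>S0. \<epsilon> s) = (\<Sum>s\<in>S0. card (\<epsilon> s))"
    using S01 \<epsilon> E' disj by (intro card_UN_disjoint) (auto simp: subset_iff)
  also have "\<dots> = card S0 * d" using \<epsilon> E' S01 by (simp add: subset_iff)
  finally have cUN: "card (\<Union>s\<in>S0. \<epsilon> s) = card S0 * d" .
  have "(\<Union>s\<in>S0. \<epsilon> s) \<subseteq> ?T"
  proof clarify
    fix y s assume "s \<in> S0" "y \<in> \<epsilon> s" "y \<notin> ?N"
    then show "y \<in> U" using inT[of "\<epsilon> s"] \<epsilon>D[of s] \<epsilon>[of s] S01 S(1) by blast
  qed
  then have "card S0 * d \<le> card ?T"
    unfolding cUN[symmetric] using TV V by (intro card_mono) (auto intro: finite_subset)
  moreover have "card T' = card ?T - card S0 * d" using \<open>(\<Union>s\<in>S0. \<epsilon> s) \<subseteq> ?T\<close>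
    unfolding T'_def cUN[symmetric] using TV V S01(3) \<epsilon> E' S01
    by (intro card_Diff_subset) (auto simp: subset_iff)
  moreover have "card S0 * 3 \<le> card S0 * d" using d by simp
  ultimately have cT': "card T' < 6 * card L"
    using cT L(2) S01(4) \<open>card S1 \<le> card L\<close> by linarith
  let ?A = "{e\<in>D. e \<inter> L \<noteq> {}}"
  have A: "?A \<subseteq> {e\<in>E. e \<subseteq> T'}"
  proof clarify
    fix e assume e: "e \<in> D" "e \<inter> L \<noteq> {}"
    then have "e \<subseteq> ?T" by (intro inT) (auto simp: L_def)
    moreover have "e \<inter> \<epsilon> s = {}" if "s \<in> S0" for s
      using that e by (auto simp: S0_def S1_def)
    ultimately show "e \<in> E \<and> e \<subseteq> T'" using e D(1) by (auto simp: T'_def)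
  qed
  have "?K * card L = (\<Sum>x\<in>L. ?K)" by simp
  also have "\<dots> \<le> (\<Sum>x\<in>L. card {e\<in>?A. x \<in> e})"
  proof (rule sum_mono)
    fix x assume x: "x \<in> L"
    then have "?K \<le> card {e\<in>D. x \<in> e}" using U(1) by (intro D(3)) (auto simp: L_def S_def)
    also have "{e\<in>D. x \<in> e} = {e\<in>?A. x \<in> e}" using x by auto
    finally show "?K \<le> card {e\<in>?A. x \<in> e}" .
  qed
  also have "\<dots> = (\<Sum>e\<in>?A. card {x\<in>L. x \<in> e})"
    by (rule sum_multicount_gen[where R = "\<lambda>x e. x \<in> e"]) (use L(1) finD in auto)
  also have "\<dots> \<le> (\<Sum>e\<in>?A. d)"
  proof (rule sum_mono)
    fix e assume "e \<in> ?A"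
    then have "e \<in> E" using D(1) by auto
    then have "card {x\<in>L. x \<in> e} \<le> card e" using E' by (intro card_mono) auto
    then show "card {x\<in>L. x \<in> e} \<le> d" using E' \<open>e \<in> E\<close> by simp
  qed
  finally have "6 * card L * d \<le> card ?A * d" by (simp add: algebra_simps)
  then have "6 * card L \<le> card ?A" using d by simp
  also have "\<dots> \<le> card {e\<in>E. e \<subseteq> T'}" using A finE by (intro card_mono) auto
  finally have "card T' \<le> card {e\<in>E. e \<subseteq> T'}" using cT' by linarith
  moreover have "T' \<noteq> {}"
  proof
    assume "T' = {}"
    then have "?A = {}" using A by blast
    then have "card ?A = 0" by (simp only: card.empty)
    then show False using cT' \<open>6 * card L \<le> card ?A\<close> by linarith
  qed
  moreover have "card T' \<le> t" using cT' U(2) L(2) by linarith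
  moreover have "T' \<subseteq> V" using TV by (auto simp: T'_def)
  ultimately show False using sparse unfolding locally_sparse_def by (meson leD)
qed

text \<open>
  The part of \<^const>\<open>expanding\<close> that concerns sets of more than $u$ vertices.
\<close>

definition mid_expanding :: "nat \<Rightarrow> 'a set \<Rightarrow> 'a set set \<Rightarrow> bool" where
  "mid_expanding u V E \<longleftrightarrow> (\<forall>U\<subseteq>V. u < card U \<longrightarrow> 4 * card U \<le> card V \<longrightarrow>
     2 * card U \<le> card (nbhd (linked E) V U))"

text \<open>
  The certificate is the union of \<open>G\<close>, which expands large sets, of $6d$ edges at each vertex, which
  expand small sets, and of the edges of a longest path, which make every booster useful to \<open>E\<close>.
\<close>

theorem sparse_booster_free_expander:
  assumes V: "finite V" "card V \<ge> 8" and E: "E \<subseteq> nsets V d" and d: "d \<ge> 3"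
    and cover: "\<forall>x\<in>V. \<exists>e\<in>E. x \<in> e" and nh: "\<not> weak_hamiltonian (V, E)"
    and sparse: "locally_sparse (6 * u) V E" and far: "low_degree_far d (6 * d) E"
    and G: "G \<subseteq> E" "card G \<le> g" "mid_expanding u V G"
  shows "\<exists>\<Gamma>\<subseteq>E. card \<Gamma> \<le> g + (6 * d + 1) * card V \<and> E \<inter> boosters d V \<Gamma> = {} \<and>
     card V choose d \<le> 16 * card (boosters d V \<Gamma>)"
proof -
  have finE: "finite E" using E V finite_imp_finite_nsets finite_subset by blast
  obtain D where D: "D \<subseteq> E" "card D \<le> 6 * d * card V"
    "\<And>x. x \<in> V \<Longrightarrow> card {e\<in>E. x \<in> e} < 6 * d \<Longrightarrow> {e\<in>E. x \<in> e} \<subseteq> D"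
    "\<And>x. x \<in> V \<Longrightarrow> card {e\<in>E. x \<in> e} \<ge> 6 * d \<Longrightarrow> card {e\<in>D. x \<in> e} \<ge> 6 * d"
    using degree_certificate[OF V(1) finE, of "6 * d"] by blast
  obtain x where "x \<in> V" using V(2) by fastforce
  then have "path_in (linked E) V [x]" by (simp add: path_in_def)
  then obtain P where P: "longest_path (linked E) V P" using ex_longest_path V(1) by blast
  then have P': "P \<noteq> []" "distinct P" "set P \<subseteq> V" "successively (linked E) P"
    by (auto simp: longest_path_def path_in_def)
  obtain F where F: "F \<subseteq> E" "card F \<le> length P" "successively (linked F) P"
    using path_certificate[OF P'(4)] by auto
  have lenP: "length P \<le> card V" using P' V(1) by (metis card_mono distinct_card)
  define \<Gamma> where "\<Gamma> = G \<union> D \<union> F"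
  have sub: "\<Gamma> \<subseteq> E" using G D F by (auto simp: \<Gamma>_def)
  have "card \<Gamma> \<le> card G + card D + card F"
    unfolding \<Gamma>_def by (metis (no_types, lifting) add_le_mono1 card_Un_le le_trans)
  then have c\<Gamma>: "card \<Gamma> \<le> g + (6 * d + 1) * card V"
    using G(2) D(2) F(2) lenP by (simp add: algebra_simps)
  have exp: "expanding (linked \<Gamma>) V"
    unfolding expanding_def
  proof (intro allI impI)
    fix U assume U: "U \<subseteq> V" "4 * card U \<le> card V"
    have fin: "finite (nbhd (linked \<Gamma>) V U)" using V(1) by (simp add: nbhd_def)
    show "2 * card U \<le> card (nbhd (linked \<Gamma>) V U)"
    proof (cases "u < card U")
      case True
      then have "2 * card U \<le> card (nbhd (linked G) V U)"
        using G(3) U by (simp add: mid_expanding_def)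
      also have "\<dots> \<le> card (nbhd (linked \<Gamma>) V U)"
        by (intro card_mono fin nbhd_linked_mono) (auto simp: \<Gamma>_def)
      finally show ?thesis .
    next
      case False
      then have "2 * card U \<le> card (nbhd (linked D) V U)"
        using small_sets_expand[OF V(1) E d cover sparse far D(1,3,4) U(1)] by simp
      also have "\<dots> \<le> card (nbhd (linked \<Gamma>) V U)"
        by (intro card_mono fin nbhd_linked_mono) (auto simp: \<Gamma>_def)
      finally show ?thesis .
    qed
  qed
  have "path_in (linked F) V P" using P' F(3) by (simp add: path_in_def)
  then have "path_in (linked \<Gamma>) V P"
    by (rule path_in_linked_mono[rotated]) (auto simp: \<Gamma>_def)
  then have "E \<inter> boosters d V \<Gamma> = {}"
    by (intro boosters_avoided[OF exp V sub P _ nh])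
  moreover have "card V choose d \<le> 16 * card (boosters d V \<Gamma>)"
    using card_boosters[OF exp V] d by simp
  ultimately show ?thesis using sub c\<Gamma> by blast
qed

section \<open>Random subsets of a finite set\<close>

abbreviation prob :: "'a pmf \<Rightarrow> 'a set \<Rightarrow> real" where
  "prob M A \<equiv> measure_pmf.prob M A"

definition random_subset :: "'a set \<Rightarrow> real \<Rightarrow> 'a set pmf" where
  "random_subset X p = map_pmf (\<lambda>b. {e \<in> X. b e}) (Pi_pmf X False (\<lambda>_. bernoulli_pmf p))"

lemma hyp_np_eq: "hyp_np d n p = map_pmf (Pair {1..n}) (random_subset (nsets {1..n} d) p)"
  by (simp add: hyp_np_def random_subset_def map_pmf_comp)

lemma set_random_subset: "set_pmf (random_subset X p) \<subseteq> Pow X"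
  by (auto simp: random_subset_def)

lemma finite_set_random_subset: "finite X \<Longrightarrow> finite (set_pmf (random_subset X p))"
  using set_random_subset finite_subset by (metis finite_Pow_iff)

text \<open>
  Independence enters the first-moment estimates only through this identity.
\<close>

lemma prob_random_subset_contains_avoids:
  assumes "finite X" "F \<subseteq> X" "B \<subseteq> X" "F \<inter> B = {}" "0 \<le> p" "p \<le> 1"
  shows "prob (random_subset X p) {E. F \<subseteq> E \<and> E \<inter> B = {}} = p ^ card F * (1 - p) ^ card B"
proof -
  let ?C = "\<lambda>e. if e \<in> F then {True} else if e \<in> B then {False} else UNIV"
  have eq: "(\<lambda>b. {e \<in> X. b e}) -` {E. F \<subseteq> E \<and> E \<inter> B = {}} = Pi X ?C"
    using assms(2-4) by (auto simp: Pi_def vimage_def split: if_splits)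
  have "prob (random_subset X p) {E. F \<subseteq> E \<and> E \<inter> B = {}} =
      (\<Prod>e\<in>X. prob (bernoulli_pmf p) (?C e))"
    unfolding random_subset_def measure_map_pmf eq by (rule measure_Pi_pmf_Pi[OF assms(1)])
  also have "\<dots> = (\<Prod>e\<in>X. (if e \<in> F then p else 1) * (if e \<in> B then 1 - p else 1))"
    using assms(4-6) by (intro prod.cong) (auto simp: measure_pmf_single)
  also have "\<dots> = (\<Prod>e\<in>X. if e \<in> F then p else 1) * (\<Prod>e\<in>X. if e \<in> B then 1 - p else 1)"
    by (rule prod.distrib)
  also have "\<dots> = (\<Prod>e\<in>X \<inter> F. p) * (\<Prod>e\<in>X \<inter> B. 1 - p)"
    by (simp only: prod.inter_restrict[OF assms(1)])
  finally show ?thesis using assms(2,3) by (simp add: Int_absorb1)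
qed

lemma pmf_random_subset:
  assumes "finite X" "E \<subseteq> X" "0 \<le> p" "p \<le> 1"
  shows "pmf (random_subset X p) E = p ^ card E * (1 - p) ^ (card X - card E)"
proof -
  have "pmf (random_subset X p) E = prob (random_subset X p) {E}"
    by (simp add: measure_pmf_single)
  also have "\<dots> = prob (random_subset X p) {E'. E \<subseteq> E' \<and> E' \<inter> (X - E) = {}}"
  proof (rule measure_prob_cong_0)
    fix x assume "x \<in> {E'. E \<subseteq> E' \<and> E' \<inter> (X - E) = {}} - {E}"
    then have "x \<notin> Pow X" by auto
    then show "pmf (random_subset X p) x = 0"
      using set_random_subset[of X p] by (auto simp: pmf_eq_0_set_pmf)
  qed auto
  also have "\<dots> = p ^ card E * (1 - p) ^ card (X - E)"
    using assms by (intro prob_random_subset_contains_avoids) auto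
  also have "card (X - E) = card X - card E"
    using assms by (intro card_Diff_subset) (auto intro: finite_subset)
  finally show ?thesis .
qed

text \<open>
  Turns the probability into a finite sum, which makes interchanging sums and expectations elementary.
\<close>

lemma prob_finite_support:
  assumes "finite S" "set_pmf M \<subseteq> S"
  shows "prob M A = (\<Sum>x\<in>S. pmf M x * of_bool (x \<in> A))"
proof -
  have "prob M A = prob M (S \<inter> A)"
    using assms(2) by (intro measure_prob_cong_0) (auto simp: set_pmf_eq)
  also have "\<dots> = (\<Sum>x\<in>S \<inter> A. pmf M x)"
    using assms(1) by (simp add: measure_measure_pmf_finite)
  also have "\<dots> = (\<Sum>x\<in>S. pmf M x * of_bool (x \<in> A))"
    using assms(1) by simp
  finally show ?thesis .
qed

lemma prob_random_subset:
  assumes "finite X" "0 \<le> p" "p \<le> 1"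
  shows "prob (random_subset X p) A =
    (\<Sum>E\<in>Pow X. p ^ card E * (1 - p) ^ (card X - card E) * of_bool (E \<in> A))"
  using assms by (subst prob_finite_support[OF _ set_random_subset])
    (auto simp: pmf_random_subset intro!: sum.cong)

text \<open>
  Monotone coupling: draw a pair of random bits at each element, where the first implies the second and
  the two have success probabilities $p$ and $p'$.
\<close>

lemma prob_random_subset_mono:
  assumes "finite X" "0 \<le> p" "p \<le> p'" "p' \<le> 1"
    and up: "\<And>E E'. E \<in> Q \<Longrightarrow> E \<subseteq> E' \<Longrightarrow> E' \<subseteq> X \<Longrightarrow> E' \<in> Q"
  shows "prob (random_subset X p) Q \<le> prob (random_subset X p') Q"
proof (cases "p = 1")
  case True
  then show ?thesis using assms by simp
next
  case False
  define r where "r = (p' - p) / (1 - p)"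
  have r: "0 \<le> r" "r \<le> 1" using assms False by (auto simp: r_def field_simps)
  have pr: "p + (1 - p) * r = p'" using False assms by (simp add: r_def)
  \<comment> \<open>The second bit is the disjunction of the first with an independent bit of probability
    \<open>r\<close>, chosen such that \<open>1 - p' = (1 - p) (1 - r)\<close>.\<close>
  define J where "J = bernoulli_pmf p \<bind> (\<lambda>a. map_pmf (\<lambda>b. (a, a \<or> b)) (bernoulli_pmf r))"
  have J1: "map_pmf fst J = bernoulli_pmf p"
    by (simp add: J_def map_bind_pmf map_pmf_comp map_pmf_const bind_return_pmf')
  have J2: "map_pmf snd J = bernoulli_pmf p'"
  proof -
    have or: "(\<or>) True = (\<lambda>_. True)" "(\<or>) False = (\<lambda>b. b)" by auto
    have T: "pmf (map_pmf snd J) True = p'"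
      using assms r pr
      by (simp add: J_def map_bind_pmf map_pmf_comp pmf_bind map_pmf_const or mult.commute)
    have "pmf (map_pmf snd J) False = 1 - p'"
      using T pmf_False_conv_True[of "map_pmf snd J"] by simp
    then show ?thesis using T assms by (intro pmf_eqI) (case_tac i; simp)
  qed
  have J3: "x \<in> set_pmf J \<Longrightarrow> fst x \<Longrightarrow> snd x" for x by (auto simp: J_def)
  define M where "M = Pi_pmf X (False, False) (\<lambda>_. J)"
  have 1: "random_subset X p = map_pmf (\<lambda>h. {e\<in>X. fst (h e)}) M"
    unfolding random_subset_def M_def J1[symmetric]
    by (subst Pi_pmf_map[where dflt = "(False, False)"]) (use assms(1) in \<open>auto simp: map_pmf_comp\<close>)
  have 2: "random_subset X p' = map_pmf (\<lambda>h. {e\<in>X. snd (h e)}) M"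
    unfolding random_subset_def M_def J2[symmetric]
    by (subst Pi_pmf_map[where dflt = "(False, False)"]) (use assms(1) in \<open>auto simp: map_pmf_comp\<close>)
  have "prob M ((\<lambda>h. {e\<in>X. fst (h e)}) -` Q) \<le>
      prob M ((\<lambda>h. {e\<in>X. snd (h e)}) -` Q)"
  proof (rule measure_pmf.finite_measure_mono_AE)
    show "AE h in M. h \<in> (\<lambda>h. {e\<in>X. fst (h e)}) -` Q \<longrightarrow> h \<in> (\<lambda>h. {e\<in>X. snd (h e)}) -` Q"
      unfolding AE_measure_pmf_iff
    proof (intro ballI impI)
      fix h assume h: "h \<in> set_pmf M" "h \<in> (\<lambda>h. {e\<in>X. fst (h e)}) -` Q"
      have "h e \<in> set_pmf J" if "e \<in> X" for e
        using h(1) that assms(1) by (auto simp: M_def set_Pi_pmf PiE_dflt_def)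
      then have "{e\<in>X. fst (h e)} \<subseteq> {e\<in>X. snd (h e)}" using J3 by blast
      then show "h \<in> (\<lambda>h. {e\<in>X. snd (h e)}) -` Q" using h(2) up by auto
    qed
  qed auto
  then show ?thesis by (simp add: 1 2)
qed

section \<open>Exponential tail bounds by summing over subsets\<close>

lemma sum_Pow_binomial:
  fixes a b :: real
  assumes "finite A"
  shows "(\<Sum>F\<in>Pow A. a ^ card F * b ^ (card A - card F)) = (a + b) ^ card A"
proof -
  have "(a + b) ^ card A = (\<Prod>x\<in>A. a + b)" by simp
  also have "\<dots> = (\<Sum>F\<in>Pow A. (\<Prod>x\<in>F. a) * (\<Prod>x\<in>A-F. b))" by (rule prod_add[OF assms])
  also have "\<dots> = (\<Sum>F\<in>Pow A. a ^ card F * b ^ (card A - card F))"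
    using assms by (intro sum.cong) (auto simp: card_Diff_subset finite_subset)
  finally show ?thesis by simp
qed

lemma sum_Pow_power_le_exp:
  fixes a :: real
  assumes "finite A" "0 \<le> a"
  shows "(\<Sum>F\<in>Pow A. a ^ card F) \<le> exp (a * card A)"
proof -
  have "(\<Sum>F\<in>Pow A. a ^ card F) = (1 + a) ^ card A"
    using sum_Pow_binomial[OF assms(1), of a 1] by (simp add: add.commute)
  also have "\<dots> \<le> exp a ^ card A" using assms by (intro power_mono) auto
  also have "\<dots> = exp (a * card A)" by (simp add: exp_of_nat_mult[symmetric] mult.commute)
  finally show ?thesis .
qed

lemma prob_UNION_le:
  assumes "finite I" "\<And>i. i \<in> I \<Longrightarrow> prob M (A i) \<le> b i"
  shows "prob M (\<Union>i\<in>I. A i) \<le> sum b I"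
proof -
  have "prob M (\<Union>i\<in>I. A i) \<le> (\<Sum>i\<in>I. prob M (A i))"
    by (rule measure_UNION_le) (use assms in auto)
  also have "\<dots> \<le> sum b I" by (rule sum_mono) (rule assms(2))
  finally show ?thesis .
qed

lemma prob_le_finite_support:
  "set_pmf M \<inter> A \<subseteq> B \<Longrightarrow> prob M A \<le> prob M B"
  by (rule measure_pmf.finite_measure_mono_AE) (auto simp: AE_measure_pmf_iff)

text \<open>
  Markov's inequality for $y^{|E|}$.
\<close>

lemma prob_many_elements:
  assumes "finite X" "0 \<le> p" "p \<le> 1" "y \<ge> 1"
  shows "prob (random_subset X p) {E. m \<le> card E} \<le> exp (y * p * card X) / y ^ m"
proof -
  have "prob (random_subset X p) {E. m \<le> card E} =
    (\<Sum>E\<in>Pow X. p ^ card E * (1 - p) ^ (card X - card E) * of_bool (m \<le> card E))"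
    by (subst prob_random_subset[OF assms(1-3)]) simp
  also have "\<dots> \<le> (\<Sum>E\<in>Pow X. (y * p) ^ card E / y ^ m)"
  proof (rule sum_mono)
    fix E assume "E \<in> Pow X"
    have "y ^ m * of_bool (m \<le> card E) \<le> y ^ card E"
      using assms(4) by (auto intro: power_increasing)
    moreover have "p ^ card E * (1 - p) ^ (card X - card E) \<le> p ^ card E"
      using assms by (intro mult_right_le_one_le) (auto intro: power_le_one)
    ultimately have "(p ^ card E * (1 - p) ^ (card X - card E)) * (y ^ m * of_bool (m \<le> card E)) \<le>
        p ^ card E * y ^ card E"
      using assms by (intro mult_mono) auto
    then show "p ^ card E * (1 - p) ^ (card X - card E) * of_bool (m \<le> card E) \<le> (y * p) ^ card E / y ^ m"
      using assms(4) by (simp add: field_simps power_mult_distrib)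
  qed
  also have "\<dots> = (\<Sum>E\<in>Pow X. (y * p) ^ card E) / y ^ m" by (simp add: sum_divide_distrib)
  also have "\<dots> \<le> exp (y * p * card X) / y ^ m"
    using assms sum_Pow_power_le_exp[OF assms(1), of "y * p"] by (intro divide_right_mono) auto
  finally show ?thesis .
qed

text \<open>
  Markov's inequality for $y^{|E \cap A|}$ with $y \le 1$, conditional on $F \subseteq E$.
\<close>

lemma prob_contains_few_within:
  assumes "finite X" "0 \<le> p" "p \<le> 1" "0 < y" "y \<le> 1" "F \<subseteq> X" "A \<subseteq> X" "F \<inter> A = {}"
  shows "prob (random_subset X p) {E. F \<subseteq> E \<and> card (E \<inter> A) \<le> m} \<le>
    p ^ card F * exp (- (1 - y) * p * card A) / y ^ m"
proof -
  let ?A = "\<lambda>J. {E. card J \<le> m \<and> F \<union> J \<subseteq> E \<and> E \<inter> (A - J) = {}}"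
  have finA: "finite A" using assms finite_subset by blast
  have "prob (random_subset X p) {E. F \<subseteq> E \<and> card (E \<inter> A) \<le> m} \<le>
    prob (random_subset X p)
      (\<Union>J\<in>Pow A. (?A J))"
    by (intro prob_le_finite_support) (force intro: exI[of _ "_ \<inter> A"])
  also have "\<dots> \<le> (\<Sum>J\<in>Pow A. p ^ card F * ((y * p) ^ card J * (1 - p) ^ (card A - card J)) / y ^ m)"
  proof (rule prob_UNION_le)
    fix J assume J: "J \<in> Pow A"
    show "prob (random_subset X p) (?A J) \<le>
      p ^ card F * ((y * p) ^ card J * (1 - p) ^ (card A - card J)) / y ^ m"
    proof (cases "card J \<le> m")
      case True
      have "(?A J) = {E. F \<union> J \<subseteq> E \<and> E \<inter> (A - J) = {}}"
        using True by auto
      moreover have "prob (random_subset X p) {E. F \<union> J \<subseteq> E \<and> E \<inter> (A - J) = {}} =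
        p ^ card (F \<union> J) * (1 - p) ^ card (A - J)"
        using J assms by (intro prob_random_subset_contains_avoids) auto
      ultimately have "prob (random_subset X p) (?A J) =
        p ^ card (F \<union> J) * (1 - p) ^ card (A - J)" by simp
      also have "\<dots> = p ^ card F * (p ^ card J * (1 - p) ^ (card A - card J))"
        using J assms finA finite_subset[OF assms(6,1)] finite_subset[of J A]
        by (subst card_Un_disjoint) (auto simp: card_Diff_subset power_add)
      also have "\<dots> \<le> p ^ card F * (p ^ card J * (1 - p) ^ (card A - card J)) * (y ^ card J / y ^ m)"
      proof -
        have "1 \<le> y ^ card J / y ^ m"
          using True assms by (auto simp: field_simps intro: power_decreasing)
        from mult_left_mono[OF this, of "p ^ card F * (p ^ card J * (1 - p) ^ (card A - card J))"]
        show ?thesis using assms by simp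
      qed
      finally show ?thesis by (simp add: power_mult_distrib mult_ac)
    qed (use assms in simp)
  qed (use finA in auto)
  also have "\<dots> = p ^ card F * (\<Sum>J\<in>Pow A. (y * p) ^ card J * (1 - p) ^ (card A - card J)) / y ^ m"
    by (simp add: sum_distrib_left sum_divide_distrib)
  also have "\<dots> = p ^ card F * (y * p + (1 - p)) ^ card A / y ^ m"
    by (simp add: sum_Pow_binomial[OF finA])
  also have "\<dots> \<le> p ^ card F * exp (- (1 - y) * p) ^ card A / y ^ m"
  proof -
    have "y * p + (1 - p) \<le> exp (- (1 - y) * p)"
      using exp_ge_add_one_self[of "- (1 - y) * p"] by (simp add: algebra_simps)
    then show ?thesis using assms by (intro divide_right_mono mult_left_mono power_mono) auto
  qed
  also have "exp (- (1 - y) * p) ^ card A = exp (- (1 - y) * p * card A)"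
    by (simp add: exp_of_nat_mult[symmetric] mult_ac)
  finally show ?thesis .
qed

text \<open>
  A union bound over all small certificates $\Gamma$, where $\Gamma$ is present and its $b$ or more
  forbidden elements are absent. The factor $y^{|\Gamma| - M} \ge 1$ replaces the restriction
  $|\Gamma| \le M$, after which the sum over $\Gamma$ is a binomial one.
\<close>

lemma prob_sparse_certificate:
  assumes "finite X" "0 \<le> p" "p \<le> 1" "0 < y" "y \<le> 1"
    and B: "\<And>\<Gamma>. B \<Gamma> \<subseteq> X" "\<And>\<Gamma>. P \<Gamma> \<Longrightarrow> b \<le> card (B \<Gamma>)"
  shows "prob (random_subset X p)
      {E. \<exists>\<Gamma>\<subseteq>E. card \<Gamma> \<le> M \<and> E \<inter> B \<Gamma> = {} \<and> P \<Gamma>} \<le> exp (y * p * card X - p * b) / y ^ M"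
proof -
  let ?A = "\<lambda>\<Gamma>. {E. card \<Gamma> \<le> M \<and> P \<Gamma> \<and> \<Gamma> \<inter> B \<Gamma> = {} \<and> \<Gamma> \<subseteq> E \<and> E \<inter> B \<Gamma> = {}}"
  have "prob (random_subset X p) {E. \<exists>\<Gamma>\<subseteq>E. card \<Gamma> \<le> M \<and> E \<inter> B \<Gamma> = {} \<and> P \<Gamma>} \<le>
    prob (random_subset X p)
      (\<Union>\<Gamma>\<in>Pow X. (?A \<Gamma>))"
    using set_random_subset[of X p] by (intro prob_le_finite_support) blast
  also have "\<dots> \<le> (\<Sum>\<Gamma>\<in>Pow X. (y * p) ^ card \<Gamma> * exp (- p * b) / y ^ M)"
  proof (rule prob_UNION_le)
    fix \<Gamma> assume \<Gamma>: "\<Gamma> \<in> Pow X"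
    show "prob (random_subset X p)
       (?A \<Gamma>) \<le>
      (y * p) ^ card \<Gamma> * exp (- p * b) / y ^ M"
    proof (cases "card \<Gamma> \<le> M \<and> P \<Gamma> \<and> \<Gamma> \<inter> B \<Gamma> = {}")
      case True
      then have "prob (random_subset X p)
        (?A \<Gamma>) =
        p ^ card \<Gamma> * (1 - p) ^ card (B \<Gamma>)"
        using \<Gamma> B(1) assms by (simp, intro prob_random_subset_contains_avoids) auto
      also have "\<dots> \<le> p ^ card \<Gamma> * exp (- p * b)"
      proof (intro mult_left_mono)
        have "(1 - p) ^ card (B \<Gamma>) \<le> exp (- p) ^ card (B \<Gamma>)"
          using assms exp_ge_add_one_self[of "- p"] by (intro power_mono) auto
        also have "\<dots> \<le> exp (- p * b)"
          using B(2)[of \<Gamma>] True assms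
          by (auto simp: exp_of_nat_mult[symmetric] mult.commute intro: mult_left_mono)
        finally show "(1 - p) ^ card (B \<Gamma>) \<le> exp (- p * b)" .
      qed (use assms in auto)
      also have "\<dots> \<le> p ^ card \<Gamma> * exp (- p * b) * (y ^ card \<Gamma> / y ^ M)"
      proof -
        have "1 \<le> y ^ card \<Gamma> / y ^ M"
          using True assms by (auto simp: field_simps intro: power_decreasing)
        from mult_left_mono[OF this, of "p ^ card \<Gamma> * exp (- p * b)"]
        show ?thesis using assms by simp
      qed
      finally show ?thesis by (simp add: power_mult_distrib mult_ac)
    next
      case False
      then have "(?A \<Gamma>) = {}" by auto
      then show ?thesis using assms by (simp only: measure_empty) simp
    qed
  qed (use assms in auto)
  also have "\<dots> = (\<Sum>\<Gamma>\<in>Pow X. (y * p) ^ card \<Gamma>) * exp (- p * b) / y ^ M"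
    by (simp add: sum_distrib_right sum_divide_distrib)
  also have "\<dots> \<le> exp (y * p * card X) * exp (- p * b) / y ^ M"
    using assms sum_Pow_power_le_exp[OF assms(1), of "y * p"]
    by (intro divide_right_mono mult_right_mono) auto
  finally show ?thesis by (simp add: exp_diff exp_minus field_simps)
qed

section \<open>Bonferroni's inequalities\<close>

lemma alternating_binomial_partial_sum:
  "(\<Sum>j\<le>k. (-1) ^ j * real (Suc m choose j)) = (-1) ^ k * real (m choose k)"
proof (induction k)
  case (Suc k)
  then show ?case by (simp add: algebra_simps)
qed simp

lemma bonferroni_indicator:
  assumes "finite I"
  shows "0 \<le> (-1) ^ k * ((\<Sum>j\<le>k. (-1) ^ j * real (card I choose j)) - of_bool (I = {}))"
proof (cases "I = {}")
  case True
  have "(\<Sum>j\<le>k. (-1) ^ j * real (0 choose j)) = (\<Sum>j\<in>{0}. (-1) ^ j * real (0 choose j))"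
    by (rule sum.mono_neutral_right) auto
  then show ?thesis using True by simp
next
  case False
  then obtain m where "card I = Suc m" using assms by (metis card_gt_0_iff gr0_conv_Suc)
  then show ?thesis using False
    by (simp add: alternating_binomial_partial_sum power_mult_distrib[symmetric] mult.assoc[symmetric])
qed

text \<open>
  For both parities of $k$ at once: the partial sum up to $k$ is an upper bound if $k$ is even and a
  lower bound if $k$ is odd. The inequality holds pointwise, since $\binom{|I|}{j}$ counts the
  $j$-subsets of the set $I$ of indices whose events occur.
\<close>

lemma bonferroni:
  assumes "finite V" "finite (set_pmf M)"
  shows "0 \<le> (-1) ^ k * ((\<Sum>j\<le>k. (-1) ^ j * (\<Sum>S\<in>nsets V j. prob M {x. \<forall>v\<in>S. P v x}))
             - prob M {x. \<forall>v\<in>V. \<not> P v x})"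
proof -
  let ?I = "\<lambda>x. {v\<in>V. P v x}" and ?S = "set_pmf M"
  let ?B = "(\<Sum>j\<le>k. (-1) ^ j * (\<Sum>S\<in>nsets V j. prob M {x. \<forall>v\<in>S. P v x}))"
  have choose: "(\<Sum>S\<in>nsets V j. of_bool (\<forall>v\<in>S. P v x)) = real (card (?I x) choose j)" for j x
  proof -
    have "(\<Sum>S\<in>nsets V j. of_bool (\<forall>v\<in>S. P v x)) = real (card (nsets V j \<inter> {S. \<forall>v\<in>S. P v x}))"
      using assms(1) by (simp add: finite_imp_finite_nsets)
    also have "nsets V j \<inter> {S. \<forall>v\<in>S. P v x} = nsets (?I x) j"
      by (auto simp: nsets_def)
    finally show ?thesis using assms(1) by (simp add: card_nsets)
  qed
  have prob: "prob M A = (\<Sum>x\<in>?S. pmf M x * of_bool (x \<in> A))" for A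
    by (rule prob_finite_support[OF assms(2) order.refl])
  have "(\<Sum>S\<in>nsets V j. prob M {x. \<forall>v\<in>S. P v x}) =
      (\<Sum>x\<in>?S. pmf M x * real (card (?I x) choose j))" for j
    unfolding choose[symmetric] prob sum_distrib_left by (subst sum.swap) simp
  then have "?B =
      (\<Sum>j\<le>k. \<Sum>x\<in>?S. pmf M x * ((-1) ^ j * real (card (?I x) choose j)))"
    by (simp add: sum_distrib_left mult_ac)
  also have "\<dots> = (\<Sum>x\<in>?S. pmf M x * (\<Sum>j\<le>k. (-1) ^ j * real (card (?I x) choose j)))"
    by (subst sum.swap) (simp add: sum_distrib_left)
  moreover have "prob M {x. \<forall>v\<in>V. \<not> P v x} = (\<Sum>x\<in>?S. pmf M x * of_bool (?I x = {}))"
    unfolding prob by (intro sum.cong) auto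
  ultimately have "(-1) ^ k * (?B
             - prob M {x. \<forall>v\<in>V. \<not> P v x}) =
     (\<Sum>x\<in>?S. pmf M x * ((-1) ^ k * ((\<Sum>j\<le>k. (-1) ^ j * real (card (?I x) choose j)) - of_bool (?I x = {}))))"
    by (simp add: sum_distrib_left sum_subtractf algebra_simps)
  also have "\<dots> \<ge> 0"
    using assms(1) by (intro sum_nonneg mult_nonneg_nonneg bonferroni_indicator) auto
  finally show ?thesis .
qed

section \<open>Comparison of the two random models\<close>

text \<open>
  The probability of $Q$ for a uniformly random subset of $X$ with $m$ elements.
\<close>

definition level_fraction :: "'a set \<Rightarrow> 'a set set \<Rightarrow> nat \<Rightarrow> real" where
  "level_fraction X Q m = card {E \<in> nsets X m. E \<in> Q} / (card X choose m)"

lemma level_fraction_bounds: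
  assumes "finite X"
  shows "0 \<le> level_fraction X Q m" "level_fraction X Q m \<le> 1"
proof -
  have "card {E \<in> nsets X m. E \<in> Q} \<le> card (nsets X m)"
    using assms by (intro card_mono) (auto simp: finite_imp_finite_nsets)
  then show "level_fraction X Q m \<le> 1"
    using assms by (auto simp: level_fraction_def card_nsets divide_le_eq_1)
qed (simp add: level_fraction_def)

text \<open>
  Double counting of the pairs $(E, x)$ with $x \notin E$: adding $x$ to a member of $Q$ stays in $Q$.
\<close>

lemma level_fraction_Suc:
  assumes "finite X" "Suc m \<le> card X"
    and up: "\<And>E E'. E \<in> Q \<Longrightarrow> E \<subseteq> E' \<Longrightarrow> E' \<subseteq> X \<Longrightarrow> E' \<in> Q"
  shows "level_fraction X Q m \<le> level_fraction X Q (Suc m)"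
proof -
  let ?N = "card X" and ?A = "{E \<in> nsets X m. E \<in> Q}" and ?B = "{E \<in> nsets X (Suc m). E \<in> Q}"
  have finAB: "finite ?A" "finite ?B" using assms(1) by (auto simp: finite_imp_finite_nsets)
  have "card ?A * (?N - m) = (\<Sum>E\<in>?A. card (X - E))"
    using assms(1) by (simp add: card_Diff_subset nsets_def)
  also have "\<dots> = card (Sigma ?A (\<lambda>E. X - E))"
    using finAB assms(1) by (subst card_SigmaI) auto
  also have "\<dots> \<le> card (Sigma ?B (\<lambda>E. E))"
  proof (rule card_inj_on_le)
    show "inj_on (\<lambda>(E, x). (insert x E, x)) (Sigma ?A (\<lambda>E. X - E))"
      by (auto simp: inj_on_def insert_ident)
    show "(\<lambda>(E, x). (insert x E, x)) ` Sigma ?A (\<lambda>E. X - E) \<subseteq> Sigma ?B (\<lambda>E. E)"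
    proof (rule image_subsetI)
      fix z assume "z \<in> Sigma ?A (\<lambda>E. X - E)"
      then obtain E x where "z = (E, x)" "E \<in> nsets X m" "E \<in> Q" "x \<in> X" "x \<notin> E" by auto
      then show "(case z of (E, x) \<Rightarrow> (insert x E, x)) \<in> Sigma ?B (\<lambda>E. E)"
        using up[of E "insert x E"] by (auto simp: nsets_def)
    qed
    show "finite (Sigma ?B (\<lambda>E. E))"
      using finAB by (intro finite_SigmaI) (auto simp: nsets_def)
  qed
  also have "\<dots> = (\<Sum>E\<in>?B. card E)"
    using finAB by (subst card_SigmaI) (auto simp: nsets_def)
  also have "\<dots> = card ?B * Suc m" by (simp add: nsets_def)
  finally have 1: "card ?A * (?N - m) \<le> card ?B * Suc m" .
  have 2: "(?N choose m) * (?N - m) = (?N choose Suc m) * Suc m"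
    using binomial_absorb_comp[of ?N m] binomial_absorption[of m ?N]
    by (simp only: mult.commute)
  have pos: "?N choose m > 0" "?N choose Suc m > 0" "?N - m > 0" using assms(2) by auto
  have "card ?A * (?N choose Suc m) * Suc m = card ?A * (?N - m) * (?N choose m)"
    using arg_cong[OF 2, of "\<lambda>t. card ?A * t"] by (simp only: mult_ac)
  also have "\<dots> \<le> card ?B * Suc m * (?N choose m)" by (rule mult_right_mono[OF 1]) simp
  finally have "card ?A * (?N choose Suc m) * Suc m \<le> card ?B * (?N choose m) * Suc m"
    by (simp only: mult_ac)
  then have "card ?A * (?N choose Suc m) \<le> card ?B * (?N choose m)" by (simp only: mult_le_cancel2)
  then have "real (card ?A) * (?N choose Suc m) \<le> real (card ?B) * (?N choose m)"
    by (simp only: of_nat_mult[symmetric] of_nat_le_iff)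
  then show ?thesis using pos by (simp add: level_fraction_def field_simps)
qed

lemma level_fraction_mono:
  assumes "finite X" "m \<le> m'" "m' \<le> card X"
    and up: "\<And>E E'. E \<in> Q \<Longrightarrow> E \<subseteq> E' \<Longrightarrow> E' \<subseteq> X \<Longrightarrow> E' \<in> Q"
  shows "level_fraction X Q m \<le> level_fraction X Q m'"
  using assms(2,3)
proof (induction m' rule: dec_induct)
  case (step k)
  then show ?case using level_fraction_Suc[where X = X and Q = Q and m = k, OF assms(1) _ up] by force
qed simp

lemma prob_random_subset_levels:
  assumes "finite X" "0 \<le> p" "p \<le> 1"
  shows "prob (random_subset X p) Q =
    (\<Sum>m\<le>card X. Bernstein (card X) m p * level_fraction X Q m)"
proof -
  let ?N = "card X"
  let ?w = "\<lambda>E. p ^ card E * (1 - p) ^ (?N - card E) * of_bool (E \<in> Q)"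
  have "prob (random_subset X p) Q =
    (\<Sum>E\<in>Pow X. (?w E))"
    by (rule prob_random_subset[OF assms])
  also have "\<dots> = (\<Sum>m\<le>?N. \<Sum>E\<in>{E\<in>Pow X. card E = m}. (?w E))"
    using assms(1) by (intro sum.group[symmetric]) (auto intro: card_mono)
  also have "\<dots> = (\<Sum>m\<le>?N. Bernstein ?N m p * level_fraction X Q m)"
  proof (rule sum.cong[OF refl])
    fix m assume m: "m \<in> {..?N}"
    have ns: "{E\<in>Pow X. card E = m} = nsets X m" using assms(1) by (auto simp: nsets_def finite_subset)
    have "(\<Sum>E\<in>{E\<in>Pow X. card E = m}. (?w E)) =
      (\<Sum>E\<in>{E\<in>Pow X. card E = m}. p ^ m * (1 - p) ^ (?N - m) * of_bool (E \<in> Q))"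
      by (intro sum.cong) auto
    also have "\<dots> = p ^ m * (1 - p) ^ (?N - m) * (\<Sum>E\<in>nsets X m. of_bool (E \<in> Q))"
      by (simp only: ns sum_distrib_left)
    also have "(\<Sum>E\<in>nsets X m. of_bool (E \<in> Q)) = real (card {E\<in>nsets X m. E \<in> Q})"
      using assms(1) by (simp add: finite_imp_finite_nsets Int_def)
    also have "p ^ m * (1 - p) ^ (?N - m) * real (card {E\<in>nsets X m. E \<in> Q}) =
        Bernstein ?N m p * level_fraction X Q m"
      using m by (simp add: Bernstein_def level_fraction_def)
    finally show "(\<Sum>E\<in>{E\<in>Pow X. card E = m}. (?w E)) =
      Bernstein ?N m p * level_fraction X Q m" .
  qed
  finally show ?thesis .
qed

text \<open>
  Chebyshev's inequality for the binomial distribution, whose weights are the Bernstein polynomials.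
\<close>

lemma Bernstein_deviation:
  assumes "0 \<le> p" "p \<le> 1" "a > 0"
  shows "(\<Sum>k\<le>N. Bernstein N k p * of_bool (a \<le> \<bar>real k - N * p\<bar>)) \<le> N * p / a\<^sup>2"
proof -
  have "(\<Sum>k\<le>N. Bernstein N k p * of_bool (a \<le> \<bar>real k - N * p\<bar>)) \<le>
      (\<Sum>k\<le>N. Bernstein N k p * ((real k - N * p)\<^sup>2 / a\<^sup>2))"
  proof (intro sum_mono mult_left_mono Bernstein_nonneg assms)
    fix k
    show "of_bool (a \<le> \<bar>real k - N * p\<bar>) \<le> (real k - N * p)\<^sup>2 / a\<^sup>2"
      using assms(3) by (auto simp: abs_le_square_iff[symmetric])
  qed
  also have "\<dots> = (\<Sum>k\<le>N. real k * (real k - 1) * Bernstein N k p + (1 - 2 * (N * p)) * (real k * Bernstein N k p)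
      + (N * p)\<^sup>2 * Bernstein N k p) / a\<^sup>2"
    unfolding sum_divide_distrib
    by (intro sum.cong) (auto simp: field_simps power2_eq_square)
  also have "\<dots> = (real N * (real N - 1) * p\<^sup>2 + (1 - 2 * (N * p)) * (N * p) + (N * p)\<^sup>2) / a\<^sup>2"
    by (simp add: sum.distrib sum_distrib_left[symmetric])
  also have "\<dots> = N * p * (1 - p) / a\<^sup>2"
    by (simp add: algebra_simps power2_eq_square)
  also have "\<dots> \<le> N * p / a\<^sup>2"
    using assms by (intro divide_right_mono mult_right_le_one_le) auto
  finally show ?thesis .
qed

text \<open>
  The number of elements of the binomial random subset stays within $a$ of its mean up to probability
  $Np/a^2$. On that event it is at most $m$ in the first case and at least $m$ in the second, and the
  fraction on a level grows with the level.
\<close>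

lemma level_fraction_transfer:
  fixes p a :: real
  assumes "finite X" "0 \<le> p" "p \<le> 1" "a > 0" "m \<le> card X"
    and up: "\<And>E E'. E \<in> Q \<Longrightarrow> E \<subseteq> E' \<Longrightarrow> E' \<subseteq> X \<Longrightarrow> E' \<in> Q"
  shows "card X * p + a \<le> m \<Longrightarrow>
      prob (random_subset X p) Q \<le> level_fraction X Q m + card X * p / a\<^sup>2"
    and "m \<le> card X * p - a \<Longrightarrow>
      level_fraction X Q m \<le> prob (random_subset X p) Q + card X * p / a\<^sup>2"
proof -
  let ?N = "card X" and ?f = "level_fraction X Q"
  let ?dev = "\<lambda>k. of_bool (a \<le> \<bar>real k - ?N * p\<bar>) :: real"
  have one: "c = (\<Sum>k\<le>?N. Bernstein ?N k p * c)" for c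
    by (simp add: sum_distrib_right[symmetric])
  note dev = Bernstein_deviation[OF assms(2-4), of ?N]
  {
    assume m: "?N * p + a \<le> m"
    have "prob (random_subset X p) Q \<le> (\<Sum>k\<le>?N. Bernstein ?N k p * (?f m + ?dev k))"
      unfolding prob_random_subset_levels[OF assms(1-3)]
    proof (intro sum_mono mult_left_mono Bernstein_nonneg assms(2,3))
      fix k assume k: "k \<in> {..?N}"
      show "?f k \<le> ?f m + ?dev k"
      proof (cases "k \<le> m")
        case True
        then show ?thesis using level_fraction_mono[OF assms(1) True assms(5) up]
          by (simp add: add_increasing2)
      next
        case False
        then have "?dev k = 1" using m by simp
        then show ?thesis using level_fraction_bounds[OF assms(1), of Q] by (simp add: add_increasing)
      qed
    qed
    also have "\<dots> = ?f m + (\<Sum>k\<le>?N. Bernstein ?N k p * ?dev k)"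
      by (simp only: distrib_left sum.distrib one[of "?f m", symmetric])
    finally show "prob (random_subset X p) Q \<le> ?f m + ?N * p / a\<^sup>2"
      using dev by linarith
  }
  {
    assume m: "m \<le> ?N * p - a"
    have "?f m = (\<Sum>k\<le>?N. Bernstein ?N k p * ?f m)" by (rule one)
    also have "\<dots> \<le> (\<Sum>k\<le>?N. Bernstein ?N k p * (?f k + ?dev k))"
    proof (intro sum_mono mult_left_mono Bernstein_nonneg assms(2,3))
      fix k assume k: "k \<in> {..?N}"
      show "?f m \<le> ?f k + ?dev k"
      proof (cases "m \<le> k")
        case True
        then show ?thesis using level_fraction_mono[OF assms(1) True _ up] k
          by (simp add: add_increasing2)
      next
        case False
        then have "?dev k = 1" using m by simp
        then show ?thesis using level_fraction_bounds[OF assms(1), of Q] by (simp add: add_increasing)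
      qed
    qed
    also have "\<dots> = prob (random_subset X p) Q + (\<Sum>k\<le>?N. Bernstein ?N k p * ?dev k)"
      by (simp only: distrib_left sum.distrib prob_random_subset_levels[OF assms(1-3)])
    finally show "?f m \<le> prob (random_subset X p) Q + ?N * p / a\<^sup>2"
      using dev by linarith
  }
qed

lemma prob_hyp_np:
  "prob (hyp_np d n p) {H. P H} =
   prob (random_subset (nsets {1..n} d) p) {E. P ({1..n}, E)}"
  unfolding hyp_np_eq measure_map_pmf by (simp only: vimage_Collect_eq)

lemma prob_hyp_nm:
  assumes "m \<le> n choose d"
  shows "prob (hyp_nm d n m) {H. P H} =
   level_fraction (nsets {1..n} d) {E. P ({1..n}, E)} m"
proof -
  let ?X = "nsets {1..n} d"
  let ?S = "{H. uniform_hypergraph d H \<and> verts H = {1..n} \<and> card (edges H) = m}"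
  have fX: "finite ?X" by (simp add: finite_imp_finite_nsets)
  have cX: "card ?X = n choose d" by (simp add: card_nsets)
  have S: "?S = Pair {1..n} ` nsets ?X m"
  proof (intro equalityI subsetI)
    fix H assume "H \<in> ?S"
    then have "H = Pair {1..n} (snd H)" "snd H \<in> nsets ?X m"
      using fX by (auto simp: uniform_hypergraph_def prod_eq_iff nsets_def[of "nsets _ _"] intro: finite_subset)
    then show "H \<in> Pair {1..n} ` nsets ?X m" by (rule image_eqI)
  next
    fix H assume "H \<in> Pair {1..n} ` nsets ?X m"
    then show "H \<in> ?S" by (auto simp: uniform_hypergraph_def nsets_def[of "nsets _ _"])
  qed
  have "card (nsets ?X m) = (n choose d) choose m" by (simp add: card_nsets fX cX)
  then have ne: "nsets ?X m \<noteq> {}" using assms by (metis binomial_eq_0_iff card.empty not_less)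
  have fin: "finite (nsets ?X m)" using fX by (rule finite_imp_finite_nsets)
  have "?S \<inter> {H. P H} = Pair {1..n} ` {E \<in> nsets ?X m. P ({1..n}, E)}" unfolding S by auto
  then have "card (?S \<inter> {H. P H}) = card {E \<in> nsets ?X m. P ({1..n}, E)}"
    by (simp add: card_image inj_on_def)
  moreover have "card ?S = card ?X choose m"
    unfolding S using fX by (simp add: card_image inj_on_def card_nsets)
  ultimately show ?thesis
    unfolding hyp_nm_def level_fraction_def
    by (subst measure_pmf_of_set) (use S ne fin in auto)
qed

section \<open>Bounds for the failure probabilities\<close>

lemma prob_random_subset_contains:
  assumes "finite X" "F \<subseteq> X" "0 \<le> p" "p \<le> 1"
  shows "prob (random_subset X p) {E. F \<subseteq> E} = p ^ card F"
  using prob_random_subset_contains_avoids[OF assms(1,2) empty_subsetI _ assms(3,4)] by simp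

lemma power_self_le_fact: "real k ^ k \<le> exp (real k) * fact k"
proof -
  have "(\<Sum>i\<in>{k}. (real k ^ i) /\<^sub>R fact i) \<le> exp (real k)"
    unfolding exp_def by (rule sum_le_suminf[OF summable_exp_generic]) auto
  then show ?thesis by (simp add: field_simps)
qed

lemma binomial_le_power_div_fact: "real (n choose k) \<le> real n ^ k / fact k"
proof -
  have "real ((n choose k) * fact k) \<le> real (n ^ k)"
    by (simp only: of_nat_le_iff binomial_fact_pow)
  then show ?thesis by (simp add: field_simps)
qed

text \<open>
  First moment over sets $T$ of $k$ vertices and $k$ edges inside $T$. With $k! \ge (k/e)^k$ twice, the
  $k$-th term is at most $(e^2\, n\, k^{d-2} p)^k$.
\<close>

lemma prob_not_locally_sparse:
  fixes p :: real
  assumes V: "finite V" and p: "0 \<le> p" "p \<le> 1" and d: "d \<ge> 2"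
  shows "prob (random_subset (nsets V d) p) {E. \<not> locally_sparse t V E} \<le>
    (\<Sum>k=1..t. (exp 2 * card V * real t ^ (d - 2) * p) ^ k)"
proof -
  let ?X = "nsets V d" and ?n = "card V"
  let ?M = "random_subset ?X p"
  have fX: "finite ?X" using V by (rule finite_imp_finite_nsets)
  have "prob ?M {E. \<not> locally_sparse t V E} \<le>
    prob ?M (\<Union>k\<in>{1..t}. \<Union>T\<in>nsets V k. \<Union>F\<in>nsets (nsets T d) k. {E. F \<subseteq> E})"
  proof (rule prob_le_finite_support, rule subsetI)
    fix E assume "E \<in> set_pmf ?M \<inter> {E. \<not> locally_sparse t V E}"
    then obtain T where E: "E \<subseteq> ?X" and T: "T \<subseteq> V" "T \<noteq> {}" "card T \<le> t" "card T \<le> card {e\<in>E. e \<subseteq> T}"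
      using set_random_subset[of ?X p] unfolding locally_sparse_def by (auto simp: not_less)
    then have fT: "finite T" using V finite_subset by blast
    obtain F where F: "F \<subseteq> {e\<in>E. e \<subseteq> T}" "card F = card T"
      using T(4) by (meson obtain_subset_with_card_n)
    have "F \<subseteq> nsets T d" using F(1) E by (auto simp: nsets_def)
    then have "F \<in> nsets (nsets T d) (card T)"
      using F(2) fT by (auto simp: nsets_def[of "nsets T d"] finite_imp_finite_nsets intro: finite_subset)
    moreover have "card T \<in> {1..t}" using T(2,3) fT by (simp add: Suc_le_eq card_gt_0_iff)
    moreover have "T \<in> nsets V (card T)" using T(1) fT by (simp add: nsets_def)
    ultimately show "E \<in> (\<Union>k\<in>{1..t}. \<Union>T\<in>nsets V k. \<Union>F\<in>nsets (nsets T d) k. {E. F \<subseteq> E})"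
      using F(1) by blast
  qed
  also have "\<dots> \<le> (\<Sum>k=1..t. \<Sum>T\<in>nsets V k. \<Sum>F\<in>nsets (nsets T d) k. p ^ k)"
  proof (intro prob_UNION_le)
    fix k T F assume "T \<in> nsets V k" and F: "F \<in> nsets (nsets T d) k"
    then have "T \<subseteq> V" by (simp add: nsets_def)
    moreover have "F \<subseteq> nsets T d" "card F = k" using F by (simp_all add: nsets_def[of "nsets T d"])
    ultimately have "F \<subseteq> ?X" "card F = k" using nsets_mono by blast+
    then show "prob ?M {E. F \<subseteq> E} \<le> p ^ k"
      using prob_random_subset_contains[OF fX _ p] by simp
  qed (use V in \<open>auto intro!: finite_imp_finite_nsets simp: nsets_def[of V]\<close>)
  also have "\<dots> = (\<Sum>k=1..t. real (?n choose k) * real ((k choose d) choose k) * p ^ k)"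
  proof (rule sum.cong[OF refl])
    fix k
    have "(\<Sum>F\<in>nsets (nsets T d) k. p ^ k) = real ((k choose d) choose k) * p ^ k" if "T \<in> nsets V k" for T
    proof -
      have "finite T" "card T = k" using that by (auto simp: nsets_def)
      then show ?thesis by (simp add: card_nsets finite_imp_finite_nsets)
    qed
    then have "(\<Sum>T\<in>nsets V k. \<Sum>F\<in>nsets (nsets T d) k. p ^ k) =
        (\<Sum>T\<in>nsets V k. real ((k choose d) choose k) * p ^ k)"
      by (rule sum.cong[OF refl])
    then show "(\<Sum>T\<in>nsets V k. \<Sum>F\<in>nsets (nsets T d) k. p ^ k) =
        real (?n choose k) * real ((k choose d) choose k) * p ^ k"
      using V by (simp add: card_nsets)
  qed
  also have "\<dots> \<le> (\<Sum>k=1..t. (exp 2 * ?n * real t ^ (d - 2) * p) ^ k)"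
  proof (rule sum_mono)
    fix k assume k: "k \<in> {1..t}"
    have "real ((k choose d) choose k) \<le> real (k choose d) ^ k / fact k"
      by (rule binomial_le_power_div_fact)
    also have "\<dots> \<le> (real k ^ d) ^ k / fact k"
    proof (intro divide_right_mono power_mono)
      have "real (k choose d) \<le> real k ^ d / fact d" by (rule binomial_le_power_div_fact)
      also have "\<dots> \<le> real k ^ d / 1" by (intro divide_left_mono fact_ge_1) auto
      also have "\<dots> = real k ^ d" by simp
      finally show "real (k choose d) \<le> real k ^ d" .
    qed auto
    also have "(real k ^ d) ^ k = (real k ^ k)^2 * (real k ^ (d - 2)) ^ k"
    proof -
      have "real k ^ d = (real k)\<^sup>2 * real k ^ (d - 2)"
        by (simp only: power_add[symmetric] le_add_diff_inverse[OF d])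
      then show ?thesis by (simp add: power_mult_distrib power2_eq_square)
    qed
    also have "\<dots> \<le> (exp k * fact k)^2 * (real t ^ (d - 2)) ^ k"
      using k by (intro mult_mono power_mono power_self_le_fact) auto
    finally have 1: "real ((k choose d) choose k) \<le> (exp k * fact k)^2 * (real t ^ (d - 2)) ^ k / fact k"
      by (simp add: divide_right_mono)
    have "real (?n choose k) * real ((k choose d) choose k) * p ^ k \<le>
      (real ?n ^ k / fact k) * ((exp k * fact k)^2 * (real t ^ (d - 2)) ^ k / fact k) * p ^ k"
      using p by (intro mult_right_mono mult_mono 1 binomial_le_power_div_fact) auto
    also have "\<dots> = (exp k)^2 * real ?n ^ k * (real t ^ (d - 2)) ^ k * p ^ k"
      by (simp add: power2_eq_square)
    also have "(exp (real k))^2 = exp 2 ^ k"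
      by (simp add: exp_of_nat_mult[symmetric] exp_double[symmetric] mult.commute)
    finally show "real (?n choose k) * real ((k choose d) choose k) * p ^ k \<le>
       (exp 2 * ?n * real t ^ (d - 2) * p) ^ k" by (simp add: power_mult_distrib)
  qed
  finally show ?thesis .
qed

lemma card_nsets_meeting:
  assumes "finite V" "S \<subseteq> V"
  shows "card {e\<in>nsets V d. e \<inter> S \<noteq> {}} = (card V choose d) - ((card V - card S) choose d)"
proof -
  have fin: "finite (nsets V d)" using assms(1) by (rule finite_imp_finite_nsets)
  have "{e\<in>nsets V d. e \<inter> S \<noteq> {}} = nsets V d - nsets (V - S) d" by (auto simp: nsets_def)
  moreover have "nsets (V - S) d \<subseteq> nsets V d" by (auto simp: nsets_def)
  ultimately have "card {e\<in>nsets V d. e \<inter> S \<noteq> {}} = card (nsets V d) - card (nsets (V - S) d)"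
    using fin by (simp add: card_Diff_subset finite_subset)
  then show ?thesis using assms by (simp add: card_nsets card_Diff_subset finite_subset)
qed

text \<open>
  Each such family lives on a set of exactly $w$ vertices, and there are at most $n^w$ of those.
\<close>

lemma card_small_union_families:
  assumes "finite V" "w \<le> card V"
  shows "card {F\<in>Pow (nsets V d). card (\<Union>F) \<le> w} \<le> card V ^ w * 2 ^ (w choose d)"
proof -
  have "{F\<in>Pow (nsets V d). card (\<Union>F) \<le> w} \<subseteq> (\<Union>W\<in>nsets V w. Pow (nsets W d))"
  proof
    fix F assume "F \<in> {F\<in>Pow (nsets V d). card (\<Union>F) \<le> w}"
    then have F: "F \<subseteq> nsets V d" "card (\<Union>F) \<le> w" by auto
    then have "\<Union>F \<subseteq> V" by (auto simp: nsets_def)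
    then obtain W where W: "\<Union>F \<subseteq> W" "W \<subseteq> V" "card W = w"
      using assms F(2) exists_subset_between by blast
    then have "W \<in> nsets V w" using assms(1) by (auto simp: nsets_def finite_subset)
    moreover have "F \<subseteq> nsets W d" using F(1) W(1) by (auto simp: nsets_def)
    ultimately show "F \<in> (\<Union>W\<in>nsets V w. Pow (nsets W d))" by blast
  qed
  moreover have finN: "finite (nsets V w)" using assms(1) by (rule finite_imp_finite_nsets)
  moreover have "finite (\<Union>W\<in>nsets V w. Pow (nsets W d))"
    using finN by (auto simp: nsets_def[of V] intro!: finite_imp_finite_nsets)
  ultimately have "card {F\<in>Pow (nsets V d). card (\<Union>F) \<le> w} \<le> card (\<Union>W\<in>nsets V w. Pow (nsets W d))"
    by (intro card_mono) auto
  also have "\<dots> \<le> (\<Sum>W\<in>nsets V w. card (Pow (nsets W d)))" by (rule card_UN_le[OF finN])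
  also have "\<dots> = (\<Sum>W\<in>nsets V w. 2 ^ (w choose d))"
    by (intro sum.cong) (auto simp: nsets_def[of V] card_Pow finite_imp_finite_nsets card_nsets)
  also have "\<dots> = (card V choose w) * 2 ^ (w choose d)" using assms(1) by (simp add: card_nsets)
  also have "\<dots> \<le> card V ^ w * 2 ^ (w choose d)"
    using assms(2) by (intro mult_right_mono binomial_le_pow) auto
  finally show ?thesis .
qed

text \<open>
  First moment over families $F$ of at most four edges on few vertices and pairs $s \ne t$ of covered
  vertices. Given $F$, the other edges meeting $\{s, t\}$ are independent of it, and both degrees can
  be below $K$ only if at most $2K$ of these edges are present.
\<close>

lemma prob_not_low_degree_far:
  fixes p y :: real
  assumes V: "finite V" "4 * d \<le> card V" and p: "0 \<le> p" "p \<le> 1" and y: "0 < y" "y \<le> 1" and d: "d \<ge> 1"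
  shows "prob (random_subset (nsets V d) p) {E. \<not> low_degree_far d K E} \<le>
    (\<Sum>f=1..4. real (card V) ^ (f * (d - 1) + 1) * 2 ^ 2 ^ (4 * d) * real ((4 * d)^2) * (p ^ f *
      exp (- (1 - y) * p * real ((card V choose d) - ((card V - 2) choose d) - 4)) / y ^ (2 * K)))"
proof -
  let ?X = "nsets V d" and ?n = "card V"
  let ?M = "random_subset ?X p"
  let ?a = "(?n choose d) - ((?n - 2) choose d) - 4"
  let ?q = "\<lambda>f. p ^ f * exp (- (1 - y) * p * real ?a) / y ^ (2 * K)"
  have fX: "finite ?X" using V(1) by (rule finite_imp_finite_nsets)
  define \<F> where "\<F> f = {F\<in>Pow ?X. card F = f \<and> card (\<Union>F) \<le> f * (d - 1) + 1}" for f
  define A where "A F s t = {e\<in>?X. e \<inter> {s, t} \<noteq> {}} - F" for F :: "'a set set" and s t :: 'a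
  have fin\<F>: "finite (\<F> f)" for f using fX by (simp add: \<F>_def)
  have finUF: "finite (\<Union>F)" if "F \<in> \<F> f" for F f
    using that V(1) by (auto simp: \<F>_def nsets_def intro!: finite_Union intro: finite_subset)
  have "prob ?M {E. \<not> low_degree_far d K E} \<le>
    prob ?M (\<Union>f\<in>{1..4}. \<Union>F\<in>\<F> f. \<Union>(s, t)\<in>{(s, t)\<in>\<Union>F \<times> \<Union>F. s \<noteq> t}.
       {E. F \<subseteq> E \<and> card (E \<inter> A F s t) \<le> 2 * K})"
  proof (rule prob_le_finite_support, rule subsetI)
    fix E assume "E \<in> set_pmf ?M \<inter> {E. \<not> low_degree_far d K E}"
    then obtain F s t where E: "E \<subseteq> ?X" and F: "F \<subseteq> E" "card F \<in> {1..4}"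
      "card (\<Union>F) \<le> card F * (d - 1) + 1" "s \<in> \<Union>F" "t \<in> \<Union>F" "s \<noteq> t"
      "card {e\<in>E. s \<in> e} < K" "card {e\<in>E. t \<in> e} < K"
      using set_random_subset[of ?X p] unfolding low_degree_far_def by blast
    have finE: "finite E" using E fX finite_subset by blast
    have "card (E \<inter> A F s t) \<le> card ({e\<in>E. s \<in> e} \<union> {e\<in>E. t \<in> e})"
      using finE by (intro card_mono) (auto simp: A_def)
    also have "\<dots> \<le> 2 * K"
      using card_Un_le[of "{e\<in>E. s \<in> e}" "{e\<in>E. t \<in> e}"] F(7,8) by linarith
    finally have "card (E \<inter> A F s t) \<le> 2 * K" .
    moreover have "F \<in> \<F> (card F)" using F E by (auto simp: \<F>_def)
    moreover have "(s, t) \<in> {(s, t)\<in>\<Union>F \<times> \<Union>F. s \<noteq> t}" using F by auto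
    ultimately show "E \<in> (\<Union>f\<in>{1..4}. \<Union>F\<in>\<F> f. \<Union>(s, t)\<in>{(s, t)\<in>\<Union>F \<times> \<Union>F. s \<noteq> t}.
       {E. F \<subseteq> E \<and> card (E \<inter> A F s t) \<le> 2 * K})"
      using F(1,2) by blast
  qed
  also have "\<dots> \<le> (\<Sum>f=1..4. \<Sum>F\<in>\<F> f. \<Sum>st\<in>{(s, t)\<in>\<Union>F \<times> \<Union>F. s \<noteq> t}.
      ?q f)"
  proof (intro prob_UNION_le)
    fix f F and st :: "'a \<times> 'a"
    assume f: "f \<in> {1..4}" and F: "F \<in> \<F> f" and "st \<in> {(s, t)\<in>\<Union>F \<times> \<Union>F. s \<noteq> t}"
    then obtain s t where st: "st = (s, t)" "s \<in> \<Union>F" "t \<in> \<Union>F" "s \<noteq> t" by auto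
    have FX: "F \<subseteq> ?X" "card F = f" using F by (auto simp: \<F>_def)
    have "s \<in> V" "t \<in> V" using FX(1) st by (auto simp: nsets_def)
    then have "card {e\<in>?X. e \<inter> {s, t} \<noteq> {}} = (?n choose d) - ((?n - 2) choose d)"
      using V(1) st(4) by (subst card_nsets_meeting) (auto simp: numeral_2_eq_2)
    moreover have "card {e\<in>?X. e \<inter> {s, t} \<noteq> {}} - card F \<le> card (A F s t)"
      unfolding A_def using finite_subset[OF FX(1) fX] by (rule diff_card_le_card_Diff)
    moreover have "card F \<le> 4" using FX(2) f by simp
    ultimately have "?a \<le> card (A F s t)" by linarith
    then have "(1 - y) * p * ?a \<le> (1 - y) * p * card (A F s t)"
      using p y by (intro mult_left_mono) (auto simp only: of_nat_le_iff intro!: mult_nonneg_nonneg)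
    then have "exp (- (1 - y) * p * card (A F s t)) \<le> exp (- (1 - y) * p * ?a)"
      by (simp only: exp_le_cancel_iff mult_minus_left neg_le_iff_le)
    then have "p ^ card F * exp (- (1 - y) * p * card (A F s t)) / y ^ (2 * K) \<le>
        ?q f"
      unfolding FX(2) using p y by (intro divide_right_mono mult_left_mono) auto
    moreover have "prob ?M {E. F \<subseteq> E \<and> card (E \<inter> A F s t) \<le> 2 * K} \<le>
        p ^ card F * exp (- (1 - y) * p * card (A F s t)) / y ^ (2 * K)"
      using FX(1) by (intro prob_contains_few_within fX p y) (auto simp: A_def)
    ultimately show "prob ?M (case st of (s, t) \<Rightarrow> {E. F \<subseteq> E \<and> card (E \<inter> A F s t) \<le> 2 * K}) \<le>
        ?q f"
      unfolding st(1) by (simp only: prod.case)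
  next
    fix f F assume "F \<in> \<F> f"
    then have "finite (\<Union>F \<times> \<Union>F)" using finUF by blast
    then show "finite {(s, t)\<in>\<Union>F \<times> \<Union>F. s \<noteq> t}" by (rule finite_subset[rotated]) auto
  qed (use fin\<F> in auto)
  also have "\<dots> \<le> (\<Sum>f=1..4. \<Sum>F\<in>\<F> f. real ((4 * d)^2) * ?q f)"
  proof (intro sum_mono)
    fix f F assume f: "f \<in> {1..4::nat}" and F: "F \<in> \<F> f"
    have "card {(s, t)\<in>\<Union>F \<times> \<Union>F. s \<noteq> t} \<le> card (\<Union>F \<times> \<Union>F)"
      using finUF[OF F] by (intro card_mono) auto
    also have "\<dots> = (card (\<Union>F))^2" by (simp add: card_cartesian_product power2_eq_square)
    also have "\<dots> \<le> (4 * d)^2"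
    proof (intro power_mono)
      have "card (\<Union>F) \<le> f * (d - 1) + 1" using F by (auto simp: \<F>_def)
      also have "\<dots> \<le> 4 * (d - 1) + 1" using f by (intro add_mono mult_right_mono) auto
      also have "\<dots> \<le> 4 * d" using d by simp
      finally show "card (\<Union>F) \<le> 4 * d" .
    qed auto
    finally have "real (card {(s, t)\<in>\<Union>F \<times> \<Union>F. s \<noteq> t}) \<le> real ((4 * d)^2)"
      by (simp only: of_nat_le_iff)
    then show "(\<Sum>st\<in>{(s, t)\<in>\<Union>F \<times> \<Union>F. s \<noteq> t}. ?q f) \<le>
      real ((4 * d)^2) * ?q f"
      using p y unfolding sum_constant by (intro mult_right_mono) auto
  qed
  also have "\<dots> \<le> (\<Sum>f=1..4. real ?n ^ (f * (d - 1) + 1) * 2 ^ 2 ^ (4 * d) * real ((4 * d)^2) *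
      ?q f)"
  proof (intro sum_mono)
    fix f assume f: "f \<in> {1..4::nat}"
    let ?w = "f * (d - 1) + 1"
    have "f * (d - 1) \<le> 4 * (d - 1)" using f by (intro mult_right_mono) auto
    then have w: "?w \<le> 4 * d" using d by linarith
    have "card (\<F> f) \<le> card {F\<in>Pow ?X. card (\<Union>F) \<le> ?w}"
      using fX by (intro card_mono) (auto simp: \<F>_def)
    also have "\<dots> \<le> ?n ^ ?w * 2 ^ (?w choose d)"
      using V w by (intro card_small_union_families) auto
    also have "\<dots> \<le> ?n ^ ?w * 2 ^ 2 ^ (4 * d)"
    proof (intro mult_left_mono power_increasing)
      have "?w choose d \<le> 2 ^ ?w" by (rule binomial_le_pow2)
      also have "\<dots> \<le> 2 ^ (4 * d)" using w by (intro power_increasing) auto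
      finally show "?w choose d \<le> 2 ^ (4 * d)" .
    qed auto
    finally have "real (card (\<F> f)) \<le> real (?n ^ ?w * 2 ^ 2 ^ (4 * d))" by (simp only: of_nat_le_iff)
    then have c: "real (card (\<F> f)) \<le> real ?n ^ ?w * 2 ^ 2 ^ (4 * d)" by simp
    show "(\<Sum>F\<in>\<F> f. real ((4 * d)^2) * ?q f) \<le>
      real ?n ^ ?w * 2 ^ 2 ^ (4 * d) * real ((4 * d)^2) * ?q f"
      using mult_right_mono[OF c, of "real ((4 * d)^2) * ?q f"] p y
      by (simp add: mult.assoc)
  qed
  finally show ?thesis .
qed

lemma binomial_le_exp_power:
  assumes "k \<ge> 1"
  shows "real (n choose k) \<le> (exp 1 * n / k) ^ k"
proof -
  have "real (n choose k) \<le> real n ^ k / fact k" by (rule binomial_le_power_div_fact)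
  also have "\<dots> \<le> real n ^ k * (exp k / real k ^ k)"
  proof -
    have "1 / fact k \<le> exp k / real k ^ k"
      using power_self_le_fact[of k] assms by (simp add: field_simps)
    from mult_left_mono[OF this, of "real n ^ k"] show ?thesis by simp
  qed
  also have "exp (real k) = exp 1 ^ k" using exp_of_nat_mult[of k "1::real"] by simp
  finally show ?thesis by (simp add: power_mult_distrib power_divide mult.commute)
qed

text \<open>
  If $U$ has too few neighbours, then some $Z \supseteq U \cup N(U)$ has $3|U|$ elements and no edge
  meets both $U$ and $V - Z$. At least $|U|(n - 3|U|) \ge |U| n/4$ pairs are forbidden, hence at least
  $|U| \binom nd / (4n)$ of the $d$-sets.
\<close>

lemma prob_not_mid_expanding:
  fixes p :: real
  assumes V: "finite V" and p: "0 \<le> p" "p \<le> 1" and d: "d \<ge> 2"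
  shows "prob (random_subset (nsets V d) p) {E. \<not> mid_expanding u V E} \<le>
    (\<Sum>k=Suc u..card V. ((exp 1 * card V / Suc u) ^ 4 * exp (- p * (card V choose d) / (4 * card V))) ^ k)"
proof -
  let ?X = "nsets V d" and ?n = "card V" and ?N = "card V choose d"
  let ?M = "random_subset ?X p"
  let ?I = "{k\<in>{Suc u..?n}. 4 * k \<le> ?n}"
  have fX: "finite ?X" using V by (rule finite_imp_finite_nsets)
  define B where "B U Z = {e\<in>?X. \<exists>(x, y)\<in>U \<times> (V - Z). x \<in> e \<and> y \<in> e}" for U Z
  have "prob ?M {E. \<not> mid_expanding u V E} \<le>
    prob ?M (\<Union>k\<in>?I. \<Union>U\<in>nsets V k. \<Union>Z\<in>{Z\<in>nsets V (3 * k). U \<subseteq> Z}. {E. E \<inter> B U Z = {}})"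
  proof (rule prob_le_finite_support, rule subsetI)
    fix E assume "E \<in> set_pmf ?M \<inter> {E. \<not> mid_expanding u V E}"
    then obtain U where U: "U \<subseteq> V" "u < card U" "4 * card U \<le> ?n"
      and small: "card (nbhd (linked E) V U) < 2 * card U"
      unfolding mid_expanding_def by (auto simp: not_le)
    let ?T = "U \<union> nbhd (linked E) V U"
    have "card ?T \<le> 3 * card U" using small card_Un_le[of U "nbhd (linked E) V U"] by linarith
    moreover have "?T \<subseteq> V" using U(1) by (auto simp: nbhd_def)
    moreover have "3 * card U \<le> ?n" using U(3) by linarith
    ultimately have "\<exists>Z. ?T \<subseteq> Z \<and> Z \<subseteq> V \<and> card Z = 3 * card U"
      by (intro exists_subset_between V)
    then obtain Z where Z: "?T \<subseteq> Z" "Z \<subseteq> V" "card Z = 3 * card U" by (elim exE conjE)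
    have "E \<inter> B U Z = {}"
    proof (rule ccontr)
      assume "E \<inter> B U Z \<noteq> {}"
      then obtain e x y where "e \<in> E" "x \<in> U" "y \<in> V - Z" "x \<in> e" "y \<in> e" by (auto simp: B_def)
      then have "y \<in> nbhd (linked E) V U" using Z(1) by (auto simp: nbhd_def linked_def)
      then show False using Z(1) \<open>y \<in> V - Z\<close> by blast
    qed
    moreover have "card U \<in> ?I" using U(2,3) by auto
    moreover have "U \<in> nsets V (card U)" using U(1) V by (auto simp: nsets_def finite_subset)
    moreover have "Z \<in> {Z\<in>nsets V (3 * card U). U \<subseteq> Z}"
      using Z V by (auto simp: nsets_def finite_subset)
    ultimately show "E \<in> (\<Union>k\<in>?I. \<Union>U\<in>nsets V k. \<Union>Z\<in>{Z\<in>nsets V (3 * k). U \<subseteq> Z}. {E. E \<inter> B U Z = {}})"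
      by blast
  qed
  also have "\<dots> \<le> (\<Sum>k\<in>?I. \<Sum>U\<in>nsets V k. \<Sum>Z\<in>{Z\<in>nsets V (3 * k). U \<subseteq> Z}. exp (- p * ?N / (4 * ?n)) ^ k)"
  proof (intro prob_UNION_le)
    fix k U Z assume k: "k \<in> ?I" and U: "U \<in> nsets V k" and Z: "Z \<in> {Z\<in>nsets V (3 * k). U \<subseteq> Z}"
    have n: "?n > 0" "k > 0" using k by auto
    have UV: "U \<subseteq> V" "card U = k" "Z \<subseteq> V" "card Z = 3 * k" "U \<subseteq> Z" "finite Z"
      using U Z by (auto simp: nsets_def)
    have "card (U \<times> (V - Z)) * ?N \<le> ?n^2 * card (B U Z)"
      unfolding B_def using V d UV(1,5) by (intro card_nsets_meeting_pairs) auto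
    moreover have "card (U \<times> (V - Z)) = k * (?n - 3 * k)"
      using UV by (simp add: card_cartesian_product card_Diff_subset)
    ultimately have "real (k * (?n - 3 * k) * ?N) \<le> real (?n^2 * card (B U Z))"
      by (simp only: of_nat_le_iff)
    moreover have "real k * (real ?n / 4) * real ?N \<le> real (k * (?n - 3 * k) * ?N)"
    proof -
      have "real ?n / 4 \<le> real (?n - 3 * k)" using k by (auto simp: of_nat_diff)
      then have "real k * (real ?n / 4) * real ?N \<le> real k * real (?n - 3 * k) * real ?N"
        by (intro mult_right_mono mult_left_mono) auto
      then show ?thesis by simp
    qed
    ultimately have "real k * (real ?n / 4) * real ?N \<le> real ?n ^ 2 * card (B U Z)" by simp
    then have cB: "k * (?N / (4 * ?n)) \<le> card (B U Z)"
      using n by (simp add: field_simps power2_eq_square)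
    have "prob ?M {E. E \<inter> B U Z = {}} = (1 - p) ^ card (B U Z)"
    proof -
      have "B U Z \<subseteq> ?X" by (auto simp: B_def)
      then show ?thesis
        using prob_random_subset_contains_avoids[of ?X "{}" "B U Z" p] fX p by simp
    qed
    also have "\<dots> \<le> exp (- p) ^ card (B U Z)"
      using p exp_ge_add_one_self[of "- p"] by (intro power_mono) auto
    also have "\<dots> = exp (- (p * card (B U Z)))"
      by (simp add: exp_of_nat_mult[symmetric] mult.commute)
    also have "\<dots> \<le> exp (- (p * (k * (?N / (4 * ?n)))))"
      using mult_left_mono[OF cB p(1)] by simp
    also have "\<dots> = exp (- p * ?N / (4 * ?n)) ^ k"
      by (simp add: exp_of_nat_mult[symmetric] field_simps)
    finally show "prob ?M {E. E \<inter> B U Z = {}} \<le> exp (- p * ?N / (4 * ?n)) ^ k" .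
  qed (use V in \<open>auto intro!: finite_imp_finite_nsets\<close>)
  also have "\<dots> \<le> (\<Sum>k\<in>?I. \<Sum>U\<in>nsets V k. \<Sum>Z\<in>nsets V (3 * k). exp (- p * ?N / (4 * ?n)) ^ k)"
    using V by (intro sum_mono sum_mono2) (auto intro: finite_imp_finite_nsets)
  also have "\<dots> = (\<Sum>k\<in>?I. real (?n choose k) * real (?n choose (3 * k)) * exp (- p * ?N / (4 * ?n)) ^ k)"
    using V by (simp add: card_nsets mult.assoc)
  also have "\<dots> \<le> (\<Sum>k\<in>?I. ((exp 1 * ?n / Suc u) ^ 4 * exp (- p * ?N / (4 * ?n))) ^ k)"
  proof (rule sum_mono)
    fix k assume k: "k \<in> ?I"
    then have k1: "k \<ge> 1" "Suc u \<le> k" by auto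
    let ?r = "exp 1 * ?n / Suc u :: real"
    have r: "exp 1 * ?n / k \<le> ?r" "exp 1 * ?n / real (3 * k) \<le> ?r"
      using k1 by (intro divide_left_mono; simp)+
    have "real (?n choose k) \<le> ?r ^ k"
      by (rule order.trans[OF binomial_le_exp_power[OF k1(1)] power_mono[OF r(1)]]) simp
    moreover have "real (?n choose (3 * k)) \<le> ?r ^ (3 * k)"
      by (rule order.trans[OF binomial_le_exp_power power_mono[OF r(2)]]) (use k1 in auto)
    ultimately have "real (?n choose k) * real (?n choose (3 * k)) \<le> ?r ^ k * ?r ^ (3 * k)"
      by (intro mult_mono) auto
    also have "\<dots> = (?r ^ 4) ^ k" by (simp only: power_add[symmetric] power_mult[symmetric]) simp
    finally show "real (?n choose k) * real (?n choose (3 * k)) * exp (- p * ?N / (4 * ?n)) ^ k \<le>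
      (?r ^ 4 * exp (- p * ?N / (4 * ?n))) ^ k"
      unfolding power_mult_distrib by (intro mult_right_mono) auto
  qed
  also have "\<dots> \<le> (\<Sum>k=Suc u..?n. ((exp 1 * ?n / Suc u) ^ 4 * exp (- p * ?N / (4 * ?n))) ^ k)"
    by (intro sum_mono2) auto
  finally show ?thesis .
qed

text \<open>
  Containing a sparse sub-hypergraph that expands is an increasing property, so it suffices to consider
  the smaller edge probability $p'$, where the whole random hypergraph is with high probability such a
  sub-hypergraph.
\<close>

lemma prob_no_sparse_mid_expander:
  fixes p p' y :: real
  assumes V: "finite V" and p: "0 \<le> p'" "p' \<le> p" "p \<le> 1" and d: "d \<ge> 2" and y: "y \<ge> 1"
  shows "prob (random_subset (nsets V d) p)
      {E. \<not> (\<exists>G\<subseteq>E. card G \<le> g \<and> mid_expanding u V G)} \<le>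
    exp (y * p' * (card V choose d)) / y ^ g +
    (\<Sum>k=Suc u..card V. ((exp 1 * card V / Suc u) ^ 4 * exp (- p' * (card V choose d) / (4 * card V))) ^ k)"
proof -
  let ?X = "nsets V d"
  let ?Q = "{E. \<exists>G\<subseteq>E. card G \<le> g \<and> mid_expanding u V G}"
  let ?M = "random_subset ?X p'"
  have fX: "finite ?X" using V by (rule finite_imp_finite_nsets)
  have "prob (random_subset ?X p) (UNIV - ?Q) = 1 - prob (random_subset ?X p) ?Q"
    using measure_pmf.prob_compl[of ?Q] by simp
  also have "\<dots> \<le> 1 - prob ?M ?Q"
  proof -
    have "E' \<in> ?Q" if "E \<in> ?Q" "E \<subseteq> E'" for E E' using that by blast
    then show ?thesis using prob_random_subset_mono[OF fX p, of ?Q] by simp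
  qed
  also have "\<dots> = prob ?M (UNIV - ?Q)"
    using measure_pmf.prob_compl[of ?Q ?M] by simp
  also have "\<dots> \<le> prob ?M ({E. g \<le> card E} \<union> {E. \<not> mid_expanding u V E})"
    by (intro measure_pmf.finite_measure_mono) auto
  also have "\<dots> \<le> prob ?M {E. g \<le> card E} + prob ?M {E. \<not> mid_expanding u V E}"
    by (intro measure_Un_le) auto
  also have "\<dots> \<le> exp (y * p' * (card V choose d)) / y ^ g +
     (\<Sum>k=Suc u..card V. ((exp 1 * card V / Suc u) ^ 4 * exp (- p' * (card V choose d) / (4 * card V))) ^ k)"
    using prob_many_elements[OF fX p(1) _ y, of g] p prob_not_mid_expanding[OF V p(1) _ d, of u]
    by (intro add_mono) (auto simp: card_nsets[OF V])
  finally have "prob (random_subset ?X p) (UNIV - ?Q) \<le> exp (y * p' * (card V choose d)) / y ^ g +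
     (\<Sum>k=Suc u..card V. ((exp 1 * card V / Suc u) ^ 4 * exp (- p' * (card V choose d) / (4 * card V))) ^ k)" .
  moreover have "UNIV - ?Q = {E. \<not> (\<exists>G\<subseteq>E. card G \<le> g \<and> mid_expanding u V G)}" by blast
  ultimately show ?thesis by (simp only:)
qed

text \<open>
  The four summands bound the failure of the hypotheses of \<open>sparse_booster_free_expander\<close>, namely
  local sparsity, distance of low-degree vertices and a sparse expander for larger sets, and finally
  the existence of the certificate itself.
\<close>

theorem prob_covering_not_hamiltonian:
  fixes p p' y y' :: real
  assumes V: "finite V" "8 \<le> card V" "4 * d \<le> card V" and p: "0 \<le> p'" "p' \<le> p" "p \<le> 1" and d: "d \<ge> 3"
    and y: "0 < y" "y \<le> 1" and y': "y' \<ge> 1"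
  shows "prob (random_subset (nsets V d) p)
      {E. (\<forall>x\<in>V. \<exists>e\<in>E. x \<in> e) \<and> \<not> weak_hamiltonian (V, E)} \<le>
    (\<Sum>k=1..6*u. (exp 2 * card V * real (6 * u) ^ (d - 2) * p) ^ k) +
    (\<Sum>f=1..4. real (card V) ^ (f * (d - 1) + 1) * 2 ^ 2 ^ (4 * d) * real ((4 * d)^2) * (p ^ f *
      exp (- (1 - y) * p * real ((card V choose d) - ((card V - 2) choose d) - 4)) / y ^ (2 * (6 * d)))) +
    (exp (y' * p' * (card V choose d)) / y' ^ g +
    (\<Sum>k=Suc u..card V. ((exp 1 * card V / Suc u) ^ 4 * exp (- p' * (card V choose d) / (4 * card V))) ^ k)) +
    exp (y * p * (card V choose d) - p * real ((card V choose d) div 16)) / y ^ (g + (6 * d + 1) * card V)"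
  (is "_ \<le> ?b1 + ?b2 + ?b3 + ?b4")
proof -
  let ?X = "nsets V d"
  let ?M = "random_subset ?X p"
  let ?E1 = "{E. \<not> locally_sparse (6 * u) V E}" and ?E2 = "{E. \<not> low_degree_far d (6 * d) E}"
  let ?E3 = "{E. \<not> (\<exists>G\<subseteq>E. card G \<le> g \<and> mid_expanding u V G)}"
  let ?E4 = "{E. \<exists>\<Gamma>\<subseteq>E. card \<Gamma> \<le> g + (6 * d + 1) * card V \<and> E \<inter> boosters d V \<Gamma> = {} \<and>
     card V choose d \<le> 16 * card (boosters d V \<Gamma>)}"
  have fX: "finite ?X" using V by (intro finite_imp_finite_nsets)
  have "prob ?M {E. (\<forall>x\<in>V. \<exists>e\<in>E. x \<in> e) \<and> \<not> weak_hamiltonian (V, E)} \<le>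
    prob ?M (((?E1 \<union> ?E2) \<union> ?E3) \<union> ?E4)"
  proof (rule prob_le_finite_support, rule subsetI)
    fix E assume E: "E \<in> set_pmf ?M \<inter> {E. (\<forall>x\<in>V. \<exists>e\<in>E. x \<in> e) \<and> \<not> weak_hamiltonian (V, E)}"
    then have sub: "E \<subseteq> ?X" using set_random_subset[of ?X p] by blast
    show "E \<in> ((?E1 \<union> ?E2) \<union> ?E3) \<union> ?E4"
    proof (cases "E \<in> (?E1 \<union> ?E2) \<union> ?E3")
      case False
      then obtain G where "G \<subseteq> E" "card G \<le> g" "mid_expanding u V G"
        "locally_sparse (6 * u) V E" "low_degree_far d (6 * d) E" by blast
      then show ?thesis
        using sparse_booster_free_expander[OF V(1,2) sub d, of u G g] E by blast
    qed blast
  qed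
  also have "\<dots> \<le> prob ?M ?E1 + prob ?M ?E2 + prob ?M ?E3 + prob ?M ?E4"
    by (intro order.trans[OF measure_Un_le] add_mono order.refl) auto
  also have "\<dots> \<le> ?b1 + ?b2 + ?b3 + ?b4"
  proof (intro add_mono)
    have p0: "0 \<le> p" using p by simp
    show "prob ?M ?E1 \<le> ?b1"
      using d by (intro prob_not_locally_sparse V p0 p(3)) auto
    show "prob ?M ?E2 \<le> ?b2"
      using d by (intro prob_not_low_degree_far V p0 p(3) y) auto
    show "prob ?M ?E3 \<le> ?b3"
      using d by (intro prob_no_sparse_mid_expander V p y') auto
    have "(card V choose d) div 16 \<le> card (boosters d V \<Gamma>)"
      if "card V choose d \<le> 16 * card (boosters d V \<Gamma>)" for \<Gamma>
      using that by linarith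
    then show "prob ?M ?E4 \<le> ?b4"
      using prob_sparse_certificate[OF fX p0 p(3) y, of "boosters d V"
          "\<lambda>\<Gamma>. card V choose d \<le> 16 * card (boosters d V \<Gamma>)"
          "(card V choose d) div 16" "g + (6 * d + 1) * card V"]
      by (auto simp: card_nsets[OF V(1)] boosters_def)
  qed
  finally show ?thesis .
qed

section \<open>Edge counts at the threshold\<close>

definition threshold :: "nat \<Rightarrow> real \<Rightarrow> nat \<Rightarrow> real" where
  "threshold d x n = fact (d - 1) * (ln (real n) + x) / real n ^ (d - 1)"

lemma power_le_fact_binomial:
  assumes "k \<le> K" "K \<le> m"
  shows "(real m - real K) ^ k \<le> fact k * real (m choose k)"
  using assms(1)
proof (induction k)
  case (Suc k)
  have "(m choose k) * (m - k) = (m choose Suc k) * Suc k"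
    using binomial_absorb_comp[of m k] binomial_absorption[of k m] by (simp only: mult.commute)
  then have h: "real (m choose k) * real (m - k) = real (m choose Suc k) * real (Suc k)"
    by (simp only: of_nat_mult[symmetric])
  have "fact (Suc k) * real (m choose Suc k) = fact k * (real (m choose Suc k) * real (Suc k))"
    by (simp add: algebra_simps)
  then have eq: "fact (Suc k) * real (m choose Suc k) = fact k * real (m choose k) * real (m - k)"
    by (simp only: h[symmetric] mult.assoc)
  have "(real m - real K) ^ Suc k = (real m - real K) ^ k * (real m - real K)" by simp
  also have "\<dots> \<le> fact k * real (m choose k) * real (m - k)"
    using Suc assms(2) by (intro mult_mono) (auto simp: of_nat_diff)
  finally show ?case by (simp only: eq)
qed simp

lemma binomial_ge:
  assumes "k \<le> m" "m \<ge> 1"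
  shows "real m ^ k / fact k * (1 - real k ^ 2 / real m) \<le> real (m choose k)"
proof -
  have "1 - real k ^ 2 / real m = 1 + real k * (- (real k / real m))" by (simp add: power2_eq_square)
  also have "\<dots> \<le> (1 + (- (real k / real m))) ^ k"
    using assms by (intro Bernoulli_inequality) (auto simp: field_simps)
  finally have "real m ^ k * (1 - real k ^ 2 / real m) \<le> real m ^ k * (1 - real k / real m) ^ k"
    by (intro mult_left_mono) auto
  also have "\<dots> = (real m - real k) ^ k"
    using assms by (simp add: power_mult_distrib[symmetric] right_diff_distrib)
  also have "\<dots> \<le> fact k * real (m choose k)" using assms by (intro power_le_fact_binomial) auto
  finally show ?thesis by (simp add: field_simps)
qed

text \<open>
  The difference counts the $d$-sets that meet a fixed $j$-set. It telescopes into $j$ terms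
  $\binom{n-i}{d-1}$ with $1 \le i \le j$.
\<close>

lemma binomial_difference_bounds:
  assumes "j + d \<le> n" "d \<ge> 1"
  shows "real j * (real n - real (j + d)) ^ (d - 1) / fact (d - 1) \<le> real ((n choose d) - ((n - j) choose d))"
    and "real ((n choose d) - ((n - j) choose d)) \<le> real j * real n ^ (d - 1) / fact (d - 1)"
proof -
  have tele: "i \<le> j \<Longrightarrow> (n - i) choose d \<le> n choose d \<and>
    real i * (real n - real (j + d)) ^ (d - 1) / fact (d - 1) \<le> real (n choose d) - real ((n - i) choose d) \<and>
    real (n choose d) - real ((n - i) choose d) \<le> real i * real n ^ (d - 1) / fact (d - 1)" for i
  proof (induction i)
    case (Suc i)
    obtain e where e: "d = Suc e" using assms(2) by (cases d) auto
    have "n - i = Suc (n - Suc i)" using Suc.prems assms by auto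
    then have step: "(n - i) choose d = ((n - Suc i) choose (d - 1)) + ((n - Suc i) choose d)"
      by (simp add: e)
    have "(real n - real (j + d)) ^ (d - 1) \<le> (real (n - Suc i) - real d) ^ (d - 1)"
      using Suc.prems assms by (intro power_mono) (auto simp: of_nat_diff)
    also have "\<dots> \<le> fact (d - 1) * real ((n - Suc i) choose (d - 1))"
      using Suc.prems assms by (intro power_le_fact_binomial) auto
    finally have lo: "(real n - real (j + d)) ^ (d - 1) / fact (d - 1) \<le> real ((n - Suc i) choose (d - 1))"
      by (simp add: field_simps)
    have "real ((n - Suc i) choose (d - 1)) \<le> real (n - Suc i) ^ (d - 1) / fact (d - 1)"
      by (rule binomial_le_power_div_fact)
    also have "\<dots> \<le> real n ^ (d - 1) / fact (d - 1)"
      by (intro divide_right_mono power_mono) auto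
    finally have hi: "real ((n - Suc i) choose (d - 1)) \<le> real n ^ (d - 1) / fact (d - 1)" .
    show ?case using Suc step lo hi by (auto simp: distrib_right add_divide_distrib)
  qed simp
  show "real j * (real n - real (j + d)) ^ (d - 1) / fact (d - 1) \<le> real ((n choose d) - ((n - j) choose d))"
    "real ((n choose d) - ((n - j) choose d)) \<le> real j * real n ^ (d - 1) / fact (d - 1)"
    using tele[of j] by (auto simp: of_nat_diff)
qed

lemma threshold_times_difference_bounds:
  assumes "j + d \<le> n" "d \<ge> 1" "0 \<le> ln (real n) + x"
  shows "real j * (ln (real n) + x) * (1 - real d * real (j + d) / real n) \<le>
      threshold d x n * real ((n choose d) - ((n - j) choose d))" (is ?lo)
    and "threshold d x n * real ((n choose d) - ((n - j) choose d)) \<le> real j * (ln (real n) + x)" (is ?hi)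
proof -
  let ?l = "ln (real n) + x" and ?c = "real ((n choose d) - ((n - j) choose d))"
  have n: "real n > 0" using assms by simp
  have t0: "threshold d x n \<ge> 0" using assms n by (simp add: threshold_def)
  have "threshold d x n * ?c \<le> threshold d x n * (real j * real n ^ (d - 1) / fact (d - 1))"
    by (intro mult_left_mono binomial_difference_bounds assms t0)
  also have "\<dots> = real j * ?l" using n by (simp add: threshold_def)
  finally show ?hi .
  have "1 - real d * real (j + d) / real n \<le> 1 + real (d - 1) * (- (real (j + d) / real n))"
    using n assms(2) by (simp add: of_nat_diff field_simps)
  also have "\<dots> \<le> (1 + (- (real (j + d) / real n))) ^ (d - 1)"
    using assms n by (intro Bernoulli_inequality) (auto simp: field_simps)
  finally have "real j * ?l * (1 - real d * real (j + d) / real n) \<le>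
      real j * ?l * (1 + (- (real (j + d) / real n))) ^ (d - 1)"
    using assms by (intro mult_left_mono) auto
  also have "\<dots> = threshold d x n * (real j * (real n - real (j + d)) ^ (d - 1) / fact (d - 1))"
  proof -
    have "1 + (- (real (j + d) / real n)) = (real n - real (j + d)) / real n"
      using n by (simp add: field_simps)
    then show ?thesis using n by (simp add: threshold_def power_divide)
  qed
  also have "\<dots> \<le> threshold d x n * ?c"
    by (intro mult_left_mono binomial_difference_bounds assms t0)
  finally show ?lo .
qed

lemma threshold_times_binomial_bounds:
  assumes "d \<le> n" "d \<ge> 1" "0 \<le> ln (real n) + x"
  shows "real n * (ln (real n) + x) / real d * (1 - real d ^ 2 / real n) \<le> threshold d x n * real (n choose d)"
    and "threshold d x n * real (n choose d) \<le> real n * (ln (real n) + x) / real d"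
proof -
  have n: "real n > 0" using assms by simp
  have t0: "threshold d x n \<ge> 0" using assms n by (simp add: threshold_def)
  have "fact d = real d * fact (d - 1)" "real n ^ d = real n * real n ^ (d - 1)"
    using assms(2) by (simp_all add: fact_reduce power_eq_if)
  then have eq: "threshold d x n * (real n ^ d / fact d) = real n * (ln (real n) + x) / real d"
    using n by (simp add: threshold_def)
  show "threshold d x n * real (n choose d) \<le> real n * (ln (real n) + x) / real d"
    unfolding eq[symmetric] by (intro mult_left_mono binomial_le_power_div_fact t0)
  have "threshold d x n * (real n ^ d / fact d * (1 - real d ^ 2 / real n)) \<le> threshold d x n * real (n choose d)"
    using assms by (intro mult_left_mono binomial_ge t0) auto
  then show "real n * (ln (real n) + x) / real d * (1 - real d ^ 2 / real n) \<le> threshold d x n * real (n choose d)"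
    unfolding eq[symmetric] by (simp add: mult.assoc)
qed

lemma threshold_le:
  assumes "d \<ge> 2" "n \<ge> 1" "0 \<le> ln (real n) + x"
  shows "threshold d x n \<le> fact (d - 1) * ((ln (real n) + x) / real n)"
proof -
  have "real n ^ 1 \<le> real n ^ (d - 1)" using assms by (intro power_increasing) auto
  then have "fact (d - 1) * (ln (real n) + x) / real n ^ (d - 1) \<le> fact (d - 1) * (ln (real n) + x) / real n"
    using assms by (intro divide_left_mono) auto
  then show ?thesis by (simp add: threshold_def)
qed

lemma eventually_log_ge: "\<forall>\<^sub>F n in sequentially. K \<le> ln (real n) + x"
  by real_asymp

lemma threshold_tendsto_0:
  assumes "d \<ge> 2"
  shows "(\<lambda>n. threshold d x n) \<longlonglongrightarrow> 0"
proof (rule tendsto_sandwich[of "\<lambda>_. 0"])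
  show "\<forall>\<^sub>F n in sequentially. 0 \<le> threshold d x n"
    using eventually_log_ge[of 0 x] by eventually_elim (simp add: threshold_def)
  show "\<forall>\<^sub>F n in sequentially. threshold d x n \<le> fact (d - 1) * ((ln (real n) + x) / real n)"
    using eventually_log_ge[of 0 x] eventually_ge_at_top[of 1]
    by eventually_elim (use assms threshold_le in blast)
  have "(\<lambda>n. (ln (real n) + x) / real n) \<longlonglongrightarrow> 0" by real_asymp
  then show "(\<lambda>n. fact (d - 1) * ((ln (real n) + x) / real n)) \<longlonglongrightarrow> 0"
    by (rule tendsto_mult_right_zero)
qed simp

lemma eventually_threshold_bounds:
  assumes "d \<ge> 2"
  shows "\<forall>\<^sub>F n in sequentially. 0 \<le> threshold d x n \<and> threshold d x n \<le> 1 / 2"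
proof -
  have "\<forall>\<^sub>F n in sequentially. threshold d x n < 1 / 2"
    using threshold_tendsto_0[OF assms] by (rule order_tendstoD) simp
  then show ?thesis using eventually_log_ge[of 0 x]
    by eventually_elim (auto simp: threshold_def)
qed

text \<open>
  At the threshold the expected number of edges meeting a fixed $j$-set is $j(\ln n + x) + o(1)$.
\<close>

lemma threshold_times_difference_tendsto:
  assumes "d \<ge> 1"
  shows "(\<lambda>n. threshold d x n * real ((n choose d) - ((n - j) choose d)) - real j * (ln (real n) + x)) \<longlonglongrightarrow> 0"
proof (rule tendsto_sandwich[of "\<lambda>n. - (real j * (real d * real (j + d)) * ((ln (real n) + x) / real n))" _ _ "\<lambda>_. 0"])
  show "\<forall>\<^sub>F n in sequentially. - (real j * (real d * real (j + d)) * ((ln (real n) + x) / real n)) \<le>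
      threshold d x n * real ((n choose d) - ((n - j) choose d)) - real j * (ln (real n) + x)"
    using eventually_log_ge[of 0 x] eventually_ge_at_top[of "j + d"]
  proof eventually_elim
    case (elim n)
    then show ?case using threshold_times_difference_bounds(1)[of j d n x] assms
      by (simp add: right_diff_distrib mult_ac)
  qed
  show "\<forall>\<^sub>F n in sequentially.
      threshold d x n * real ((n choose d) - ((n - j) choose d)) - real j * (ln (real n) + x) \<le> 0"
    using eventually_log_ge[of 0 x] eventually_ge_at_top[of "j + d"]
  proof eventually_elim
    case (elim n)
    then show ?case using threshold_times_difference_bounds(2)[of j d n x] assms by simp
  qed
  have "(\<lambda>n. (ln (real n) + x) / real n) \<longlonglongrightarrow> 0" by real_asymp
  from tendsto_minus[OF tendsto_mult_right_zero[OF this, of "real j * (real d * real (j + d))"]]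
  show "(\<lambda>n. - (real j * (real d * real (j + d)) * ((ln (real n) + x) / real n))) \<longlonglongrightarrow> 0" by simp
qed simp

section \<open>The number of isolated vertices\<close>

text \<open>
  The $j$-th binomial moment of the number of isolated vertices converges to that of a Poisson
  variable with mean $e^{-x}$: taking logarithms, $(1-p)^C$ with $C$ the number of $d$-sets meeting a
  $j$-set behaves like $e^{-pC} \approx n^{-j} e^{-jx}$.
\<close>

lemma isolated_moment_tendsto:
  assumes "d \<ge> 2"
  shows "(\<lambda>n. real (n choose j) * (1 - threshold d x n) ^ ((n choose d) - ((n - j) choose d)))
    \<longlonglongrightarrow> exp (- x) ^ j / fact j"
proof -
  let ?t = "threshold d x" and ?c = "\<lambda>n. (n choose d) - ((n - j) choose d)"
  have A: "(\<lambda>n. real (n choose j) / real n ^ j) \<longlonglongrightarrow> 1 / fact j"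
  proof (rule tendsto_sandwich[of "\<lambda>n. 1 / fact j * (1 - real j ^ 2 / real n)" _ _ "\<lambda>_. 1 / fact j"])
    show "\<forall>\<^sub>F n in sequentially. 1 / fact j * (1 - real j ^ 2 / real n) \<le> real (n choose j) / real n ^ j"
      using eventually_ge_at_top[of "Suc j"]
    proof eventually_elim
      case (elim n)
      then have "real n ^ j / fact j * (1 - real j ^ 2 / real n) \<le> real (n choose j)" "real n ^ j > 0"
        using binomial_ge[of j n] by auto
      then show ?case by (simp add: field_simps)
    qed
    show "\<forall>\<^sub>F n in sequentially. real (n choose j) / real n ^ j \<le> 1 / fact j"
      using eventually_ge_at_top[of 1]
    proof eventually_elim
      case (elim n)
      then have "real n ^ j > 0" by simp
      then show ?case using binomial_le_power_div_fact[of n j] by (simp add: field_simps)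
    qed
    have "(\<lambda>n. 1 / fact j * (1 - real j ^ 2 / real n)) \<longlonglongrightarrow> 1 / fact j * (1 - 0)"
      by (intro tendsto_intros)
    then show "(\<lambda>n. 1 / fact j * (1 - real j ^ 2 / real n)) \<longlonglongrightarrow> 1 / fact j" by simp
  qed simp
  have tc: "(\<lambda>n. ?t n * real (?c n) - real j * (ln (real n) + x)) \<longlonglongrightarrow> 0"
    using assms by (intro threshold_times_difference_tendsto) auto
  have B: "(\<lambda>n. real (?c n) * ln (1 - ?t n) + ?t n * real (?c n)) \<longlonglongrightarrow> 0"
  proof (rule tendsto_sandwich[of "\<lambda>n. - (2 * real j * fact (d - 1) * ((ln (real n) + x) ^ 2 / real n))" _ _ "\<lambda>_. 0"])
    have "(\<lambda>n. (ln (real n) + x) ^ 2 / real n) \<longlonglongrightarrow> 0" by real_asymp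
    from tendsto_minus[OF tendsto_mult_right_zero[OF this, of "2 * real j * fact (d - 1)"]]
    show "(\<lambda>n. - (2 * real j * fact (d - 1) * ((ln (real n) + x) ^ 2 / real n))) \<longlonglongrightarrow> 0" by simp
    show "\<forall>\<^sub>F n in sequentially. real (?c n) * ln (1 - ?t n) + ?t n * real (?c n) \<le> 0"
      using eventually_threshold_bounds[OF assms, of x]
    proof eventually_elim
      case (elim n)
      then have "ln (1 - ?t n) \<le> - ?t n" using ln_add_one_self_le_self2[of "- ?t n"] by simp
      from mult_left_mono[OF this, of "real (?c n)"] show ?case by (simp add: mult.commute)
    qed
    show "\<forall>\<^sub>F n in sequentially. - (2 * real j * fact (d - 1) * ((ln (real n) + x) ^ 2 / real n)) \<le>
        real (?c n) * ln (1 - ?t n) + ?t n * real (?c n)"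
      using eventually_threshold_bounds[OF assms, of x] eventually_ge_at_top[of "Suc (j + d)"]
        eventually_log_ge[of 0 x]
    proof eventually_elim
      case (elim n)
      have "- ?t n - 2 * (?t n)\<^sup>2 \<le> ln (1 - ?t n)"
        using elim by (intro ln_one_minus_pos_lower_bound) auto
      from mult_left_mono[OF this, of "real (?c n)"]
      have 1: "- (2 * (?t n * real (?c n)) * ?t n) \<le> real (?c n) * ln (1 - ?t n) + ?t n * real (?c n)"
        by (simp add: algebra_simps power2_eq_square)
      have "2 * (?t n * real (?c n)) \<le> 2 * (real j * (ln (real n) + x))"
        using elim assms threshold_times_difference_bounds(2)[of j d n x] by auto
      moreover have "?t n \<le> fact (d - 1) * ((ln (real n) + x) / real n)"
        using elim assms by (intro threshold_le) auto
      ultimately have "2 * (?t n * real (?c n)) * ?t n \<le>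
          2 * (real j * (ln (real n) + x)) * (fact (d - 1) * ((ln (real n) + x) / real n))"
        by (rule mult_mono) (use elim in auto)
      also have "\<dots> = 2 * real j * fact (d - 1) * ((ln (real n) + x) ^ 2 / real n)"
        by (simp add: power2_eq_square)
      finally show ?case using 1 by linarith
    qed
  qed simp
  have C: "(\<lambda>n. real j * ln (real n) + real (?c n) * ln (1 - ?t n)) \<longlonglongrightarrow> - (real j * x)"
    using tendsto_diff[OF tendsto_diff[OF B tc] tendsto_const[of "real j * x"]]
    by (simp add: algebra_simps)
  have "(\<lambda>n. real (n choose j) / real n ^ j * exp (real j * ln (real n) + real (?c n) * ln (1 - ?t n)))
     \<longlonglongrightarrow> 1 / fact j * exp (- (real j * x))"
    by (intro tendsto_mult A tendsto_exp C)
  moreover have "\<forall>\<^sub>F n in sequentially.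
     real (n choose j) / real n ^ j * exp (real j * ln (real n) + real (?c n) * ln (1 - ?t n)) =
     real (n choose j) * (1 - ?t n) ^ ?c n"
    using eventually_threshold_bounds[OF assms, of x] eventually_ge_at_top[of 1]
  proof eventually_elim
    case (elim n)
    have "exp (real j * ln (real n)) = real n ^ j"
      using elim by (simp add: exp_of_nat_mult)
    moreover have "exp (real (?c n) * ln (1 - ?t n)) = (1 - ?t n) ^ ?c n"
      using elim by (simp only: exp_of_nat_mult) (simp add: exp_ln)
    ultimately show ?case using elim by (simp add: exp_add)
  qed
  ultimately have "(\<lambda>n. real (n choose j) * (1 - ?t n) ^ ?c n) \<longlonglongrightarrow> 1 / fact j * exp (- (real j * x))"
    by (blast intro: Lim_transform_eventually)
  then show ?thesis by (simp add: exp_of_nat_mult[symmetric])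
qed

text \<open>
  By Bonferroni's inequalities the probability lies between consecutive partial sums whose terms tend to
  those of the exponential series at $-e^{-x}$.
\<close>

theorem prob_covering_tendsto:
  assumes "d \<ge> 2"
  shows "(\<lambda>n. prob (random_subset (nsets {1..n} d) (threshold d x n))
      {E. \<forall>v\<in>{1..n}. \<exists>e\<in>E. v \<in> e}) \<longlonglongrightarrow> exp (- exp (- x))"
proof -
  let ?M = "\<lambda>n. random_subset (nsets {1..n} d) (threshold d x n)"
  let ?h = "\<lambda>n. prob (?M n) {E. \<forall>v\<in>{1..n}. \<exists>e\<in>E. v \<in> e}"
  let ?T = "\<lambda>j n. real (n choose j) * (1 - threshold d x n) ^ ((n choose d) - ((n - j) choose d))"
  let ?s = "\<lambda>k. \<Sum>j\<le>k. (-1) ^ j * (exp (- x) ^ j / fact j)"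
  let ?S = "\<lambda>k n. \<Sum>j\<le>k. (-1) ^ j * ?T j n"
  have St: "?S k \<longlonglongrightarrow> ?s k" for k
    by (intro tendsto_sum tendsto_mult tendsto_const isolated_moment_tendsto assms)
  have s: "?s \<longlonglongrightarrow> exp (- exp (- x))"
  proof -
    have "(\<lambda>j. (- exp (- x)) ^ j /\<^sub>R fact j) sums exp (- exp (- x))" by (rule exp_converges)
    then have "(\<lambda>k. \<Sum>j\<le>k. (- exp (- x)) ^ j /\<^sub>R fact j) \<longlonglongrightarrow> exp (- exp (- x))"
      by (simp add: sums_def_le)
    moreover have "(- exp (- x)) ^ j /\<^sub>R fact j = (-1) ^ j * (exp (- x) ^ j / fact j)" for j
      by (subst power_minus) (simp add: divide_inverse mult.commute)
    ultimately show ?thesis by simp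
  qed
  have bonf: "\<forall>\<^sub>F n in sequentially. 0 \<le> (-1) ^ k * (?S k n - ?h n)" for k
    using eventually_threshold_bounds[OF assms, of x]
  proof eventually_elim
    case (elim n)
    let ?X = "nsets {1..n} d"
    have fX: "finite ?X" by (simp add: finite_imp_finite_nsets)
    have "prob (?M n) {E. \<forall>v\<in>S. \<not> (\<exists>e\<in>E. v \<in> e)} =
        (1 - threshold d x n) ^ ((n choose d) - ((n - j) choose d))" if S: "S \<in> nsets {1..n} j" for S j
    proof -
      have S': "S \<subseteq> {1..n}" "card S = j" using S by (auto simp: nsets_def)
      let ?B = "{e\<in>?X. e \<inter> S \<noteq> {}}"
      have "prob (?M n) {E. \<forall>v\<in>S. \<not> (\<exists>e\<in>E. v \<in> e)} =
          prob (?M n) {E. {} \<subseteq> E \<and> E \<inter> ?B = {}}"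
      proof (intro antisym prob_le_finite_support)
        show "set_pmf (?M n) \<inter> {E. {} \<subseteq> E \<and> E \<inter> ?B = {}} \<subseteq> {E. \<forall>v\<in>S. \<not> (\<exists>e\<in>E. v \<in> e)}"
          using set_random_subset[of ?X "threshold d x n"] by blast
      qed blast
      also have "\<dots> = (1 - threshold d x n) ^ card ?B"
        using prob_random_subset_contains_avoids[of ?X "{}" ?B "threshold d x n"] fX elim by simp
      also have "card ?B = (n choose d) - ((n - j) choose d)"
        using S' by (subst card_nsets_meeting) auto
      finally show ?thesis .
    qed
    then have "(\<Sum>S\<in>nsets {1..n} j. prob (?M n) {E. \<forall>v\<in>S. \<not> (\<exists>e\<in>E. v \<in> e)}) = ?T j n" for j
      by (simp add: card_nsets)
    then show ?case
      using bonferroni[of "{1..n}" "?M n" k "\<lambda>v E. \<not> (\<exists>e\<in>E. v \<in> e)"] finite_set_random_subset[OF fX]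
      by simp
  qed
  show ?thesis
  proof (rule LIMSEQ_I)
    fix r :: real assume r: "r > 0"
    have "\<forall>\<^sub>F k in sequentially. dist (?s k) (exp (- exp (- x))) < r / 2"
      using s r by (intro tendstoD) auto
    then obtain K where K: "\<And>k. k \<ge> K \<Longrightarrow> \<bar>?s k - exp (- exp (- x))\<bar> < r / 2"
      unfolding eventually_sequentially dist_real_def by blast
    have ev: "\<forall>\<^sub>F n in sequentially. \<bar>?S k n - ?s k\<bar> < r / 2" for k
      using tendstoD[OF St[of k], of "r / 2"] r by (simp add: dist_real_def)
    have squeeze: "\<bar>h - L\<bar> < r" if "h \<le> a" "b \<le> h"
      "\<bar>a - s\<bar> < r / 2" "\<bar>b - t\<bar> < r / 2" "\<bar>s - L\<bar> < r / 2" "\<bar>t - L\<bar> < r / 2" for h a b s t L :: real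
    proof -
      have "a - s < r / 2" "- (b - t) < r / 2" "s - L < r / 2" "- (t - L) < r / 2"
        using that(3-6) by (simp_all only: abs_less_iff)
      then show ?thesis using that(1,2) unfolding abs_less_iff by (intro conjI) linarith+
    qed
    have "\<forall>\<^sub>F n in sequentially. norm (?h n - exp (- exp (- x))) < r"
      using ev[of "2 * K"] ev[of "2 * K + 1"] bonf[of "2 * K"] bonf[of "2 * K + 1"]
    proof eventually_elim
      case (elim n)
      have signs: "(- 1 :: real) ^ (2 * K) = 1" "(- 1 :: real) ^ (2 * K + 1) = - 1" by simp_all
      have "?h n \<le> ?S (2 * K) n"
        using elim(3) unfolding signs by (simp only: mult_1_left diff_ge_0_iff_ge)
      moreover have "?S (2 * K + 1) n \<le> ?h n"
        using elim(4) unfolding signs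
        by (simp only: mult_minus_left mult_1_left neg_0_le_iff_le diff_le_0_iff_le)
      ultimately show ?case unfolding real_norm_def
        by (rule squeeze[OF _ _ elim(1,2) K K]) simp_all
    qed
    then show "\<exists>no. \<forall>n\<ge>no. norm (?h n - exp (- exp (- x))) < r"
      by (simp add: eventually_sequentially)
  qed
qed

section \<open>Convergence of the failure bounds\<close>

lemma geometric_sum_le:
  fixes q :: real
  assumes "0 \<le> q" "q \<le> 1 / 2" "a \<ge> 1"
  shows "(\<Sum>k=a..b. q ^ k) \<le> 2 * q"
proof -
  have *: "(\<Sum>k=1..m. q ^ k) \<le> 2 * q * (1 - (1 / 2) ^ m)" for m
  proof (induction m)
    case (Suc m)
    have "q * q ^ m \<le> q * (1 / 2) ^ m" using assms by (intro mult_left_mono power_mono) auto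
    then show ?case using Suc by (simp add: algebra_simps)
  qed simp
  have "(\<Sum>k=a..b. q ^ k) \<le> (\<Sum>k=1..b. q ^ k)"
    using assms by (intro sum_mono2) auto
  also have "\<dots> \<le> 2 * q * (1 - (1 / 2) ^ b)" by (rule *)
  also have "\<dots> \<le> 2 * q" using assms by (simp add: algebra_simps)
  finally show ?thesis .
qed

lemma geometric_sum_tendsto_0:
  fixes q Q :: "nat \<Rightarrow> real"
  assumes "\<forall>\<^sub>F n in sequentially. 0 \<le> q n \<and> q n \<le> Q n" "Q \<longlonglongrightarrow> 0" "\<And>n. a n \<ge> 1"
  shows "(\<lambda>n. \<Sum>k=a n..b n. q n ^ k) \<longlonglongrightarrow> 0"
proof (rule tendsto_sandwich[of "\<lambda>_. 0" _ _ "\<lambda>n. 2 * Q n"])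
  show "\<forall>\<^sub>F n in sequentially. 0 \<le> (\<Sum>k=a n..b n. q n ^ k)"
    using assms(1) by eventually_elim (auto intro: sum_nonneg)
  have "\<forall>\<^sub>F n in sequentially. Q n < 1 / 2" using assms(2) by (rule order_tendstoD) simp
  then show "\<forall>\<^sub>F n in sequentially. (\<Sum>k=a n..b n. q n ^ k) \<le> 2 * Q n"
    using assms(1)
  proof eventually_elim
    case (elim n)
    then have "(\<Sum>k=a n..b n. q n ^ k) \<le> 2 * q n" using assms(3) by (intro geometric_sum_le) auto
    then show ?case using elim by linarith
  qed
  show "(\<lambda>n. 2 * Q n) \<longlonglongrightarrow> 0" using tendsto_mult_right_zero[OF assms(2)] .
qed simp

text \<open>
  Where the two expansion arguments meet. Local sparsity needs $n^{2-d} u^{d-2} \ln n \to 0$; the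
  union bound for larger sets needs $(n/u)^4$ to grow more slowly than every positive power of $n$.
\<close>

definition split_size :: "nat \<Rightarrow> nat" where
  "split_size n = nat \<lfloor>real n / ln (real n) ^ 2\<rfloor>"

lemma split_size_bounds: "real (split_size n) \<le> real n / ln (real n) ^ 2"
    "real n / ln (real n) ^ 2 \<le> real (Suc (split_size n))"
  unfolding split_size_def by (simp_all add: of_nat_nat) linarith

lemma dense_set_bound_tendsto_0:
  assumes "d \<ge> 3"
  shows "(\<lambda>n. \<Sum>k=1..6 * split_size n.
    (exp 2 * real n * real (6 * split_size n) ^ (d - 2) * threshold d x n) ^ k) \<longlonglongrightarrow> 0"
  (is "(\<lambda>n. \<Sum>k=_.._ n. ?q n ^ k) \<longlonglongrightarrow> 0")
proof (rule geometric_sum_tendsto_0[where a = "\<lambda>_. 1"])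
  have d2: "d \<ge> 2" using assms by simp
  show "\<forall>\<^sub>F n in sequentially.
      0 \<le> ?q n \<and>
      ?q n \<le>
      exp 2 * fact (d - 1) * (6 * (ln (real n) + x) / ln (real n) ^ 2)"
    using eventually_threshold_bounds[OF d2, of x] eventually_log_ge[of 0 x]
      eventually_log_ge[of 3 0] eventually_gt_at_top[of 0]
  proof eventually_elim
    case (elim n)
    \<comment> \<open>One factor \<open>u/n\<close> out of the \<open>d - 2 \<ge> 1\<close> available ones already beats the logarithm.\<close>
    let ?l = "ln (real n) + x" and ?r = "6 / ln (real n) ^ 2"
    have n: "real n > 0" using elim by simp
    have "(3::real) ^ 2 \<le> ln (real n) ^ 2" using elim by (intro power_mono) auto
    then have r: "0 \<le> ?r" "?r \<le> 1" by (simp_all add: divide_le_eq_1)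
    have "real (6 * split_size n) \<le> ?r * real n" using split_size_bounds(1)[of n] by simp
    then have "real (6 * split_size n) ^ (d - 2) \<le> (?r * real n) ^ (d - 2)"
      by (intro power_mono) auto
    also have "\<dots> = ?r ^ (d - 2) * real n ^ (d - 2)" by (rule power_mult_distrib)
    also have "\<dots> \<le> ?r ^ 1 * real n ^ (d - 2)"
      using assms r by (intro mult_right_mono power_decreasing) auto
    finally have "?q n \<le>
        exp 2 * real n * (?r * real n ^ (d - 2)) * threshold d x n"
      using elim by (intro mult_right_mono mult_left_mono) auto
    also have "\<dots> = exp 2 * ?r * (real n * real n ^ (d - 2)) * threshold d x n"
      by (simp only: mult_ac)
    also have "real n * real n ^ (d - 2) = real n ^ (d - 1)"
      using assms by (simp add: power_Suc[symmetric] Suc_diff_Suc numeral_2_eq_2)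
    also have "exp 2 * ?r * real n ^ (d - 1) * threshold d x n =
        exp 2 * fact (d - 1) * (6 * ?l / ln (real n) ^ 2)"
      using n by (simp add: threshold_def)
    finally show ?case using elim by simp
  qed
  have "(\<lambda>n. 6 * (ln (real n) + x) / ln (real n) ^ 2) \<longlonglongrightarrow> 0" by real_asymp
  then show "(\<lambda>n. exp 2 * fact (d - 1) * (6 * (ln (real n) + x) / ln (real n) ^ 2)) \<longlonglongrightarrow> 0"
    by (rule tendsto_mult_right_zero)
qed simp

lemma eventually_threshold_binomial_ge:
  assumes "d \<ge> 2"
  shows "\<forall>\<^sub>F n in sequentially. real n * (ln (real n) + x) / (2 * real d) \<le> threshold d x n * real (n choose d)"
  using eventually_log_ge[of 0 x] eventually_ge_at_top[of "2 * d ^ 2"] eventually_ge_at_top[of "Suc d"]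
proof eventually_elim
  case (elim n)
  have "2 * real d ^ 2 \<le> real n" using elim by (metis of_nat_le_iff of_nat_mult of_nat_numeral of_nat_power)
  then have "1 / 2 \<le> 1 - real d ^ 2 / real n" using elim by (simp add: field_simps)
  then have "real n * (ln (real n) + x) / real d * (1 / 2) \<le>
      real n * (ln (real n) + x) / real d * (1 - real d ^ 2 / real n)"
    using elim by (intro mult_left_mono) auto
  also have "\<dots> \<le> threshold d x n * real (n choose d)"
    using elim assms by (intro threshold_times_binomial_bounds) auto
  finally show ?case by (simp add: mult.commute)
qed

text \<open>
  Here and below the sparser random hypergraph has a ten-thousandth of the edge probability, so that it
  has fewer than $n \ln n/(1000 d)$ edges with high probability.
\<close>

lemma mid_expansion_bound_tendsto_0:
  assumes "d \<ge> 2"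
  shows "(\<lambda>n. \<Sum>k=Suc (split_size n)..n. ((exp 1 * real n / real (Suc (split_size n))) ^ 4 *
     exp (- (threshold d x n / 10000) * real (n choose d) / real (4 * n))) ^ k) \<longlonglongrightarrow> 0"
  (is "(\<lambda>n. \<Sum>k=_ n.._ n. ?q n ^ k) \<longlonglongrightarrow> 0")
proof (rule geometric_sum_tendsto_0[where a = "\<lambda>n. Suc (split_size n)"])
  define a where "a = 1 / (80000 * real d)"
  have a: "a > 0" using assms by (simp add: a_def)
  show "\<forall>\<^sub>F n in sequentially. 0 \<le> ?q n \<and>
     ?q n \<le>
     (exp 1 * ln (real n) ^ 2) ^ 4 * exp (- (a * (ln (real n) + x)))"
    using eventually_threshold_binomial_ge[OF assms, of x] eventually_log_ge[of 1 0] eventually_gt_at_top[of 0]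
  proof eventually_elim
    case (elim n)
    have "ln (real n) ^ 2 > 0" using elim(2) by (intro zero_less_power) linarith
    then have "real n \<le> real (Suc (split_size n)) * ln (real n) ^ 2"
      using split_size_bounds(2)[of n] elim by (simp add: field_simps)
    then have "real n / real (Suc (split_size n)) \<le> ln (real n) ^ 2"
      by (simp add: divide_le_eq mult.commute)
    from mult_left_mono[OF this, of "exp 1"]
    have "exp 1 * real n / real (Suc (split_size n)) \<le> exp 1 * ln (real n) ^ 2" by simp
    then have "(exp 1 * real n / real (Suc (split_size n))) ^ 4 \<le> (exp 1 * ln (real n) ^ 2) ^ 4"
      by (intro power_mono) auto
    moreover have "a * (ln (real n) + x) \<le> (threshold d x n / 10000) * real (n choose d) / real (4 * n)"
      using elim assms by (simp add: a_def field_simps)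
    ultimately show ?case
      by (auto intro!: mult_mono simp del: of_nat_mult)
  qed
  show "(\<lambda>n. (exp 1 * ln (real n) ^ 2) ^ 4 * exp (- (a * (ln (real n) + x)))) \<longlonglongrightarrow> 0"
    using a by real_asymp
qed simp

text \<open>
  The number of edges granted to the sparse expander. The constant is small enough that choosing these
  edges costs less, in the union bound over certificates, than avoiding the boosters gains.
\<close>

definition thinned_size :: "nat \<Rightarrow> nat \<Rightarrow> nat" where
  "thinned_size d n = nat \<lceil>real n * ln (real n) / (1000 * real d)\<rceil>"

lemma thinned_size_bounds:
  assumes "n \<ge> 1"
  shows "real n * ln (real n) / (1000 * real d) \<le> real (thinned_size d n)"
    "real (thinned_size d n) \<le> real n * ln (real n) / (1000 * real d) + 1"
proof -
  have "0 \<le> real n * ln (real n) / (1000 * real d)" using assms by simp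
  then show "real n * ln (real n) / (1000 * real d) \<le> real (thinned_size d n)"
    "real (thinned_size d n) \<le> real n * ln (real n) / (1000 * real d) + 1"
    unfolding thinned_size_def by linarith+
qed

lemma thinned_size_bound_tendsto_0:
  assumes "d \<ge> 2"
  shows "(\<lambda>n. exp (exp 1 * (threshold d x n / 10000) * real (n choose d)) / exp 1 ^ thinned_size d n) \<longlonglongrightarrow> 0"
  (is "(\<lambda>n. ?b n) \<longlonglongrightarrow> 0")
proof (rule tendsto_sandwich[of "\<lambda>_. 0"])
  define b where "b = 1 / (10000 * real d)"
  have b: "b > 0" using assms by (simp add: b_def)
  show "(\<lambda>n. exp (b * (3 * (real n * (ln (real n) + x)) - 10 * (real n * ln (real n))))) \<longlonglongrightarrow> 0"
    using b by real_asymp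
  show "\<forall>\<^sub>F n in sequentially. ?b n \<le>
      exp (b * (3 * (real n * (ln (real n) + x)) - 10 * (real n * ln (real n))))"
    using eventually_threshold_bounds[OF assms, of x] eventually_log_ge[of 0 x]
      eventually_ge_at_top[of d] eventually_ge_at_top[of 1]
  proof eventually_elim
    case (elim n)
    have "threshold d x n * real (n choose d) \<le> real n * (ln (real n) + x) / real d"
      using elim assms by (intro threshold_times_binomial_bounds) auto
    then have a1: "exp 1 * (threshold d x n * real (n choose d)) \<le> 3 * (real n * (ln (real n) + x) / real d)"
      using elim exp_le by (intro mult_mono) auto
    have a2: "real n * ln (real n) / (1000 * real d) \<le> real (thinned_size d n)"
      using elim by (intro thinned_size_bounds) auto
    have "exp 1 * (threshold d x n * real (n choose d)) / 10000 - real (thinned_size d n) \<le>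
        3 * (real n * (ln (real n) + x) / real d) / 10000 - real n * ln (real n) / (1000 * real d)"
      by (intro diff_mono divide_right_mono a1 a2) simp
    also have "\<dots> = b * (3 * (real n * (ln (real n) + x)) - 10 * (real n * ln (real n)))"
      using assms by (simp add: b_def field_simps)
    finally have "exp (exp 1 * (threshold d x n * real (n choose d)) / 10000 - real (thinned_size d n)) \<le>
        exp (b * (3 * (real n * (ln (real n) + x)) - 10 * (real n * ln (real n))))"
      by simp
    moreover have "exp (1::real) ^ thinned_size d n = exp (real (thinned_size d n))"
      by (simp add: exp_of_nat_mult[symmetric])
    ultimately show ?case by (simp add: exp_diff mult.assoc)
  qed
qed auto

text \<open>
  Up to $O(n)$ the exponent is at most $-\frac{3}{128 d} n \ln n$, half of the gain of
  $\frac{3}{64} p \binom nd$ from avoiding the boosters, plus $\frac{6}{1000 d} n \ln n$ from the bound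
  $M$ on the size of the certificate.
\<close>

lemma booster_bound_tendsto_0:
  assumes "d \<ge> 2"
  shows "(\<lambda>n. exp (1 / 64 * threshold d x n * real (n choose d) - threshold d x n * real ((n choose d) div 16)) /
     (1 / 64) ^ (thinned_size d n + (6 * d + 1) * n)) \<longlonglongrightarrow> 0"
  (is "(\<lambda>n. ?b n) \<longlonglongrightarrow> 0")
proof (rule tendsto_sandwich[of "\<lambda>_. 0"])
  define b where "b = 1 / real d"
  have b: "b > 0" using assms by (simp add: b_def)
  define c where "c = 6 * (6 * real d + 1)"
  show "(\<lambda>n. exp (b * real n * (6 / 1000 * ln (real n) - 3 / 128 * (ln (real n) + x)) + 7 + c * real n)) \<longlonglongrightarrow> 0"
    using b by real_asymp
  show "\<forall>\<^sub>F n in sequentially. ?b n \<le>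
     exp (b * real n * (6 / 1000 * ln (real n) - 3 / 128 * (ln (real n) + x)) + 7 + c * real n)"
    using eventually_threshold_bounds[OF assms, of x] eventually_threshold_binomial_ge[OF assms, of x]
      eventually_ge_at_top[of 1]
  proof eventually_elim
    case (elim n)
    let ?t = "threshold d x n" and ?N = "real (n choose d)" and ?M = "thinned_size d n + (6 * d + 1) * n"
    \<comment> \<open>The crude bound \<open>64 \<le> e^6\<close> turns all factors into exponentials.\<close>
    have "(64::real) \<le> exp 1 ^ 6"
      using power_mono[of 2 "exp 1 :: real" 6] exp_ge_add_one_self[of 1] by simp
    then have "(64::real) ^ ?M \<le> (exp 1 ^ 6) ^ ?M" by (intro power_mono) auto
    also have "\<dots> = exp (6 * real ?M)"
      by (simp only: power_mult[symmetric] exp_of_nat_mult[symmetric] of_nat_mult of_nat_numeral mult_1_left mult_1_right mult.commute)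
    finally have 64: "1 / (1 / 64) ^ ?M \<le> exp (6 * real ?M)" by (simp add: power_divide)
    have "?N / 16 - 1 \<le> real ((n choose d) div 16)" by linarith
    from mult_left_mono[OF this, of ?t] have "?t * ?N / 16 - ?t \<le> ?t * real ((n choose d) div 16)"
      using elim by (simp add: algebra_simps)
    then have e1: "1 / 64 * ?t * ?N - ?t * real ((n choose d) div 16) \<le> 1 - 3 / 64 * (?t * ?N)"
      using elim by linarith
    have e2: "6 * real ?M \<le> 6 * (real n * ln (real n) / (1000 * real d) + 1) + c * real n"
      using thinned_size_bounds(2)[of n d] elim by (simp add: c_def algebra_simps)
    have "exp (1 / 64 * ?t * ?N - ?t * real ((n choose d) div 16)) / (1 / 64) ^ ?M =
       exp (1 / 64 * ?t * ?N - ?t * real ((n choose d) div 16)) * (1 / (1 / 64) ^ ?M)" by simp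
    also have "\<dots> \<le> exp (1 / 64 * ?t * ?N - ?t * real ((n choose d) div 16)) * exp (6 * real ?M)"
      by (intro mult_left_mono 64) simp
    also have "\<dots> = exp (1 / 64 * ?t * ?N - ?t * real ((n choose d) div 16) + 6 * real ?M)"
      by (rule exp_add[symmetric])
    also have "\<dots> \<le> exp (1 - 3 / 64 * (real n * (ln (real n) + x) / (2 * real d)) +
        (6 * (real n * ln (real n) / (1000 * real d) + 1) + c * real n))"
    proof -
      have "A + M \<le> 1 - 3 / 64 * Q + R" if "A \<le> 1 - 3 / 64 * P" "M \<le> R" "Q \<le> P" for A M P Q R :: real
        using that by linarith
      then show ?thesis unfolding exp_le_cancel_iff using e1 e2 elim(2) .
    qed
    also have "1 - 3 / 64 * (real n * (ln (real n) + x) / (2 * real d)) +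
        (6 * (real n * ln (real n) / (1000 * real d) + 1) + c * real n) =
        b * real n * (6 / 1000 * ln (real n) - 3 / 128 * (ln (real n) + x)) + 7 + c * real n"
      using assms by (simp add: b_def field_simps)
    finally show ?case .
  qed
qed auto

text \<open>
  For each $f$ the factor $n^{f(d-1)} p^f$ is polylogarithmic. This leaves $n$ from the number of
  chains against a factor of order $n^{-2 \cdot 63/64}$, for two low degrees at once; the weaker
  exponent $189/128 > 1$ is enough.
\<close>

lemma close_low_degree_bound_tendsto_0:
  assumes "d \<ge> 2"
  shows "(\<lambda>n. \<Sum>f=1..4. real n ^ (f * (d - 1) + 1) * 2 ^ 2 ^ (4 * d) * real ((4 * d)^2) * (threshold d x n ^ f *
      exp (- (1 - 1 / 64) * threshold d x n * real ((n choose d) - ((n - 2) choose d) - 4)) / (1 / 64) ^ (2 * (6 * d))))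
    \<longlonglongrightarrow> 0"
  (is "(\<lambda>n. \<Sum>f=1..4. ?b f n) \<longlonglongrightarrow> 0")
proof (rule tendsto_null_sum)
  fix f assume f: "f \<in> {1..4::nat}"
  define K :: real where "K = 2 ^ 2 ^ (4 * d) * real ((4 * d)^2) / (1 / 64) ^ (2 * (6 * d)) * fact (d - 1) ^ f"
  have K: "K \<ge> 0" by (simp add: K_def)
  show "(\<lambda>n. ?b f n)
     \<longlonglongrightarrow> 0"
  proof (rule tendsto_sandwich[of "\<lambda>_. 0" _ _ "\<lambda>n. K * (real n * (ln (real n) + x) ^ 4 * exp (- (189 / 128 * (ln (real n) + x))))"])
    show "\<forall>\<^sub>F n in sequentially. 0 \<le> ?b f n"
      using eventually_threshold_bounds[OF assms, of x] by eventually_elim auto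
    have "(\<lambda>n. real n * (ln (real n) + x) ^ 4 * exp (- (189 / 128 * (ln (real n) + x)))) \<longlonglongrightarrow> 0"
      by real_asymp
    then show "(\<lambda>n. K * (real n * (ln (real n) + x) ^ 4 * exp (- (189 / 128 * (ln (real n) + x))))) \<longlonglongrightarrow> 0"
      by (rule tendsto_mult_right_zero)
    have "\<forall>\<^sub>F n in sequentially. - 1 <
        threshold d x n * real ((n choose d) - ((n - 2) choose d)) - real 2 * (ln (real n) + x)"
      by (rule order_tendstoD(1)[OF threshold_times_difference_tendsto]) (use assms in auto)
    then show "\<forall>\<^sub>F n in sequentially.
      ?b f n
      \<le> K * (real n * (ln (real n) + x) ^ 4 * exp (- (189 / 128 * (ln (real n) + x))))"
      using eventually_threshold_bounds[OF assms, of x] eventually_log_ge[of 6 x] eventually_gt_at_top[of 0]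
    proof eventually_elim
      case (elim n)
      let ?t = "threshold d x n" and ?l = "ln (real n) + x"
        and ?a = "(n choose d) - ((n - 2) choose d) - 4"
      have n: "real n > 0" using elim by simp
      have "real ((n choose d) - ((n - 2) choose d)) - 4 \<le> real ?a" by linarith
      from mult_left_mono[OF this, of ?t]
      have "?t * real ((n choose d) - ((n - 2) choose d)) - 4 * ?t \<le> ?t * real ?a"
        using elim by (simp add: algebra_simps)
      moreover have "2 * ?l - 1 < ?t * real ((n choose d) - ((n - 2) choose d))"
        using elim(1) unfolding of_nat_numeral by linarith
      moreover have "3 / 2 * l \<le> ta" if "tc - 4 * t \<le> ta" "2 * l - 1 < tc" "t \<le> 1 / 2" "6 \<le> l"
        for ta tc t l :: real using that by linarith
      ultimately have "3 / 2 * ?l \<le> ?t * real ?a" using elim(2,3) by blast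
      then have ex: "exp (- (1 - 1 / 64) * ?t * real ?a) \<le> exp (- (189 / 128 * ?l))" by simp
      have tf: "real n ^ (f * (d - 1) + 1) * ?t ^ f = real n * (fact (d - 1) * ?l) ^ f"
      proof -
        have "real n ^ (f * (d - 1) + 1) = real n * (real n ^ (d - 1)) ^ f"
          by (simp add: power_mult[symmetric] mult.commute)
        then have "real n ^ (f * (d - 1) + 1) * ?t ^ f = real n * (real n ^ (d - 1) * ?t) ^ f"
          by (simp only: power_mult_distrib mult.assoc)
        then show ?thesis using n by (simp add: threshold_def)
      qed
      have "?b f n =
        (real n ^ (f * (d - 1) + 1) * ?t ^ f) * (2 ^ 2 ^ (4 * d) * real ((4 * d)^2) / (1 / 64) ^ (2 * (6 * d))) *
        exp (- (1 - 1 / 64) * ?t * real ?a)"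
        by (simp only: times_divide_eq_right times_divide_eq_left mult_ac)
      also have "\<dots> = K * (real n * ?l ^ f * exp (- (1 - 1 / 64) * ?t * real ?a))"
        unfolding tf K_def power_mult_distrib
        by (simp only: times_divide_eq_right times_divide_eq_left mult_ac)
      also have "\<dots> \<le> K * (real n * ?l ^ 4 * exp (- (189 / 128 * ?l)))"
        using elim f by (intro mult_left_mono mult_mono ex power_increasing K) auto
      finally show ?case .
    qed
  qed simp
qed

theorem prob_covering_not_hamiltonian_tendsto_0:
  assumes "d \<ge> 3"
  shows "(\<lambda>n. prob (random_subset (nsets {1..n} d) (threshold d x n))
      {E. (\<forall>v\<in>{1..n}. \<exists>e\<in>E. v \<in> e) \<and> \<not> weak_hamiltonian ({1..n}, E)}) \<longlonglongrightarrow> 0"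
proof (rule tendsto_sandwich[of "\<lambda>_. 0"])
  have d2: "d \<ge> 2" using assms by simp
  let ?B = "\<lambda>n. (\<Sum>k=1..6 * split_size n.
      (exp 2 * real n * real (6 * split_size n) ^ (d - 2) * threshold d x n) ^ k) +
    (\<Sum>f=1..4. real n ^ (f * (d - 1) + 1) * 2 ^ 2 ^ (4 * d) * real ((4 * d)^2) * (threshold d x n ^ f *
      exp (- (1 - 1 / 64) * threshold d x n * real ((n choose d) - ((n - 2) choose d) - 4)) / (1 / 64) ^ (2 * (6 * d)))) +
    (exp (exp 1 * (threshold d x n / 10000) * real (n choose d)) / exp 1 ^ thinned_size d n +
    (\<Sum>k=Suc (split_size n)..n. ((exp 1 * real n / real (Suc (split_size n))) ^ 4 *
     exp (- (threshold d x n / 10000) * real (n choose d) / real (4 * n))) ^ k)) +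
    exp (1 / 64 * threshold d x n * real (n choose d) - threshold d x n * real ((n choose d) div 16)) /
     (1 / 64) ^ (thinned_size d n + (6 * d + 1) * n)"
  show "?B \<longlonglongrightarrow> 0"
    by (intro tendsto_add_zero dense_set_bound_tendsto_0[OF assms] close_low_degree_bound_tendsto_0[OF d2]
      thinned_size_bound_tendsto_0[OF d2] mid_expansion_bound_tendsto_0[OF d2] booster_bound_tendsto_0[OF d2])
  show "\<forall>\<^sub>F n in sequentially. prob (random_subset (nsets {1..n} d) (threshold d x n))
      {E. (\<forall>v\<in>{1..n}. \<exists>e\<in>E. v \<in> e) \<and> \<not> weak_hamiltonian ({1..n}, E)} \<le> ?B n"
    using eventually_threshold_bounds[OF d2, of x] eventually_ge_at_top[of 8] eventually_ge_at_top[of "4 * d"]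
  proof eventually_elim
    case (elim n)
    have "(1::real) \<le> exp 1" by simp
    then show ?case
      using prob_covering_not_hamiltonian[of "{1..n}" d "threshold d x n / 10000" "threshold d x n" "1 / 64" "exp 1"
          "split_size n" "thinned_size d n"] elim assms by simp
  qed
qed simp_all

section \<open>Transfer from constant to varying parameters\<close>

text \<open>
  The distribution function of the standard Gumbel law.
\<close>

definition gumbel :: "real \<Rightarrow> real" where
  "gumbel x = exp (- exp (- x))"

text \<open>
  The limit law in a form that suits arbitrary sequences $c_n$: whenever $c_n \ge x$ the probability
  exceeds every bound below the limit at $x$, and dually. Convergent and divergent $c_n$ are then
  special cases.
\<close>

definition gumbel_window :: "(nat \<Rightarrow> real) \<Rightarrow> (nat \<Rightarrow> real) \<Rightarrow> bool" where
  "gumbel_window c G \<longleftrightarrow>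
     (\<forall>x r. r < gumbel x \<longrightarrow> (\<forall>\<^sub>F n in sequentially. x \<le> c n \<longrightarrow> r < G n)) \<and>
     (\<forall>x r. gumbel x < r \<longrightarrow> (\<forall>\<^sub>F n in sequentially. c n \<le> x \<longrightarrow> G n < r))"

lemma continuous_gumbel: "continuous (at x within S) gumbel"
  unfolding gumbel_def[abs_def] by (intro continuous_intros)

lemma gumbel_less_left:
  assumes "r < gumbel x"
  shows "\<exists>y<x. r < gumbel y"
proof -
  have "\<forall>\<^sub>F y in at_left x. r < gumbel y"
    using continuous_gumbel[of x "{..<x}"] assms
    unfolding continuous_within by (rule order_tendstoD(1))
  then obtain b where b: "b < x" "\<forall>y>b. y < x \<longrightarrow> r < gumbel y"
    unfolding eventually_at_left_field by blast
  then show ?thesis by (intro exI[of _ "(b + x) / 2"]) auto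
qed

lemma gumbel_less_right:
  assumes "gumbel x < r"
  shows "\<exists>y>x. gumbel y < r"
proof -
  have "\<forall>\<^sub>F y in at_right x. gumbel y < r"
    using continuous_gumbel[of x "{x<..}"] assms
    unfolding continuous_within by (rule order_tendstoD(2))
  then obtain b where b: "b > x" "\<forall>y>x. y < b \<longrightarrow> gumbel y < r"
    unfolding eventually_at_right_field by blast
  then show ?thesis by (intro exI[of _ "(b + x) / 2"]) auto
qed

lemma gumbel_window_tendsto:
  assumes "gumbel_window c G" "c \<longlonglongrightarrow> c0"
  shows "G \<longlonglongrightarrow> gumbel c0"
proof (rule order_tendstoI)
  fix r assume "r < gumbel c0"
  then obtain y where y: "y < c0" "r < gumbel y" using gumbel_less_left by blast
  have "\<forall>\<^sub>F n in sequentially. y < c n" using assms(2) y(1) by (rule order_tendstoD)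
  moreover have "\<forall>\<^sub>F n in sequentially. y \<le> c n \<longrightarrow> r < G n"
    using assms(1) y(2) by (auto simp: gumbel_window_def)
  ultimately show "\<forall>\<^sub>F n in sequentially. r < G n" by eventually_elim auto
next
  fix r assume "gumbel c0 < r"
  then obtain y where y: "y > c0" "gumbel y < r" using gumbel_less_right by blast
  have "\<forall>\<^sub>F n in sequentially. c n < y" using assms(2) y(1) by (rule order_tendstoD)
  moreover have "\<forall>\<^sub>F n in sequentially. c n \<le> y \<longrightarrow> G n < r"
    using assms(1) y(2) by (auto simp: gumbel_window_def)
  ultimately show "\<forall>\<^sub>F n in sequentially. G n < r" by eventually_elim auto
qed

lemma gumbel_window_at_top:
  assumes "gumbel_window c G" "filterlim c at_top sequentially" "\<And>n. G n \<le> 1"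
  shows "G \<longlonglongrightarrow> 1"
proof (rule order_tendstoI)
  fix r :: real assume r: "r < 1"
  have "(gumbel \<longlongrightarrow> 1) at_top" unfolding gumbel_def[abs_def] by real_asymp
  then have "\<forall>\<^sub>F x in at_top. r < gumbel x" using r by (rule order_tendstoD)
  then obtain x where x: "r < gumbel x" using eventually_happens'[OF trivial_limit_at_top_linorder] by blast
  have "\<forall>\<^sub>F n in sequentially. x \<le> c n" using assms(2) by (auto simp: filterlim_at_top)
  moreover have "\<forall>\<^sub>F n in sequentially. x \<le> c n \<longrightarrow> r < G n"
    using assms(1) x by (auto simp: gumbel_window_def)
  ultimately show "\<forall>\<^sub>F n in sequentially. r < G n" by eventually_elim auto
next
  fix r :: real assume "1 < r"
  then show "\<forall>\<^sub>F n in sequentially. G n < r" using le_less_trans[OF assms(3)]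
    by (intro always_eventually allI)
qed

lemma gumbel_window_at_bot:
  assumes "gumbel_window c G" "filterlim c at_bot sequentially" "\<And>n. 0 \<le> G n"
  shows "G \<longlonglongrightarrow> 0"
proof (rule order_tendstoI)
  fix r :: real assume r: "0 < r"
  have "(gumbel \<longlongrightarrow> 0) at_bot" unfolding gumbel_def[abs_def] by real_asymp
  then have "\<forall>\<^sub>F x in at_bot. gumbel x < r" using r by (rule order_tendstoD)
  then obtain x where x: "gumbel x < r" using eventually_happens'[OF trivial_limit_at_bot_linorder] by blast
  have "\<forall>\<^sub>F n in sequentially. c n \<le> x" using assms(2) by (auto simp: filterlim_at_bot)
  moreover have "\<forall>\<^sub>F n in sequentially. c n \<le> x \<longrightarrow> G n < r"
    using assms(1) x by (auto simp: gumbel_window_def)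
  ultimately show "\<forall>\<^sub>F n in sequentially. G n < r" by eventually_elim auto
next
  fix r :: real assume "r < 0"
  then show "\<forall>\<^sub>F n in sequentially. r < G n" using less_le_trans[OF _ assms(3)]
    by (intro always_eventually allI)
qed

lemma threshold_mono: "x \<le> y \<Longrightarrow> threshold d x n \<le> threshold d y n"
  by (auto simp: threshold_def intro!: divide_right_mono)

text \<open>
  If $c_n \ge x$, the edge probability is at least the one for the constant $x$, and monotone coupling
  compares the two; dually for $c_n \le x$.
\<close>

lemma gumbel_window_binomial:
  fixes Q :: "nat \<Rightarrow> nat set set set"
  assumes "d \<ge> 2"
    and lim: "\<And>x. (\<lambda>n. prob (random_subset (nsets {1..n} d) (threshold d x n)) (Q n)) \<longlonglongrightarrow> gumbel x"
    and up: "\<And>n E E'. E \<in> Q n \<Longrightarrow> E \<subseteq> E' \<Longrightarrow> E' \<subseteq> nsets {1..n} d \<Longrightarrow> E' \<in> Q n"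
    and p: "\<forall>\<^sub>F n in sequentially. p n = threshold d (c n) n \<and> 0 \<le> p n \<and> p n \<le> 1"
  shows "gumbel_window c (\<lambda>n. prob (random_subset (nsets {1..n} d) (p n)) (Q n))"
  unfolding gumbel_window_def
proof (intro conjI allI impI)
  have mono: "prob (random_subset (nsets {1..n} d) q) (Q n) \<le>
      prob (random_subset (nsets {1..n} d) q') (Q n)" if "0 \<le> q" "q \<le> q'" "q' \<le> 1" for n q q'
    using that up by (intro prob_random_subset_mono) (auto simp: finite_imp_finite_nsets)
  {
    fix x r assume "r < gumbel x"
    from order_tendstoD(1)[OF lim this] eventually_threshold_bounds[OF assms(1), of x] p
    show "\<forall>\<^sub>F n in sequentially. x \<le> c n \<longrightarrow>
        r < prob (random_subset (nsets {1..n} d) (p n)) (Q n)"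
    proof eventually_elim
      case (elim n)
      then show ?case using mono[of "threshold d x n" "p n" n] threshold_mono[of x "c n" d n] by auto
    qed
  }
  {
    fix x r assume "gumbel x < r"
    from order_tendstoD(2)[OF lim this] eventually_threshold_bounds[OF assms(1), of x] p
    show "\<forall>\<^sub>F n in sequentially. c n \<le> x \<longrightarrow>
        prob (random_subset (nsets {1..n} d) (p n)) (Q n) < r"
    proof eventually_elim
      case (elim n)
      then show ?case using mono[of "p n" "threshold d x n" n] threshold_mono[of "c n" x d n] by auto
    qed
  }
qed

text \<open>
  The parameter of the binomial model is shifted from $x$ to a nearby $y$. This moves the mean number of
  edges by $n|x-y|/d$, of which one half serves as the deviation in Chebyshev's inequality; the other
  half can absorb the error in $\binom nd \approx n^d/d!$.
\<close>

lemma gumbel_window_uniform: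
  fixes Q :: "nat \<Rightarrow> nat set set set" and m :: "nat \<Rightarrow> nat"
  assumes d: "d \<ge> 2"
    and lim: "\<And>x. (\<lambda>n. prob (random_subset (nsets {1..n} d) (threshold d x n)) (Q n)) \<longlonglongrightarrow> gumbel x"
    and up: "\<And>n E E'. E \<in> Q n \<Longrightarrow> E \<subseteq> E' \<Longrightarrow> E' \<subseteq> nsets {1..n} d \<Longrightarrow> E' \<in> Q n"
    and m: "\<forall>\<^sub>F n in sequentially. real (m n) = real n / real d * (ln (real n) + c n) \<and> m n \<le> n choose d"
  shows "gumbel_window c (\<lambda>n. level_fraction (nsets {1..n} d) (Q n) (m n))"
proof -
  let ?X = "\<lambda>n::nat. nsets {1..n} d"
  let ?P = "\<lambda>x n. prob (random_subset (?X n) (threshold d x n)) (Q n)"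
  let ?err = "\<lambda>x \<epsilon> n. 4 * real d / \<epsilon> ^ 2 * ((ln (real n) + x) / real n)"
  have fX: "finite (?X n)" for n by (simp add: finite_imp_finite_nsets)
  have cX: "card (?X n) = n choose d" for n by (simp add: card_nsets)
  have err0: "?err x \<epsilon> \<longlonglongrightarrow> 0" for x \<epsilon>
    by (rule tendsto_mult_right_zero) real_asymp
  have err: "real (card (?X n)) * threshold d x n / (real n * \<epsilon> / (2 * real d)) ^ 2 \<le> ?err x \<epsilon> n"
    if "\<epsilon> > 0" "d \<le> n" "0 \<le> ln (real n) + x" for x \<epsilon> n
  proof -
    have n: "real n > 0" using that d by simp
    have "threshold d x n * real (n choose d) \<le> real n * (ln (real n) + x) / real d"
      using that d by (intro threshold_times_binomial_bounds) auto
    then have "real (card (?X n)) * threshold d x n / (real n * \<epsilon> / (2 * real d)) ^ 2 \<le>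
        real n * (ln (real n) + x) / real d / (real n * \<epsilon> / (2 * real d)) ^ 2"
      unfolding cX by (intro divide_right_mono) (auto simp: mult.commute)
    also have "\<dots> = ?err x \<epsilon> n"
      using n that d by (simp add: field_simps power2_eq_square)
    finally show ?thesis .
  qed
  show ?thesis unfolding gumbel_window_def
  proof (intro conjI allI impI)
    fix x r assume "r < gumbel x"
    then obtain y where y: "y < x" "r < gumbel y" using gumbel_less_left by blast
    let ?\<epsilon> = "x - y"
    have "(\<lambda>n. ?P y n - ?err y ?\<epsilon> n) \<longlonglongrightarrow> gumbel y - 0"
      by (intro tendsto_diff lim err0)
    then have "\<forall>\<^sub>F n in sequentially. r < ?P y n - ?err y ?\<epsilon> n"
      using y(2) by (intro order_tendstoD(1)) auto
    then show "\<forall>\<^sub>F n in sequentially. x \<le> c n \<longrightarrow> r < level_fraction (?X n) (Q n) (m n)"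
      using eventually_threshold_bounds[OF d, of y] eventually_log_ge[of 0 y] eventually_ge_at_top[of d] m
    proof eventually_elim
      case (elim n)
      show ?case
      proof
        assume c: "x \<le> c n"
        let ?a = "real n * ?\<epsilon> / (2 * real d)"
        have n: "real n > 0" using elim d by simp
        have "threshold d y n * real (n choose d) \<le> real n * (ln (real n) + y) / real d"
          using elim d by (intro threshold_times_binomial_bounds) auto
        moreover have "real n * (ln (real n) + y) / real d + real n * ?\<epsilon> / real d \<le> real (m n)"
        proof -
          have "real n * (ln (real n) + y) / real d + real n * ?\<epsilon> / real d = real n / real d * (ln (real n) + x)"
            using d by (simp add: field_simps)
          also have "\<dots> \<le> real n / real d * (ln (real n) + c n)"
            using c by (intro mult_left_mono) auto
          finally show ?thesis using elim by simp
        qed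
        moreover have "?a \<le> real n * ?\<epsilon> / real d"
          using y(1) n d by (intro divide_left_mono mult_nonneg_nonneg) auto
        ultimately have "real (card (?X n)) * threshold d y n + ?a \<le> real (m n)"
          unfolding cX by (simp only: mult.commute[of "real (n choose d)"])
        then have "?P y n \<le> level_fraction (?X n) (Q n) (m n) + real (card (?X n)) * threshold d y n / ?a ^ 2"
        proof (rule level_fraction_transfer(1)[OF fX, rotated -1])
          show "0 \<le> threshold d y n" "threshold d y n \<le> 1" using elim by simp_all
          show "0 < ?a" using y(1) n d by simp
          show "m n \<le> card (?X n)" using elim by (simp add: cX)
          show "E' \<in> Q n" if "E \<in> Q n" "E \<subseteq> E'" "E' \<subseteq> ?X n" for E E' using that by (rule up)
        qed
        then show "r < level_fraction (?X n) (Q n) (m n)"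
          using err[of ?\<epsilon> n y] elim y(1) by auto
      qed
    qed
  next
    fix x r assume "gumbel x < r"
    then obtain y where y: "x < y" "gumbel y < r" using gumbel_less_right by blast
    let ?\<epsilon> = "y - x"
    have "(\<lambda>n. ?P y n + ?err y ?\<epsilon> n) \<longlonglongrightarrow> gumbel y + 0"
      by (intro tendsto_add lim err0)
    then have "\<forall>\<^sub>F n in sequentially. ?P y n + ?err y ?\<epsilon> n < r"
      using y(2) by (intro order_tendstoD(2)) auto
    moreover have "\<forall>\<^sub>F n in sequentially. (ln (real n) + y) / real n < ?\<epsilon> / (2 * real d ^ 2)"
      by (rule order_tendstoD(2)[of _ 0]) (real_asymp, use y(1) d in simp)
    ultimately show "\<forall>\<^sub>F n in sequentially. c n \<le> x \<longrightarrow> level_fraction (?X n) (Q n) (m n) < r"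
      using eventually_threshold_bounds[OF d, of y] eventually_log_ge[of 0 y] eventually_ge_at_top[of d] m
    proof eventually_elim
      case (elim n)
      show ?case
      proof
        assume c: "c n \<le> x"
        let ?a = "real n * ?\<epsilon> / (2 * real d)"
        have n: "real n > 0" "real d > 0" using elim d by simp_all
        have "real n * (ln (real n) + y) / real d * (1 - real d ^ 2 / real n) \<le> threshold d y n * real (n choose d)"
          using elim d by (intro threshold_times_binomial_bounds) auto
        moreover have "real n * (ln (real n) + y) / real d * (1 - real d ^ 2 / real n) =
            real n * (ln (real n) + y) / real d - real d * (ln (real n) + y)"
          using n by (simp add: field_simps power2_eq_square)
        moreover have "real d * (ln (real n) + y) \<le> ?a"
          using elim(2) n by (simp add: field_simps power2_eq_square)
        moreover have "real (m n) \<le> real n * (ln (real n) + y) / real d - 2 * ?a"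
        proof -
          have "real (m n) \<le> real n / real d * (ln (real n) + x)"
            using elim c n by (auto intro!: divide_right_mono mult_left_mono)
          also have "\<dots> = real n * (ln (real n) + y) / real d - 2 * ?a"
            using n by (simp add: field_simps)
          finally show ?thesis .
        qed
        ultimately have "real (m n) \<le> real (card (?X n)) * threshold d y n - ?a"
          unfolding cX by (simp only: mult.commute[of "real (n choose d)"])
        then have "level_fraction (?X n) (Q n) (m n) \<le> ?P y n + real (card (?X n)) * threshold d y n / ?a ^ 2"
        proof (rule level_fraction_transfer(2)[OF fX, rotated -1])
          show "0 \<le> threshold d y n" "threshold d y n \<le> 1" using elim by simp_all
          show "0 < ?a" using y(1) n d by simp
          show "m n \<le> card (?X n)" using elim by (simp add: cX)
          show "E' \<in> Q n" if "E \<in> Q n" "E \<subseteq> E'" "E' \<subseteq> ?X n" for E E' using that by (rule up)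
        qed
        then show "level_fraction (?X n) (Q n) (m n) < r"
          using err[of ?\<epsilon> n y] elim y(1) by auto
      qed
    qed
  qed
qed

text \<open>
  A weak Hamiltonian hypergraph covers all vertices, and the converse fails with probability $o(1)$.
\<close>

lemma prob_hamiltonian_tendsto:
  assumes "d \<ge> 3"
  shows "(\<lambda>n. prob (random_subset (nsets {1..n} d) (threshold d x n))
      {E. weak_hamiltonian ({1..n}, E)}) \<longlonglongrightarrow> gumbel x"
proof -
  let ?M = "\<lambda>n. random_subset (nsets {1..n} d) (threshold d x n)"
  let ?C = "\<lambda>n. {E. \<forall>v\<in>{1..n}. \<exists>e\<in>E. v \<in> e} :: nat set set set"
  let ?H = "\<lambda>n. {E. weak_hamiltonian ({1..n}, E)} :: nat set set set"
  let ?D = "\<lambda>n. {E. (\<forall>v\<in>{1..n}. \<exists>e\<in>E. v \<in> e) \<and> \<not> weak_hamiltonian ({1..n}, E)} :: nat set set set"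
  have "?H n \<subseteq> ?C n" for n
    by (intro subsetI CollectI ballI weak_hamiltonian_covers) (simp_all only: mem_Collect_eq)
  moreover have "?D n = ?C n - ?H n" for n by blast
  ultimately have "prob (?M n) (?H n) = prob (?M n) (?C n) - prob (?M n) (?D n)" for n
    using measure_pmf.finite_measure_Diff[of "?C n" "?M n" "?H n"] by simp
  moreover have "(\<lambda>n. prob (?M n) (?C n) - prob (?M n) (?D n)) \<longlonglongrightarrow> exp (- exp (- x)) - 0"
    using assms by (intro tendsto_diff prob_covering_tendsto prob_covering_not_hamiltonian_tendsto_0) auto
  ultimately show ?thesis by (simp add: gumbel_def)
qed

text \<open>
  To be used with the probabilities \<open>H\<close> of a weak Hamilton cycle and \<open>C\<close> of minimum degree
  at least 1; both random models lead to this situation.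
\<close>

lemma gumbel_window_conclusion:
  assumes H: "gumbel_window c H" and C: "gumbel_window c C"
    and b: "\<And>n. 0 \<le> H n" "\<And>n. H n \<le> 1"
  shows "(\<forall>c0. c \<longlonglongrightarrow> c0 \<longrightarrow> (\<lambda>n. H n - C n) \<in> o(\<lambda>_. 1) \<and> H \<longlonglongrightarrow> exp (- exp (- c0))) \<and>
    (filterlim c at_bot sequentially \<longrightarrow> (\<lambda>n. 1 - H n) \<longlonglongrightarrow> 1) \<and>
    (filterlim c at_top sequentially \<longrightarrow> H \<longlonglongrightarrow> 1)"
proof (intro conjI allI impI)
  fix c0 assume c: "c \<longlonglongrightarrow> c0"
  show lim: "H \<longlonglongrightarrow> exp (- exp (- c0))" using gumbel_window_tendsto[OF H c] by (simp add: gumbel_def)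
  have "(\<lambda>n. H n - C n) \<longlonglongrightarrow> gumbel c0 - gumbel c0"
    by (intro tendsto_diff gumbel_window_tendsto[OF H c] gumbel_window_tendsto[OF C c])
  then show "(\<lambda>n. H n - C n) \<in> o(\<lambda>_. 1)" by (intro smalloI_tendsto) auto
next
  assume "filterlim c at_bot sequentially"
  then have "H \<longlonglongrightarrow> 0" using gumbel_window_at_bot[OF H] b by blast
  from tendsto_diff[OF tendsto_const[of 1] this] show "(\<lambda>n. 1 - H n) \<longlonglongrightarrow> 1" by simp
next
  assume "filterlim c at_top sequentially"
  then show "H \<longlonglongrightarrow> 1" using gumbel_window_at_top[OF H] b by blast
qed

lemma gumbel_window_cong:
  assumes "gumbel_window c G" "\<forall>\<^sub>F n in sequentially. G n = G' n"
  shows "gumbel_window c G'"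
  unfolding gumbel_window_def
proof (intro conjI allI impI)
  fix x r assume "r < gumbel x"
  then have "\<forall>\<^sub>F n in sequentially. x \<le> c n \<longrightarrow> r < G n" using assms(1) by (auto simp: gumbel_window_def)
  with assms(2) show "\<forall>\<^sub>F n in sequentially. x \<le> c n \<longrightarrow> r < G' n" by eventually_elim simp
next
  fix x r assume "gumbel x < r"
  then have "\<forall>\<^sub>F n in sequentially. c n \<le> x \<longrightarrow> G n < r" using assms(1) by (auto simp: gumbel_window_def)
  with assms(2) show "\<forall>\<^sub>F n in sequentially. c n \<le> x \<longrightarrow> G' n < r" by eventually_elim simp
qed

lemma min_degree_ge_1_iff_covers:
  fixes n :: nat
  assumes "n \<ge> 1" "E \<subseteq> nsets {1..n} d"
  shows "min_degree ({1..n}, E) \<ge> 1 \<longleftrightarrow> (\<forall>v\<in>{1..n}. \<exists>e\<in>E. v \<in> e)"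
  using assms by (intro min_degree_ge_1_iff) (auto intro: finite_subset finite_imp_finite_nsets)

lemma covers_mono:
  "E \<in> {E. \<forall>v\<in>V. \<exists>e\<in>E. v \<in> e} \<Longrightarrow> E \<subseteq> E' \<Longrightarrow> E' \<in> {E. \<forall>v\<in>V. \<exists>e\<in>E. v \<in> e}"
  by blast

section \<open>The threshold theorem\<close>

lemma hyp_np_gumbel_windows:
  fixes c p :: "nat \<Rightarrow> real"
  assumes d: "d \<ge> 3"
    and p: "\<forall>\<^sub>F n in sequentially.
      p n = fact (d - 1) * (ln (real n) + c n) / real n ^ (d - 1) \<and> 0 \<le> p n \<and> p n \<le> 1"
  shows "gumbel_window c (\<lambda>n. prob (hyp_np d n (p n)) {H. weak_hamiltonian H})"
    and "gumbel_window c (\<lambda>n. prob (hyp_np d n (p n)) {H. min_degree H \<ge> 1})"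
proof -
  have p': "\<forall>\<^sub>F n in sequentially. p n = threshold d (c n) n \<and> 0 \<le> p n \<and> p n \<le> 1"
    using p by (simp add: threshold_def)
  show "gumbel_window c (\<lambda>n. prob (hyp_np d n (p n)) {H. weak_hamiltonian H})"
    unfolding prob_hyp_np using d weak_hamiltonian_mono
    by (intro gumbel_window_binomial p' prob_hamiltonian_tendsto) auto
  have C: "gumbel_window c (\<lambda>n. prob (random_subset (nsets {1..n} d) (p n))
      {E. \<forall>v\<in>{1..n}. \<exists>e\<in>E. v \<in> e})"
    using d prob_covering_tendsto[of d]
    by (intro gumbel_window_binomial[OF _ _ covers_mono p']) (auto simp: gumbel_def)
  have "\<forall>\<^sub>F n in sequentially. prob (random_subset (nsets {1..n} d) (p n))
      {E. \<forall>v\<in>{1..n}. \<exists>e\<in>E. v \<in> e} = prob (hyp_np d n (p n)) {H. min_degree H \<ge> 1}"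
    using eventually_ge_at_top[of 1]
  proof eventually_elim
    case (elim n)
    show ?case unfolding prob_hyp_np
    proof (rule measure_pmf.finite_measure_eq_AE, unfold AE_measure_pmf_iff, rule ballI)
      fix E assume "E \<in> set_pmf (random_subset (nsets {1..n} d) (p n))"
      then have "E \<subseteq> nsets {1..n} d" using set_random_subset by blast
      from min_degree_ge_1_iff_covers[OF elim this]
      show "E \<in> {E. \<forall>v\<in>{1..n}. \<exists>e\<in>E. v \<in> e} \<longleftrightarrow> E \<in> {E. 1 \<le> min_degree ({1..n}, E)}"
        by (simp only: mem_Collect_eq)
    qed simp_all
  qed
  with C show "gumbel_window c (\<lambda>n. prob (hyp_np d n (p n)) {H. min_degree H \<ge> 1})"
    by (rule gumbel_window_cong)
qed

lemma hyp_nm_gumbel_windows: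
  fixes c :: "nat \<Rightarrow> real" and m :: "nat \<Rightarrow> nat"
  assumes d: "d \<ge> 3"
    and m: "\<forall>\<^sub>F n in sequentially.
      real (m n) = real n / real d * (ln (real n) + c n) \<and> m n \<le> n choose d"
  shows "gumbel_window c (\<lambda>n. prob (hyp_nm d n (m n)) {H. weak_hamiltonian H})"
    and "gumbel_window c (\<lambda>n. prob (hyp_nm d n (m n)) {H. min_degree H \<ge> 1})"
proof -
  have d2: "d \<ge> 2" using d by simp
  have H: "gumbel_window c (\<lambda>n. level_fraction (nsets {1..n} d) {E. weak_hamiltonian ({1..n}, E)} (m n))"
    by (intro gumbel_window_uniform[OF d2 prob_hamiltonian_tendsto[OF d] _ m])
      (auto intro: weak_hamiltonian_mono)
  have "\<forall>\<^sub>F n in sequentially. level_fraction (nsets {1..n} d) {E. weak_hamiltonian ({1..n}, E)} (m n) =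
      prob (hyp_nm d n (m n)) {H. weak_hamiltonian H}"
    using m by eventually_elim (simp add: prob_hyp_nm)
  with H show "gumbel_window c (\<lambda>n. prob (hyp_nm d n (m n)) {H. weak_hamiltonian H})"
    by (rule gumbel_window_cong)
  have C: "gumbel_window c (\<lambda>n. level_fraction (nsets {1..n} d) {E. \<forall>v\<in>{1..n}. \<exists>e\<in>E. v \<in> e} (m n))"
    by (rule gumbel_window_uniform[OF d2 _ covers_mono m])
      (unfold gumbel_def, rule prob_covering_tendsto[OF d2])
  have "\<forall>\<^sub>F n in sequentially. level_fraction (nsets {1..n} d) {E. \<forall>v\<in>{1..n}. \<exists>e\<in>E. v \<in> e} (m n) =
      prob (hyp_nm d n (m n)) {H. min_degree H \<ge> 1}"
    using m eventually_ge_at_top[of 1]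
  proof eventually_elim
    case (elim n)
    have "{E \<in> nsets (nsets {1..n} d) (m n). E \<in> {E. \<forall>v\<in>{1..n}. \<exists>e\<in>E. v \<in> e}} =
       {E \<in> nsets (nsets {1..n} d) (m n). E \<in> {E. 1 \<le> min_degree ({1..n}, E)}}"
      using min_degree_ge_1_iff_covers[of n _ d] elim(2) by (auto simp: nsets_def[of "nsets _ _"])
    then show ?case using elim by (simp only: prob_hyp_nm level_fraction_def)
  qed
  with C show "gumbel_window c (\<lambda>n. prob (hyp_nm d n (m n)) {H. min_degree H \<ge> 1})"
    by (rule gumbel_window_cong)
qed

lemma prob_not_eq: "prob M {x. \<not> P x} = 1 - prob M {x. P x}"
  using measure_pmf.prob_compl[of "{x. P x}" M] by (simp add: Collect_neg_eq Compl_eq_Diff_UNIV)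

theorem theorem1p1:
  fixes d :: nat
  assumes "d \<ge> 3"
  shows
    "(\<forall>(c :: nat \<Rightarrow> real) (p :: nat \<Rightarrow> real).
        (\<forall>\<^sub>F n in sequentially.
            p n = fact (d - 1) * (ln (real n) + c n) / real n ^ (d - 1) \<and> 0 \<le> p n \<and> p n \<le> 1) \<longrightarrow>
        (\<forall>c0 :: real. c \<longlonglongrightarrow> c0 \<longrightarrow>
            (\<lambda>n. measure_pmf.prob (hyp_np d n (p n)) {H. weak_hamiltonian H}
                 - measure_pmf.prob (hyp_np d n (p n)) {H. min_degree H \<ge> 1}) \<in> o(\<lambda>_. 1) \<and>
            (\<lambda>n. measure_pmf.prob (hyp_np d n (p n)) {H. weak_hamiltonian H})
               \<longlonglongrightarrow> exp (- exp (- c0))) \<and>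
        (filterlim c at_bot sequentially \<longrightarrow>
            (\<lambda>n. measure_pmf.prob (hyp_np d n (p n)) {H. \<not> weak_hamiltonian H}) \<longlonglongrightarrow> 1) \<and>
        (filterlim c at_top sequentially \<longrightarrow>
            (\<lambda>n. measure_pmf.prob (hyp_np d n (p n)) {H. weak_hamiltonian H}) \<longlonglongrightarrow> 1)) \<and>
     (\<forall>(c :: nat \<Rightarrow> real) (m :: nat \<Rightarrow> nat).
        (\<forall>\<^sub>F n in sequentially.
            real (m n) = real n / real d * (ln (real n) + c n) \<and> m n \<le> n choose d) \<longrightarrow>
        (\<forall>c0 :: real. c \<longlonglongrightarrow> c0 \<longrightarrow>
            (\<lambda>n. measure_pmf.prob (hyp_nm d n (m n)) {H. weak_hamiltonian H}
                 - measure_pmf.prob (hyp_nm d n (m n)) {H. min_degree H \<ge> 1}) \<in> o(\<lambda>_. 1) \<and>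
            (\<lambda>n. measure_pmf.prob (hyp_nm d n (m n)) {H. weak_hamiltonian H})
               \<longlonglongrightarrow> exp (- exp (- c0))) \<and>
        (filterlim c at_bot sequentially \<longrightarrow>
            (\<lambda>n. measure_pmf.prob (hyp_nm d n (m n)) {H. \<not> weak_hamiltonian H}) \<longlonglongrightarrow> 1) \<and>
        (filterlim c at_top sequentially \<longrightarrow>
            (\<lambda>n. measure_pmf.prob (hyp_nm d n (m n)) {H. weak_hamiltonian H}) \<longlonglongrightarrow> 1))"
  unfolding prob_not_eq
  by (rule conjI; (rule allI)+; rule impI; rule gumbel_window_conclusion)
    (assumption | rule assms hyp_np_gumbel_windows hyp_nm_gumbel_windows measure_nonneg
      measure_pmf.prob_le_1)+

end
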